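(* Let $S$ be an embedded Poisson submanifold of a Poisson manifold $(M,\Pi)$, with normal bundle $E=T_SM/TS$, and let $\mathbf e:E\to M$ be an exponential map. Then there exists an infinitesimal Poisson algebra $P_1=(C^\infty_{\mathrm{aff}}(E),\cdot,\{,\}^{\mathrm{aff}})$ which is a first order approximation to $P=(C^\infty(M),\cdot,\{,\}_M)$ around the zero section $S\hookrightarrow E$, in the sense that $$\{\phi_1\circ\mathbf e^{-1},\phi_2\circ\mathbf e^{-1}\}_M\circ\mathbf e=\{\phi_1,\phi_2\}^{\mathrm{aff}}+\mathscr O_2\qquad\text{for all }\phi_1,\phi_2\in C^\infty_{\mathrm{aff}}(E),$$ where $\mathscr O_2$ denotes a function on $E$ vanishing to second order along the zero section (i.e. vanishing there together with its differential).
   Context: **Poisson submanifold.** $\{f,g\}_M=\Pi(\mathrm df,\mathrm dg)$; $\Pi^\natural(\alpha)=\mathbf i_\alpha\Pi$. A submanifold $S$ is Poisson if $\Pi_q\in\wedge^2T_qS$ for all $q\in S$; it then carries the restricted Poisson tensor $\Pi_S$ with bracket $\{,\}_S$. $T_SM=TM|_S$, $T^*_SM=T^*M|_S$; $TS^\circ\subset T^*_SM$ is the annihilator of $TS$. $\pi:E\to S$ is the normal bundle, $\nu:T_SM\to E$ the quotient projection; $\nu^*:E^*\to T_S^*M$ is an isomorphism onto $TS^\circ$. **Infinitesimal data.** The bracket of 1-forms on $M$ is $[\alpha,\beta]_A=\mathbf i_{\Pi^\natural(\alpha)}\mathrm d\beta-\mathbf i_{\Pi^\natural(\beta)}\mathrm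 d\alpha-\mathrm d\langle\alpha,\Pi^\natural(\beta)\rangle$. The restricted Lie algebroid $A_S=(T^*_SM,[,]_{A_S},\Pi^\natural|_S)$ over $S$ has the unique bracket for which the restriction map $\Gamma T^*M\to\Gamma T^*_SM$ is a Lie algebra homomorphism; $TS^\circ$ is an ideal with zero anchor. The fiberwise Lie bracket on $E^*$ is defined by $\nu^*[\eta_1,\eta_2]_{E^*}=[\nu^*\eta_1,\nu^*\eta_2]_{A_S}$. **Affine functions.** $C^\infty_{\mathrm{aff}}(E)=\pi^*C^\infty(S)\oplus C^\infty_{\mathrm{lin}}(E)\simeq C^\infty(S)\oplus\Gamma E^*$, where $f\oplus\eta$ corresponds to $\pi^*f+\ell_\eta$, $\ell_\eta(z)=\langle\eta_{\pi(z)},z\rangle$. Its commutative product is $(f_1\oplus\eta_1)\cdot(f_2\oplus\eta_2)=f_1f_2\oplus(f_1\eta_2+f_2\eta_1)$. On $C^\infty_{\mathrm{lin}}(E)$ there is the Lie bracket $\{\ell_{\eta_1},\ell_{\eta_2}\}^{\mathrm{lin}}=\ell_{[\eta_1,\eta_2]_{E^*}}$. **Infinitesimal Poisson algebra.** A Poisson algebra $(C^\infty_{\mathrm{aff}}(E),\cdot,\{,\}^{\mathrm{aff}})$ with the commutative product $(f_1\oplus\eta_1)\cdot(f_2\oplus\eta_2)=f_1f_2\oplus(f_1\eta_2+f_2\eta_1)$ and a Lie bracket (derivation in each argument) such that (a) the natural projection $C^\infty_{\mathrm{aff}}(E)\to C^\infty(S)$ is a Poisson algebra homomorphism onto $(C^\infty(S),\{,\}_S)$;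 (b) $\{0\oplus\varphi_1,0\oplus\varphi_2\}^{\mathrm{aff}}=0\oplus\{\varphi_1,\varphi_2\}^{\mathrm{lin}}$ for all $\varphi_1,\varphi_2\in C^\infty_{\mathrm{lin}}(E)$. **Exponential map.** A diffeomorphism $\mathbf e$ from $E$ onto a neighborhood of $S$ in $M$ with $\mathbf e|_S=\mathrm{id}_S$ (zero section identified with $S$) and such that $E_q\hookrightarrow T_qE\xrightarrow{\mathrm d_q\mathbf e}T_qM\xrightarrow{\nu_q}E_q$ is the identity for each $q\in S$. The bracket $\{\phi_1\circ\mathbf e^{-1},\phi_2\circ\mathbf e^{-1}\}_M$ is computed on the open set $\mathbf e(E)$. *)

theory Defs
  imports "HOL-Analysis.Analysis" "HOL-Library.Function_Algebras"
begin

section \<open>Function spaces as real vector spaces\<close>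

instantiation "fun" :: (type, real_vector) real_vector
begin

definition scaleR_fun :: "real \<Rightarrow> ('a \<Rightarrow> 'b) \<Rightarrow> 'a \<Rightarrow> 'b"
  where "scaleR_fun r f = (\<lambda>x. r *\<^sub>R f x)"

instance
  by standard (auto simp: scaleR_fun_def fun_eq_iff scaleR_add_right scaleR_add_left)

end

definition dual_space :: "'v::real_vector set \<Rightarrow> ('v \<Rightarrow> real) set"
  where "dual_space V = {\<alpha>. (\<forall>x\<in>V. \<forall>y\<in>V. \<alpha> (x + y) = \<alpha> x + \<alpha> y) \<and>
    (\<forall>r. \<forall>x\<in>V. \<alpha> (r *\<^sub>R x) = r * \<alpha> x) \<and> (\<forall>x. x \<notin> V \<longrightarrow> \<alpha> x = 0)}"

text \<open>Second exterior power of \<open>V\<close>, i.e. the finite sums of decomposables \<open>x \<and> y\<close> with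
  \<open>x, y \<in> V\<close>, realised as bilinear forms on the dual \<open>D\<close> of a space containing \<open>V\<close>.
  The forms are \<open>0\<close> outside \<open>D \<times> D\<close>, so that equality of forms is equality of functions.\<close>

definition bivectors :: "('v::real_vector \<Rightarrow> real) set \<Rightarrow> 'v set
    \<Rightarrow> (('v \<Rightarrow> real) \<Rightarrow> ('v \<Rightarrow> real) \<Rightarrow> real) set"
  where "bivectors D V = {B. \<exists>(n::nat) x y. (\<forall>i<n. x i \<in> V \<and> y i \<in> V) \<and>
    B = (\<lambda>\<alpha> \<beta>. if \<alpha> \<in> D \<and> \<beta> \<in> D
      then \<Sum>i<n. \<alpha> (x i) * \<beta> (y i) - \<alpha> (y i) * \<beta> (x i) else 0)}"

definition bilinear_within :: "'p::real_vector set \<Rightarrow> ('p \<Rightarrow> 'p \<Rightarrow> 'p) \<Rightarrow> bool"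
  where "bilinear_within C b \<longleftrightarrow>
    (\<forall>x\<in>C. \<forall>y\<in>C. b x y \<in> C) \<and>
    (\<forall>x\<in>C. \<forall>y\<in>C. \<forall>z\<in>C. b (x + y) z = b x z + b y z \<and> b z (x + y) = b z x + b z y) \<and>
    (\<forall>r. \<forall>x\<in>C. \<forall>y\<in>C. b (r *\<^sub>R x) y = r *\<^sub>R b x y \<and> b x (r *\<^sub>R y) = r *\<^sub>R b x y)"

definition poisson_algebra ::
    "'p::real_vector set \<Rightarrow> ('p \<Rightarrow> 'p \<Rightarrow> 'p) \<Rightarrow> ('p \<Rightarrow> 'p \<Rightarrow> 'p) \<Rightarrow> bool"
  where "poisson_algebra C mul br \<longleftrightarrow> subspace C \<and>
    bilinear_within C mul \<and>
    (\<forall>x\<in>C. \<forall>y\<in>C. mul x y = mul y x) \<and>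
    (\<forall>x\<in>C. \<forall>y\<in>C. \<forall>z\<in>C. mul (mul x y) z = mul x (mul y z)) \<and>
    bilinear_within C br \<and>
    (\<forall>x\<in>C. \<forall>y\<in>C. br x y = - br y x) \<and>
    (\<forall>x\<in>C. \<forall>y\<in>C. \<forall>z\<in>C. br x (br y z) + br y (br z x) + br z (br x y) = 0) \<and>
    (\<forall>x\<in>C. \<forall>y\<in>C. \<forall>z\<in>C. br x (mul y z) = mul (br x y) z + mul y (br x z)) \<and>
    (\<forall>x\<in>C. \<forall>y\<in>C. \<forall>z\<in>C. br (mul x y) z = mul x (br y z) + mul (br x z) y)"

definition poisson_algebra_hom ::
    "'p::real_vector set \<Rightarrow> ('p \<Rightarrow> 'p \<Rightarrow> 'p) \<Rightarrow> ('p \<Rightarrow> 'p \<Rightarrow> 'p)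
    \<Rightarrow> 'q::real_vector set \<Rightarrow> ('q \<Rightarrow> 'q \<Rightarrow> 'q) \<Rightarrow> ('q \<Rightarrow> 'q \<Rightarrow> 'q) \<Rightarrow> ('p \<Rightarrow> 'q) \<Rightarrow> bool"
  where "poisson_algebra_hom C mul br C' mul' br' h \<longleftrightarrow>
    (\<forall>x\<in>C. h x \<in> C') \<and>
    (\<forall>x\<in>C. \<forall>y\<in>C. h (x + y) = h x + h y) \<and>
    (\<forall>r. \<forall>x\<in>C. h (r *\<^sub>R x) = r *\<^sub>R h x) \<and>
    (\<forall>x\<in>C. \<forall>y\<in>C. h (mul x y) = mul' (h x) (h y)) \<and>
    (\<forall>x\<in>C. \<forall>y\<in>C. h (br x y) = br' (h x) (h y))"


section \<open>Smooth manifolds\<close>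

primrec Ck_on :: "nat \<Rightarrow> 'a::real_normed_vector set \<Rightarrow> ('a \<Rightarrow> 'b::real_normed_vector) \<Rightarrow> bool"
  where
    "Ck_on 0 U f \<longleftrightarrow> continuous_on U f"
  | "Ck_on (Suc k) U f \<longleftrightarrow> (\<forall>x\<in>U. f differentiable (at x)) \<and>
      (\<forall>v. Ck_on k U (\<lambda>x. frechet_derivative f (at x) v))"

text \<open>Smoothness on an arbitrary set means local smooth extendability. On an open set this is
  smoothness; on a (relatively open subset of a) linear subspace it is smoothness in the
  coordinates of the subspace, which gives the usual smooth functions of a submanifold.\<close>

definition smooth_on :: "'a::real_normed_vector set \<Rightarrow> ('a \<Rightarrow> 'b::real_normed_vector) \<Rightarrow> bool"
  where "smooth_on T f \<longleftrightarrow> (\<forall>x\<in>T. \<exists>U g. open U \<and> x \<in> U \<and> (\<forall>k. Ck_on k U g) \<and>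
    (\<forall>y\<in>T \<inter> U. g y = f y))"

text \<open>A chart is a pair of a domain and a coordinate map; the values of the coordinate map outside
  the domain are irrelevant. A manifold is given by its atlas, which determines the points and
  the topology.\<close>

type_synonym ('m, 'a) chart = "'m set \<times> ('m \<Rightarrow> 'a)"

definition chart_inv :: "('m, 'a) chart \<Rightarrow> 'a \<Rightarrow> 'm"
  where "chart_inv c = inv_into (fst c) (snd c)"

definition points :: "('m, 'a) chart set \<Rightarrow> 'm set"
  where "points M = (\<Union>c\<in>M. fst c)"

definition smooth_atlas :: "('m, 'a::euclidean_space) chart set \<Rightarrow> bool"
  where "smooth_atlas M \<longleftrightarrow>
    (\<forall>c\<in>M. inj_on (snd c) (fst c) \<and> open (snd c ` fst c)) \<and>
    (\<forall>c\<in>M. \<forall>d\<in>M. open (snd c ` (fst c \<inter> fst d)) \<and>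
      smooth_on (snd c ` (fst c \<inter> fst d)) (snd d \<circ> chart_inv c))"

definition atlas_topology :: "('m, 'a::euclidean_space) chart set \<Rightarrow> 'm topology"
  where "atlas_topology M =
    topology (\<lambda>W. W \<subseteq> points M \<and> (\<forall>c\<in>M. open (snd c ` (W \<inter> fst c))))"

definition smooth_manifold :: "('m, 'a::euclidean_space) chart set \<Rightarrow> bool"
  where "smooth_manifold M \<longleftrightarrow> smooth_atlas M \<and>
    (\<forall>c. fst c \<subseteq> points M \<and> smooth_atlas (insert c M) \<longrightarrow> c \<in> M) \<and>
    Hausdorff_space (atlas_topology M) \<and> second_countable (atlas_topology M)"

definition restrict_atlas :: "('m, 'a) chart set \<Rightarrow> 'm set \<Rightarrow> ('m, 'a) chart set"
  where "restrict_atlas M W = (\<lambda>c. (fst c \<inter> W, snd c)) ` M"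

definition chart_at :: "('m, 'a) chart set \<Rightarrow> 'm \<Rightarrow> ('m, 'a) chart"
  where "chart_at M q = (SOME c. c \<in> M \<and> q \<in> fst c)"

definition smooth_fun :: "('m, 'a::euclidean_space) chart set \<Rightarrow> 'm set \<Rightarrow> ('m \<Rightarrow> real) \<Rightarrow> bool"
  where "smooth_fun M T f \<longleftrightarrow> (\<forall>c\<in>M. smooth_on (snd c ` (T \<inter> fst c)) (f \<circ> chart_inv c))"

text \<open>Functions (and, below, sections) on a subset \<open>T\<close> of the points are represented by functions
  that are \<open>0\<close> outside \<open>T\<close>, so that they form vector spaces under the pointwise operations.\<close>

definition smooth_functions :: "('m, 'a::euclidean_space) chart set \<Rightarrow> 'm set \<Rightarrow> ('m \<Rightarrow> real) set"
  where "smooth_functions M T = {f. smooth_fun M T f \<and> (\<forall>q. q \<notin> T \<longrightarrow> f q = 0)}"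

definition smooth_map ::
    "('m, 'a::euclidean_space) chart set \<Rightarrow> ('n, 'b::euclidean_space) chart set \<Rightarrow> ('m \<Rightarrow> 'n) \<Rightarrow> bool"
  where "smooth_map M N f \<longleftrightarrow> continuous_map (atlas_topology M) (atlas_topology N) f \<and>
    (\<forall>c\<in>M. \<forall>d\<in>N. smooth_on (snd c ` {p \<in> fst c. f p \<in> fst d}) (snd d \<circ> f \<circ> chart_inv c))"


section \<open>Tangent and cotangent spaces\<close>

text \<open>A tangent vector at \<open>q\<close> is the family of its coordinate representations in all charts around
  \<open>q\<close>, related by the differentials of the chart transitions.\<close>

type_synonym ('m, 'a) tvec = "('m, 'a) chart \<Rightarrow> 'a"
type_synonym ('m, 'a) covec = "('m, 'a) tvec \<Rightarrow> real"

definition tangent_space :: "('m, 'a::euclidean_space) chart set \<Rightarrow> 'm \<Rightarrow> ('m, 'a) tvec set"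
  where "tangent_space M q = {X.
    (\<forall>c\<in>M. \<forall>d\<in>M. q \<in> fst c \<longrightarrow> q \<in> fst d \<longrightarrow>
      X d = frechet_derivative (snd d \<circ> chart_inv c) (at (snd c q)) (X c)) \<and>
    (\<forall>c. \<not> (c \<in> M \<and> q \<in> fst c) \<longrightarrow> X c = 0)}"

abbreviation cotangent_space :: "('m, 'a::euclidean_space) chart set \<Rightarrow> 'm \<Rightarrow> ('m, 'a) covec set"
  where "cotangent_space M q \<equiv> dual_space (tangent_space M q)"

text \<open>The constant coordinate vector field \<open>v\<close> and the constant coordinate 1-form
  \<open>X \<mapsto> v \<bullet> X\<close> of the chart \<open>c\<close>, at \<open>q\<close>.\<close>

definition coord_vec ::
    "('m, 'a::euclidean_space) chart set \<Rightarrow> ('m, 'a) chart \<Rightarrow> 'a \<Rightarrow> 'm \<Rightarrow> ('m, 'a) tvec"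
  where "coord_vec M c v q = (\<lambda>d. if d \<in> M \<and> q \<in> fst d
    then frechet_derivative (snd d \<circ> chart_inv c) (at (snd c q)) v else 0)"

definition coord_covec ::
    "('m, 'a::euclidean_space) chart set \<Rightarrow> ('m, 'a) chart \<Rightarrow> 'a \<Rightarrow> 'm \<Rightarrow> ('m, 'a) covec"
  where "coord_covec M c v q = (\<lambda>X. if X \<in> tangent_space M q then v \<bullet> X c else 0)"

definition differential ::
    "('m, 'a::euclidean_space) chart set \<Rightarrow> ('m \<Rightarrow> real) \<Rightarrow> 'm \<Rightarrow> ('m, 'a) covec"
  where "differential M f q = (\<lambda>X. if X \<in> tangent_space M q
    then (let c = chart_at M q in frechet_derivative (f \<circ> chart_inv c) (at (snd c q)) (X c))
    else 0)"

definition tangent_map ::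
    "('m, 'a::euclidean_space) chart set \<Rightarrow> ('n, 'b::euclidean_space) chart set \<Rightarrow> ('m \<Rightarrow> 'n) \<Rightarrow> 'm
    \<Rightarrow> ('m, 'a) tvec \<Rightarrow> ('n, 'b) tvec"
  where "tangent_map M N f q X = (\<lambda>d. if d \<in> N \<and> f q \<in> fst d
    then (let c = chart_at M q in
      frechet_derivative (snd d \<circ> f \<circ> chart_inv c) (at (snd c q)) (X c))
    else 0)"

definition velocity :: "('m, 'a::euclidean_space) chart set \<Rightarrow> (real \<Rightarrow> 'm) \<Rightarrow> ('m, 'a) tvec"
  where "velocity M \<gamma> = (\<lambda>c. if c \<in> M \<and> \<gamma> 0 \<in> fst c
    then vector_derivative (\<lambda>t. snd c (\<gamma> t)) (at 0) else 0)"

text \<open>Smooth sections of the restriction of the cotangent bundle to \<open>T\<close>; the 1-forms on the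
  manifold are the case \<open>T = points M\<close>.\<close>

definition covector_fields ::
    "('m, 'a::euclidean_space) chart set \<Rightarrow> 'm set \<Rightarrow> ('m \<Rightarrow> ('m, 'a) covec) set"
  where "covector_fields M T = {\<alpha>. (\<forall>q\<in>T. \<alpha> q \<in> cotangent_space M q) \<and>
    (\<forall>c\<in>M. \<forall>v. smooth_on (snd c ` (T \<inter> fst c))
      ((\<lambda>q. \<alpha> q (coord_vec M c v q)) \<circ> chart_inv c)) \<and>
    (\<forall>q. q \<notin> T \<longrightarrow> \<alpha> q = 0)}"

text \<open>Exterior derivative of a 1-form at a point,
  \<open>d\<beta>(X, Y) = X (\<beta>(Y)) - Y (\<beta>(X))\<close> for extensions of \<open>X\<close> and \<open>Y\<close> to (commuting)
  constant coordinate vector fields.\<close>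

definition ext_deriv ::
    "('m, 'a::euclidean_space) chart set \<Rightarrow> ('m \<Rightarrow> ('m, 'a) covec) \<Rightarrow> 'm
    \<Rightarrow> ('m, 'a) tvec \<Rightarrow> ('m, 'a) tvec \<Rightarrow> real"
  where "ext_deriv M \<beta> q X Y = (let c = chart_at M q in
    frechet_derivative ((\<lambda>p. \<beta> p (coord_vec M c (Y c) p)) \<circ> chart_inv c) (at (snd c q)) (X c) -
    frechet_derivative ((\<lambda>p. \<beta> p (coord_vec M c (X c) p)) \<circ> chart_inv c) (at (snd c q)) (Y c))"


section \<open>Poisson manifolds\<close>

type_synonym ('m, 'a) tensor = "'m \<Rightarrow> ('m, 'a) covec \<Rightarrow> ('m, 'a) covec \<Rightarrow> real"

definition poisson_bracket :: "('m, 'a::euclidean_space) chart set \<Rightarrow> ('m, 'a) tensor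
    \<Rightarrow> ('m \<Rightarrow> real) \<Rightarrow> ('m \<Rightarrow> real) \<Rightarrow> 'm \<Rightarrow> real"
  where "poisson_bracket M \<pi> f g q =
    (if q \<in> points M then \<pi> q (differential M f q) (differential M g q) else 0)"

definition poisson_manifold ::
    "('m, 'a::euclidean_space) chart set \<Rightarrow> ('m, 'a) tensor \<Rightarrow> bool"
  where "poisson_manifold M \<pi> \<longleftrightarrow> smooth_manifold M \<and>
    (\<forall>q\<in>points M. \<pi> q \<in> bivectors (cotangent_space M q) (tangent_space M q)) \<and>
    (\<forall>c\<in>M. \<forall>u v. smooth_on (snd c ` fst c)
      ((\<lambda>q. \<pi> q (coord_covec M c u q) (coord_covec M c v q)) \<circ> chart_inv c)) \<and>
    (\<forall>f\<in>smooth_functions M (points M). \<forall>g\<in>smooth_functions M (points M).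
      \<forall>h\<in>smooth_functions M (points M).
      poisson_bracket M \<pi> f (poisson_bracket M \<pi> g h) +
      poisson_bracket M \<pi> g (poisson_bracket M \<pi> h f) +
      poisson_bracket M \<pi> h (poisson_bracket M \<pi> f g) = 0)"

definition sharp :: "('m, 'a::euclidean_space) chart set \<Rightarrow> ('m, 'a) tensor \<Rightarrow> 'm
    \<Rightarrow> ('m, 'a) covec \<Rightarrow> ('m, 'a) tvec"
  where "sharp M \<pi> q \<alpha> =
    (THE X. X \<in> tangent_space M q \<and> (\<forall>\<beta>\<in>cotangent_space M q. \<beta> X = \<pi> q \<alpha> \<beta>))"

text \<open>The bracket \<open>[\<alpha>, \<beta>]\<^sub>A\<close> of 1-forms.\<close>

definition form_bracket :: "('m, 'a::euclidean_space) chart set \<Rightarrow> ('m, 'a) tensor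
    \<Rightarrow> ('m \<Rightarrow> ('m, 'a) covec) \<Rightarrow> ('m \<Rightarrow> ('m, 'a) covec) \<Rightarrow> 'm \<Rightarrow> ('m, 'a) covec"
  where "form_bracket M \<pi> \<alpha> \<beta> q = (\<lambda>X. if q \<in> points M \<and> X \<in> tangent_space M q
    then ext_deriv M \<beta> q (sharp M \<pi> q (\<alpha> q)) X - ext_deriv M \<alpha> q (sharp M \<pi> q (\<beta> q)) X
      - differential M (\<lambda>p. \<alpha> p (sharp M \<pi> p (\<beta> p))) q X
    else 0)"


section \<open>Poisson submanifolds\<close>

definition slice_chart ::
    "('m, 'a::euclidean_space) chart set \<Rightarrow> 'm set \<Rightarrow> ('m, 'a) chart \<Rightarrow> 'a set \<Rightarrow> bool"
  where "slice_chart M S c W \<longleftrightarrow> c \<in> M \<and> subspace W \<and>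
    snd c ` (fst c \<inter> S) = snd c ` fst c \<inter> W"

definition embedded_submanifold :: "('m, 'a::euclidean_space) chart set \<Rightarrow> 'm set \<Rightarrow> bool"
  where "embedded_submanifold M S \<longleftrightarrow> S \<subseteq> points M \<and>
    (\<exists>k. \<forall>q\<in>S. \<exists>c W. slice_chart M S c W \<and> q \<in> fst c \<and> dim W = k)"

definition tangent_subspace ::
    "('m, 'a::euclidean_space) chart set \<Rightarrow> 'm set \<Rightarrow> 'm \<Rightarrow> ('m, 'a) tvec set"
  where "tangent_subspace M S q =
    {X \<in> tangent_space M q. \<forall>c W. slice_chart M S c W \<and> q \<in> fst c \<longrightarrow> X c \<in> W}"

definition poisson_submanifold ::
    "('m, 'a::euclidean_space) chart set \<Rightarrow> ('m, 'a) tensor \<Rightarrow> 'm set \<Rightarrow> bool"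
  where "poisson_submanifold M \<pi> S \<longleftrightarrow> embedded_submanifold M S \<and>
    (\<forall>q\<in>S. \<pi> q \<in> bivectors (cotangent_space M q) (tangent_subspace M S q))"

text \<open>The differential of a function on \<open>S\<close>, and the element of the second exterior power of
  \<open>T\<^sub>qS\<close> whose image under the inclusion into \<open>T\<^sub>qM\<close> is \<open>\<pi> q\<close>.\<close>

definition sub_differential :: "('m, 'a::euclidean_space) chart set \<Rightarrow> 'm set
    \<Rightarrow> ('m \<Rightarrow> real) \<Rightarrow> 'm \<Rightarrow> ('m, 'a) covec"
  where "sub_differential M S f q = (\<lambda>X. if X \<in> tangent_subspace M S q
    then (let (c, W) = (SOME (c, W). slice_chart M S c W \<and> q \<in> fst c) in
      frechet_derivative (f \<circ> chart_inv c) (at (snd c q) within W) (X c))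
    else 0)"

definition restricted_tensor :: "('m, 'a::euclidean_space) chart set \<Rightarrow> ('m, 'a) tensor \<Rightarrow> 'm set
    \<Rightarrow> ('m, 'a) tensor"
  where "restricted_tensor M \<pi> S q = (THE B.
    B \<in> bivectors (dual_space (tangent_subspace M S q)) (tangent_subspace M S q) \<and>
    (\<forall>\<alpha>\<in>cotangent_space M q. \<forall>\<beta>\<in>cotangent_space M q.
      B (\<lambda>X. if X \<in> tangent_subspace M S q then \<alpha> X else 0)
        (\<lambda>X. if X \<in> tangent_subspace M S q then \<beta> X else 0) = \<pi> q \<alpha> \<beta>))"

definition sub_bracket :: "('m, 'a::euclidean_space) chart set \<Rightarrow> ('m, 'a) tensor \<Rightarrow> 'm set
    \<Rightarrow> ('m \<Rightarrow> real) \<Rightarrow> ('m \<Rightarrow> real) \<Rightarrow> 'm \<Rightarrow> real"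
  where "sub_bracket M \<pi> S f g q = (if q \<in> S
    then restricted_tensor M \<pi> S q (sub_differential M S f q) (sub_differential M S g q) else 0)"

text \<open>The bracket of the restricted Lie algebroid. Sections over a non-closed \<open>S\<close> need not extend to
  \<open>M\<close>, but they do so near any point of \<open>S\<close>; the bracket at \<open>q\<close> is the restriction of the
  bracket of any such extensions.\<close>

definition AS_bracket :: "('m, 'a::euclidean_space) chart set \<Rightarrow> ('m, 'a) tensor \<Rightarrow> 'm set
    \<Rightarrow> ('m \<Rightarrow> ('m, 'a) covec) \<Rightarrow> ('m \<Rightarrow> ('m, 'a) covec) \<Rightarrow> 'm \<Rightarrow> ('m, 'a) covec"
  where "AS_bracket M \<pi> S a b q = (if q \<in> S
    then (THE \<omega>. \<exists>\<alpha>\<in>covector_fields M (points M). \<exists>\<beta>\<in>covector_fields M (points M).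
      \<exists>W. openin (atlas_topology M) W \<and> q \<in> W \<and>
        (\<forall>p\<in>W \<inter> S. \<alpha> p = a p \<and> \<beta> p = b p) \<and> \<omega> = form_bracket M \<pi> \<alpha> \<beta> q)
    else 0)"


section \<open>The normal bundle\<close>

text \<open>Elements of \<open>E\<^sub>q = T\<^sub>qM / T\<^sub>qS\<close> are cosets, and \<open>E\<close> consists of pairs of a point \<open>q\<close> and
  an element of \<open>E\<^sub>q\<close>.\<close>

definition normal_class ::
    "('m, 'a::euclidean_space) chart set \<Rightarrow> 'm set \<Rightarrow> 'm \<Rightarrow> ('m, 'a) tvec \<Rightarrow> ('m, 'a) tvec set"
  where "normal_class M S q X = (\<lambda>Y. X + Y) ` tangent_subspace M S q"

definition normal_space ::
    "('m, 'a::euclidean_space) chart set \<Rightarrow> 'm set \<Rightarrow> 'm \<Rightarrow> ('m, 'a) tvec set set"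
  where "normal_space M S q = normal_class M S q ` tangent_space M q"

definition normal_bundle ::
    "('m, 'a::euclidean_space) chart set \<Rightarrow> 'm set \<Rightarrow> ('m \<times> ('m, 'a) tvec set) set"
  where "normal_bundle M S = Sigma S (normal_space M S)"

definition normal_scale :: "('m, 'a::euclidean_space) chart set \<Rightarrow> 'm set \<Rightarrow> 'm
    \<Rightarrow> real \<Rightarrow> ('m, 'a) tvec set \<Rightarrow> ('m, 'a) tvec set"
  where "normal_scale M S q r z = (\<Union>X\<in>z. normal_class M S q (r *\<^sub>R X))"

definition zero_section ::
    "('m, 'a::euclidean_space) chart set \<Rightarrow> 'm set \<Rightarrow> 'm \<Rightarrow> 'm \<times> ('m, 'a) tvec set"
  where "zero_section M S q = (q, normal_class M S q 0)"

text \<open>A slice chart \<open>(c, W)\<close> of \<open>M\<close> gives a bundle chart of \<open>E\<close>: the fibre over \<open>q\<close> is the quotient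
  of the model space by \<open>W\<close>, which is identified with the orthogonal complement of \<open>W\<close>.\<close>

definition normal_chart :: "'m set \<Rightarrow> ('m, 'a::euclidean_space) chart set
    \<Rightarrow> ('m, 'a) chart \<Rightarrow> 'a set \<Rightarrow> ('m \<times> ('m, 'a) tvec set, 'a) chart"
  where "normal_chart S M c W = ({z \<in> normal_bundle M S. fst z \<in> fst c},
    \<lambda>z. snd c (fst z) + (THE v. v \<in> orthogonal_comp W \<and> v \<in> (\<lambda>X. X c) ` snd z))"

definition normal_atlas :: "('m, 'a::euclidean_space) chart set \<Rightarrow> 'm set
    \<Rightarrow> ('m \<times> ('m, 'a) tvec set, 'a) chart set"
  where "normal_atlas M S = {normal_chart S M c W | c W. slice_chart M S c W}"

text \<open>Smooth sections of \<open>E\<^sup>*\<close>: the fibres consist of the linear functionals on the quotient, and a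
  section is smooth if its pairings with the local spanning sections of \<open>E\<close> induced by the
  coordinate vector fields are.\<close>

definition conormal_space ::
    "('m, 'a::euclidean_space) chart set \<Rightarrow> 'm set \<Rightarrow> 'm \<Rightarrow> (('m, 'a) tvec set \<Rightarrow> real) set"
  where "conormal_space M S q = {\<xi>.
    (\<forall>X\<in>tangent_space M q. \<forall>Y\<in>tangent_space M q.
      \<xi> (normal_class M S q (X + Y)) = \<xi> (normal_class M S q X) + \<xi> (normal_class M S q Y)) \<and>
    (\<forall>r. \<forall>X\<in>tangent_space M q.
      \<xi> (normal_class M S q (r *\<^sub>R X)) = r * \<xi> (normal_class M S q X)) \<and>
    (\<forall>z. z \<notin> normal_space M S q \<longrightarrow> \<xi> z = 0)}"

definition conormal_sections ::
    "('m, 'a::euclidean_space) chart set \<Rightarrow> 'm set \<Rightarrow> ('m \<Rightarrow> ('m, 'a) tvec set \<Rightarrow> real) set"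
  where "conormal_sections M S = {\<eta>. (\<forall>q\<in>S. \<eta> q \<in> conormal_space M S q) \<and>
    (\<forall>c\<in>M. \<forall>v. smooth_on (snd c ` (S \<inter> fst c))
      ((\<lambda>q. \<eta> q (normal_class M S q (coord_vec M c v q))) \<circ> chart_inv c)) \<and>
    (\<forall>q. q \<notin> S \<longrightarrow> \<eta> q = 0)}"

definition nu_dual :: "('m, 'a::euclidean_space) chart set \<Rightarrow> 'm set \<Rightarrow> 'm
    \<Rightarrow> (('m, 'a) tvec set \<Rightarrow> real) \<Rightarrow> ('m, 'a) covec"
  where "nu_dual M S q \<xi> = (\<lambda>X. if X \<in> tangent_space M q then \<xi> (normal_class M S q X) else 0)"

text \<open>The bracket on sections of \<open>E\<^sup>*\<close> determined by
  \<open>\<nu>\<^sup>*[\<eta>\<^sub>1, \<eta>\<^sub>2] = [\<nu>\<^sup>*\<eta>\<^sub>1, \<nu>\<^sup>*\<eta>\<^sub>2]\<close>.\<close>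

definition conormal_bracket :: "('m, 'a::euclidean_space) chart set \<Rightarrow> ('m, 'a) tensor \<Rightarrow> 'm set
    \<Rightarrow> ('m \<Rightarrow> ('m, 'a) tvec set \<Rightarrow> real) \<Rightarrow> ('m \<Rightarrow> ('m, 'a) tvec set \<Rightarrow> real)
    \<Rightarrow> 'm \<Rightarrow> ('m, 'a) tvec set \<Rightarrow> real"
  where "conormal_bracket M \<pi> S \<eta>1 \<eta>2 q = (if q \<in> S
    then (THE \<xi>. \<xi> \<in> conormal_space M S q \<and> nu_dual M S q \<xi> =
      AS_bracket M \<pi> S (\<lambda>p. if p \<in> S then nu_dual M S p (\<eta>1 p) else 0)
        (\<lambda>p. if p \<in> S then nu_dual M S p (\<eta>2 p) else 0) q)
    else 0)"


section \<open>Infinitesimal Poisson algebras\<close>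

type_synonym ('m, 'a) affine = "('m \<Rightarrow> real) \<times> ('m \<Rightarrow> ('m, 'a) tvec set \<Rightarrow> real)"

text \<open>Fibrewise affine functions on \<open>E\<close>, written as pairs \<open>f \<oplus> \<eta>\<close>; the function on \<open>E\<close> that
  corresponds to such a pair is \<open>affine_fun\<close>.\<close>

definition affine_functions ::
    "('m, 'a::euclidean_space) chart set \<Rightarrow> 'm set \<Rightarrow> ('m, 'a) affine set"
  where "affine_functions M S = smooth_functions M S \<times> conormal_sections M S"

definition affine_fun :: "('m, 'a::euclidean_space) affine \<Rightarrow> 'm \<times> ('m, 'a) tvec set \<Rightarrow> real"
  where "affine_fun \<phi> z = fst \<phi> (fst z) + snd \<phi> (fst z) (snd z)"

definition affine_mult ::
    "('m, 'a::euclidean_space) affine \<Rightarrow> ('m, 'a) affine \<Rightarrow> ('m, 'a) affine"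
  where "affine_mult \<phi> \<psi> =
    (fst \<phi> * fst \<psi>, \<lambda>q. fst \<phi> q *\<^sub>R snd \<psi> q + fst \<psi> q *\<^sub>R snd \<phi> q)"

definition infinitesimal_poisson_algebra ::
    "('m, 'a::euclidean_space) chart set \<Rightarrow> ('m, 'a) tensor \<Rightarrow> 'm set
    \<Rightarrow> (('m, 'a) affine \<Rightarrow> ('m, 'a) affine \<Rightarrow> ('m, 'a) affine) \<Rightarrow> bool"
  where "infinitesimal_poisson_algebra M \<pi> S br \<longleftrightarrow>
    poisson_algebra (affine_functions M S) affine_mult br \<and>
    poisson_algebra_hom (affine_functions M S) affine_mult br
      (smooth_functions M S) (*) (sub_bracket M \<pi> S) fst \<and>
    fst ` affine_functions M S = smooth_functions M S \<and>
    (\<forall>\<eta>1\<in>conormal_sections M S. \<forall>\<eta>2\<in>conormal_sections M S.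
      br (0, \<eta>1) (0, \<eta>2) = (0, conormal_bracket M \<pi> S \<eta>1 \<eta>2))"


section \<open>Exponential maps and first order approximation\<close>

text \<open>The last condition: the velocity at \<open>t = 0\<close> of \<open>t \<mapsto> t z\<close> is the image of \<open>z\<close> under the
  inclusion of \<open>E\<^sub>q\<close> into the tangent space of \<open>E\<close> at the zero of \<open>E\<^sub>q\<close>.\<close>

definition exponential_map :: "('m, 'a::euclidean_space) chart set \<Rightarrow> 'm set
    \<Rightarrow> ('m \<times> ('m, 'a) tvec set \<Rightarrow> 'm) \<Rightarrow> bool"
  where "exponential_map M S e \<longleftrightarrow>
    openin (atlas_topology M) (e ` normal_bundle M S) \<and>
    inj_on e (normal_bundle M S) \<and>
    smooth_map (normal_atlas M S) (restrict_atlas M (e ` normal_bundle M S)) e \<and>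
    smooth_map (restrict_atlas M (e ` normal_bundle M S)) (normal_atlas M S)
      (inv_into (normal_bundle M S) e) \<and>
    (\<forall>q\<in>S. e (zero_section M S q) = q) \<and>
    (\<forall>q\<in>S. \<forall>z\<in>normal_space M S q.
      normal_class M S q (tangent_map (normal_atlas M S) M e (zero_section M S q)
        (velocity (normal_atlas M S) (\<lambda>t. (q, normal_scale M S q t z)))) = z)"

definition vanishes_to_second_order :: "('m, 'a::euclidean_space) chart set \<Rightarrow> 'm set
    \<Rightarrow> ('m \<times> ('m, 'a) tvec set \<Rightarrow> real) \<Rightarrow> bool"
  where "vanishes_to_second_order M S h \<longleftrightarrow>
    smooth_fun (normal_atlas M S) (normal_bundle M S) h \<and>
    (\<forall>q\<in>S. h (zero_section M S q) = 0 \<and>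
      differential (normal_atlas M S) h (zero_section M S q) = 0)"

definition first_order_approximation :: "('m, 'a::euclidean_space) chart set \<Rightarrow> ('m, 'a) tensor
    \<Rightarrow> 'm set \<Rightarrow> ('m \<times> ('m, 'a) tvec set \<Rightarrow> 'm)
    \<Rightarrow> (('m, 'a) affine \<Rightarrow> ('m, 'a) affine \<Rightarrow> ('m, 'a) affine) \<Rightarrow> bool"
  where "first_order_approximation M \<pi> S e br \<longleftrightarrow>
    (\<forall>\<phi>1\<in>affine_functions M S. \<forall>\<phi>2\<in>affine_functions M S.
      vanishes_to_second_order M S (\<lambda>z.
        poisson_bracket M \<pi> (affine_fun \<phi>1 \<circ> inv_into (normal_bundle M S) e)
          (affine_fun \<phi>2 \<circ> inv_into (normal_bundle M S) e) (e z)
        - affine_fun (br \<phi>1 \<phi>2) z))"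

end

theory Submission
  imports Defs
begin

text \<open>Let \<open>\<rho>\<close> be the retraction of \<open>e(E)\<close> onto \<open>S\<close> that corresponds to the bundle projection. A
  function \<open>F\<close> on \<open>e(E)\<close> has a first order jet along \<open>S\<close>:
  its restriction to \<open>S\<close> together with the conormal section induced by the
  differential of \<open>F - F \<circ> \<rho>\<close>, which vanishes on \<open>S\<close>. The normalisation of \<open>d e\<close> along the fibres says
  that the jet of (the function induced by) an affine function is that affine function. The bracket
  of two affine functions is the jet of the Poisson bracket of the induced functions.

  In coordinates, \<open>[\<alpha>, \<beta>]\<^sub>A\<close> at a point of \<open>S\<close> involves derivatives of \<open>\<alpha>\<close> and \<open>\<beta>\<close> only in the
  directions of their images under \<open>\<Pi>\<close>, which are tangent to \<open>S\<close>; so it depends only on the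
  restrictions of \<open>\<alpha>\<close> and \<open>\<beta>\<close> to \<open>S\<close>. Since \<open>d{F, H} = [dF, dH]\<^sub>A\<close>, the jet of \<open>{F, H}\<close> depends only
  on the jets of \<open>F\<close> and \<open>H\<close>. Hence the Jacobi identity and the Leibniz rule pass to jets, and the
  bracket of fibrewise linear functions is the one of the restricted Lie algebroid.\<close>

section \<open>Smooth functions on Euclidean spaces\<close>

text \<open>\<open>jet\<close> is an algebra homomorphism from the smooth functions on e(E) onto the
  affine functions, with kernel the functions that vanish to second order along S, and
  \<open>pushed\<close> is a linear section of it. The section alone cannot carry the structure:
  brackets of pushed functions need not be pushed functions, and \<open>pushed\<close> does not
  respect the product (two fibrewise linear functions multiply to a quadratic one, not to zero). The
  kernel is stable under {., H}, so the bracket descends to the quotient and identities may be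
  checked on arbitrary representatives (\<open>aff_bracket_jet\<close>); the Jacobi identity depends
  on this, its inner brackets not being pushed functions. A second obstacle is that the Jacobi
  identity on M and the algebroid bracket are formulated with objects on all of M, while pushed
  functions live on e(E) only. Hence everything is localised, and cutoffs built from exp(-1/x) turn
  germs into global functions. Forms meet functions in the closedness of exact forms, which rests on
  the symmetry of second derivatives.\<close>

lemma Ck_on_subset: "Ck_on k U f \<Longrightarrow> V \<subseteq> U \<Longrightarrow> Ck_on k V f"
  by (induction k arbitrary: f) (auto intro: continuous_on_subset)

lemma Ck_on_cong:
  assumes "open U" "Ck_on k U f" "\<And>x. x \<in> U \<Longrightarrow> f x = g x"
  shows "Ck_on k U g"
  using assms(2,3)
proof (induction k arbitrary: f g)
  case 0
  then show ?case by (metis Ck_on.simps(1) continuous_on_cong)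
next
  case (Suc k)
  have d: "f differentiable (at x)" if "x \<in> U" for x
    using Suc.prems that by auto
  have "g differentiable (at x)" if "x \<in> U" for x
    using d[OF that] has_derivative_transform_within_open[OF _ assms(1) that, of f _ UNIV g] Suc.prems(2)
    unfolding differentiable_def by auto
  moreover have "frechet_derivative f (at x) v = frechet_derivative g (at x) v" if "x \<in> U" for x v
    using frechet_derivative_transform_within_open[OF d[OF that] assms(1) that, of g] Suc.prems(2) by auto
  ultimately show ?case
    using Suc.IH Suc.prems by (metis (no_types, lifting) Ck_on.simps(2))
qed

lemma Ck_on_Suc_imp: "Ck_on (Suc k) U f \<Longrightarrow> Ck_on k U f"
proof (induction k arbitrary: f)
  case 0
  then show ?case
    by (auto intro!: continuous_at_imp_continuous_on differentiable_imp_continuous_within)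
next
  case (Suc k)
  then show ?case by (metis Ck_on.simps(2))
qed

text \<open>The entry point of the inductions on k below: the derivative is given as an explicit
  expression \<open>f' x v\<close>, which for fixed v is left to the induction hypothesis.\<close>

lemma Ck_on_SucI:
  assumes "open U" "\<And>x. x \<in> U \<Longrightarrow> (f has_derivative f' x) (at x)"
    and "\<And>v. Ck_on k U (\<lambda>x. f' x v)"
  shows "Ck_on (Suc k) U f"
proof -
  have "frechet_derivative f (at x) = f' x" if "x \<in> U" for x
    using assms(2)[OF that] frechet_derivative_at by metis
  then have "Ck_on k U (\<lambda>x. frechet_derivative f (at x) v)" for v
    using Ck_on_cong[OF assms(1) assms(3)[of v], of "\<lambda>x. frechet_derivative f (at x) v"] by simp
  then show ?thesis using assms(2) by (auto simp: differentiable_def)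
qed

lemma Ck_on_has_derivative:
  "Ck_on (Suc k) U f \<Longrightarrow> x \<in> U \<Longrightarrow> (f has_derivative frechet_derivative f (at x)) (at x)"
  by (simp add: frechet_derivative_works)

lemma Ck_on_const: "open U \<Longrightarrow> Ck_on k U (\<lambda>x. c)"
proof (induction k arbitrary: c)
  case (Suc k)
  then show ?case by (intro Ck_on_SucI[where f' = "\<lambda>x v. 0"]) auto
qed auto

lemma Ck_on_bounded_linear:
  assumes "open U" "bounded_linear h"
  shows "Ck_on k U h"
proof (cases k)
  case (Suc j)
  show ?thesis unfolding Suc
    by (intro Ck_on_SucI[where f' = "\<lambda>x. h"] assms Ck_on_const bounded_linear_imp_has_derivative)
qed (simp add: assms linear_continuous_on)

lemma Ck_on_add:
  assumes "open U"
  shows "Ck_on k U f \<Longrightarrow> Ck_on k U g \<Longrightarrow> Ck_on k U (\<lambda>x. f x + g x)"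
proof (induction k arbitrary: f g)
  case 0
  then show ?case by (auto intro: continuous_intros)
next
  case (Suc k)
  show ?case
    by (rule Ck_on_SucI[where f' = "\<lambda>x v. frechet_derivative f (at x) v + frechet_derivative g (at x) v"])
      (use Suc assms in \<open>auto intro!: has_derivative_add simp: frechet_derivative_works[symmetric]\<close>)
qed

text \<open>Stated for any bounded bilinear map so that real products, scalar multiples and inner
  products are covered at once.\<close>

lemma Ck_on_bilinear:
  assumes "bounded_bilinear p" "open U"
  shows "Ck_on k U f \<Longrightarrow> Ck_on k U g \<Longrightarrow> Ck_on k U (\<lambda>x. p (f x) (g x))"
proof (induction k arbitrary: f g)
  case 0
  then show ?case by (auto intro: bounded_bilinear.continuous_on[OF assms(1)])
next
  case (Suc k)
  show ?case
  proof (rule Ck_on_SucI[OF assms(2)])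
    fix x assume "x \<in> U"
    then show "((\<lambda>x. p (f x) (g x)) has_derivative
        (\<lambda>v. p (f x) (frechet_derivative g (at x) v) + p (frechet_derivative f (at x) v) (g x))) (at x)"
      by (intro bounded_bilinear.FDERIV[OF assms(1)] Ck_on_has_derivative[OF Suc.prems(1)]
          Ck_on_has_derivative[OF Suc.prems(2)])
  next
    fix v
    show "Ck_on k U (\<lambda>x. p (f x) (frechet_derivative g (at x) v) + p (frechet_derivative f (at x) v) (g x))"
      using Suc.prems by (intro Ck_on_add assms Suc.IH Ck_on_Suc_imp[OF Suc.prems(1)]
          Ck_on_Suc_imp[OF Suc.prems(2)]) auto
  qed
qed

lemma Ck_on_sum:
  "open U \<Longrightarrow> (\<And>i. i \<in> I \<Longrightarrow> Ck_on k U (f i)) \<Longrightarrow> Ck_on k U (\<lambda>x. \<Sum>i\<in>I. f i x)"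
  by (induction I rule: infinite_finite_induct) (auto intro: Ck_on_const Ck_on_add)

lemma linear_basis_expansion:
  fixes v :: "'a::euclidean_space"
  shows "linear h \<Longrightarrow> h v = (\<Sum>b\<in>Basis. (v \<bullet> b) *\<^sub>R h b)"
  by (metis (no_types, lifting) euclidean_representation linear_scale linear_sum sum.cong)

text \<open>\<open>Ck_on\<close> controls the derivative of g in fixed directions only, whereas the
  chain rule applies it to the direction Df(x) v, which moves with x. Expanding this direction in a
  basis turns the derivative into a finite sum of products of C^k functions; hence the Euclidean
  type of the middle space.\<close>

lemma Ck_on_compose:
  fixes f :: "'a::real_normed_vector \<Rightarrow> 'b::euclidean_space"
    and g :: "'b \<Rightarrow> 'c::real_normed_vector"
  assumes "open U" "open V" "f ` U \<subseteq> V"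
  shows "Ck_on k U f \<Longrightarrow> Ck_on k V g \<Longrightarrow> Ck_on k U (g \<circ> f)"
proof (induction k arbitrary: g)
  case 0
  then show ?case
    using assms by (metis Ck_on.simps(1) continuous_on_compose continuous_on_subset)
next
  case (Suc k)
  let ?D = "frechet_derivative"
  show ?case
  proof (rule Ck_on_SucI[OF assms(1)])
    fix x assume x: "x \<in> U"
    then have fx: "f x \<in> V" using assms by auto
    have "linear (?D g (at (f x)))"
      using Suc.prems(2) fx by (auto intro: linear_frechet_derivative)
    then have "?D g (at (f x)) \<circ> ?D f (at x) =
        (\<lambda>v. \<Sum>b\<in>Basis. (?D f (at x) v \<bullet> b) *\<^sub>R ?D g (at (f x)) b)"
      by (auto simp: fun_eq_iff intro: linear_basis_expansion)
    then show "(g \<circ> f has_derivative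
        (\<lambda>v. \<Sum>b\<in>Basis. (?D f (at x) v \<bullet> b) *\<^sub>R ?D g (at (f x)) b)) (at x)"
      using diff_chain_at[OF Ck_on_has_derivative[OF Suc.prems(1) x]
          Ck_on_has_derivative[OF Suc.prems(2) fx]] by simp
  next
    fix v
    have "Ck_on k U ((\<lambda>y. ?D g (at y) b) \<circ> f)" for b
      using Suc.prems by (intro Suc.IH Ck_on_Suc_imp[OF Suc.prems(1)]) auto
    then show "Ck_on k U (\<lambda>x. \<Sum>b\<in>Basis. (?D f (at x) v \<bullet> b) *\<^sub>R ?D g (at (f x)) b)"
      using Suc.prems(1) assms(1)
      by (intro Ck_on_sum Ck_on_bilinear[OF bounded_bilinear_scaleR]
          Ck_on_bilinear[OF bounded_bilinear_inner]) (auto simp: o_def intro: Ck_on_const)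
  qed
qed

lemma Ck_on_local:
  assumes "\<And>x. x \<in> U \<Longrightarrow> \<exists>V. open V \<and> x \<in> V \<and> Ck_on k V f"
  shows "Ck_on k U f"
  using assms
proof (induction k arbitrary: f)
  case 0
  then show ?case
    by (metis Ck_on.simps(1) continuous_at_imp_continuous_on continuous_on_eq_continuous_at)
next
  case (Suc k)
  then show ?case by (metis Ck_on.simps(2))
qed

section \<open>Smoothness on arbitrary sets by local extension\<close>

lemma smooth_onE:
  assumes "smooth_on T f" "x \<in> T"
  obtains U g where "open U" "x \<in> U" "\<forall>k. Ck_on k U g" "\<forall>y\<in>T \<inter> U. g y = f y"
  using assms(1)[unfolded smooth_on_def, rule_format, OF assms(2)] that by auto

lemma smooth_on_open_iff:
  assumes "open U"
  shows "smooth_on U f \<longleftrightarrow> (\<forall>k. Ck_on k U f)"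
proof
  assume f: "smooth_on U f"
  show "\<forall>k. Ck_on k U f"
  proof (intro allI Ck_on_local)
    fix k x assume "x \<in> U"
    with f obtain V g where V: "open V" "x \<in> V" "\<forall>k. Ck_on k V g" "\<forall>y\<in>U \<inter> V. g y = f y"
      by (rule smooth_onE)
    have "Ck_on k (U \<inter> V) g"
      by (rule Ck_on_subset[OF V(3)[rule_format]]) simp
    then have "Ck_on k (U \<inter> V) f"
      by (rule Ck_on_cong[rotated]) (use V assms in auto)
    then show "\<exists>V. open V \<and> x \<in> V \<and> Ck_on k V f"
      using \<open>x \<in> U\<close> V assms by blast
  qed
next
  assume "\<forall>k. Ck_on k U f"
  then show "smooth_on U f"
    unfolding smooth_on_def by (intro ballI exI[of _ U] exI[of _ f]) (use assms in simp)
qed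

lemma smooth_on_subset:
  assumes "smooth_on T f" "T' \<subseteq> T"
  shows "smooth_on T' f"
  unfolding smooth_on_def
proof
  fix x assume "x \<in> T'"
  then obtain U g where "open U" "x \<in> U" "\<forall>k. Ck_on k U g" "\<forall>y\<in>T \<inter> U. g y = f y"
    using smooth_onE[OF assms(1), of x] assms(2) by (metis subsetD)
  then show "\<exists>U g. open U \<and> x \<in> U \<and> (\<forall>k. Ck_on k U g) \<and> (\<forall>y\<in>T' \<inter> U. g y = f y)"
    using assms(2) by (intro exI[of _ U] exI[of _ g]) auto
qed

lemma smooth_on_cong:
  assumes "smooth_on T f" "\<And>x. x \<in> T \<Longrightarrow> f x = g x"
  shows "smooth_on T g"
  unfolding smooth_on_def
proof
  fix x assume "x \<in> T"
  with assms(1) obtain U h where "open U" "x \<in> U" "\<forall>k. Ck_on k U h" "\<forall>y\<in>T \<inter> U. h y = f y"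
    by (rule smooth_onE)
  then show "\<exists>U h. open U \<and> x \<in> U \<and> (\<forall>k. Ck_on k U h) \<and> (\<forall>y\<in>T \<inter> U. h y = g y)"
    using assms(2) by (intro exI[of _ U] exI[of _ h]) auto
qed

lemma smooth_on_local:
  assumes "\<And>x. x \<in> T \<Longrightarrow> \<exists>U. open U \<and> x \<in> U \<and> smooth_on (T \<inter> U) f"
  shows "smooth_on T f"
  unfolding smooth_on_def
proof
  fix x assume x: "x \<in> T"
  then obtain U where U: "open U" "x \<in> U" "smooth_on (T \<inter> U) f" using assms by meson
  from x U(2) have "x \<in> T \<inter> U" by simp
  with U(3) obtain V g where V: "open V" "x \<in> V" "\<forall>k. Ck_on k V g" "\<forall>y\<in>T \<inter> U \<inter> V. g y = f y"
    by (rule smooth_onE)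
  have "Ck_on k (U \<inter> V) g" for k
    by (rule Ck_on_subset[OF V(3)[rule_format]]) simp
  then show "\<exists>U g. open U \<and> x \<in> U \<and> (\<forall>k. Ck_on k U g) \<and> (\<forall>y\<in>T \<inter> U. g y = f y)"
    using U V by (intro exI[of _ "U \<inter> V"] exI[of _ g]) (simp add: open_Int)
qed

lemma smooth_on_const [intro!, simp]: "smooth_on T (\<lambda>x. c)"
  unfolding smooth_on_def by (intro ballI exI[of _ UNIV] exI[of _ "\<lambda>x. c"]) (simp add: Ck_on_const)

lemma smooth_on_bounded_linear: "bounded_linear h \<Longrightarrow> smooth_on T h"
  unfolding smooth_on_def by (intro ballI exI[of _ UNIV] exI[of _ h]) (simp add: Ck_on_bounded_linear)

text \<open>The two local extensions have different domains; they are combined on the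
  intersection.\<close>

lemma smooth_on_combine:
  fixes T :: "'a::real_normed_vector set"
  assumes p: "\<And>k (U::'a set) f g. open U \<Longrightarrow> Ck_on k U f \<Longrightarrow> Ck_on k U g \<Longrightarrow> Ck_on k U (\<lambda>x. p (f x) (g x))"
    and f: "smooth_on T f" and g: "smooth_on T g"
  shows "smooth_on T (\<lambda>x. p (f x) (g x))"
  unfolding smooth_on_def
proof
  fix x assume x: "x \<in> T"
  obtain U f' where U: "open U" "x \<in> U" "\<forall>k. Ck_on k U f'" "\<forall>y\<in>T \<inter> U. f' y = f y"
    by (rule smooth_onE[OF f x])
  obtain V g' where V: "open V" "x \<in> V" "\<forall>k. Ck_on k V g'" "\<forall>y\<in>T \<inter> V. g' y = g y"
    by (rule smooth_onE[OF g x])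
  show "\<exists>U h. open U \<and> x \<in> U \<and> (\<forall>k. Ck_on k U h) \<and> (\<forall>y\<in>T \<inter> U. h y = p (f y) (g y))"
    using U V by (intro exI[of _ "U \<inter> V"] exI[of _ "\<lambda>x. p (f' x) (g' x)"])
      (simp add: open_Int p Ck_on_subset[of _ U f'] Ck_on_subset[of _ V g'])
qed

lemma smooth_on_bilinear:
  "bounded_bilinear p \<Longrightarrow> smooth_on T f \<Longrightarrow> smooth_on T g \<Longrightarrow> smooth_on T (\<lambda>x. p (f x) (g x))"
  by (rule smooth_on_combine[OF Ck_on_bilinear])

lemma smooth_on_add: "smooth_on T f \<Longrightarrow> smooth_on T g \<Longrightarrow> smooth_on T (\<lambda>x. f x + g x)"
  by (rule smooth_on_combine[OF Ck_on_add])

lemmas smooth_on_mult = smooth_on_bilinear[OF bounded_bilinear_mult]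

lemma smooth_on_diff:
  assumes "smooth_on T f" "smooth_on T g"
  shows "smooth_on T (\<lambda>x. f x - g x)"
proof -
  have "smooth_on T (\<lambda>x. -1 *\<^sub>R g x)"
    by (rule smooth_on_bilinear[OF bounded_bilinear_scaleR]) (use assms in auto)
  from smooth_on_add[OF assms(1) this] show ?thesis by simp
qed

lemma smooth_on_sum:
  "(\<And>i. i \<in> I \<Longrightarrow> smooth_on T (f i)) \<Longrightarrow> smooth_on T (\<lambda>x. \<Sum>i\<in>I. f i x)"
  by (induction I rule: infinite_finite_induct) (auto intro: smooth_on_add)

lemma smooth_on_compose:
  fixes f :: "'a::real_normed_vector \<Rightarrow> 'b::euclidean_space"
    and g :: "'b \<Rightarrow> 'c::real_normed_vector"
  assumes "smooth_on T f" "smooth_on T' g" "f ` T \<subseteq> T'"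
  shows "smooth_on T (g \<circ> f)"
  unfolding smooth_on_def
proof
  fix x assume x: "x \<in> T"
  obtain U f' where U: "open U" "x \<in> U" "\<forall>k. Ck_on k U f'" "\<forall>y\<in>T \<inter> U. f' y = f y"
    by (rule smooth_onE[OF assms(1) x])
  obtain V g' where V: "open V" "f x \<in> V" "\<forall>k. Ck_on k V g'" "\<forall>y\<in>T' \<inter> V. g' y = g y"
    by (rule smooth_onE[OF assms(2), of "f x"]) (use x assms(3) in auto)
  \<comment> \<open>The extension of f may leave the domain of the extension of g, so the composite
    is formed on the preimage of that domain, which is open by continuity (the case k = 0).\<close>
  have "open (f' -` V \<inter> U)"
    using U(1) U(3)[rule_format, of 0] V(1) by (auto simp: continuous_on_open_vimage)
  moreover from this have "Ck_on k (f' -` V \<inter> U) (g' \<circ> f')" for k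
    using V by (intro Ck_on_compose[where V = V]) (use U in \<open>auto intro: Ck_on_subset[OF U(3)[rule_format]]\<close>)
  ultimately show "\<exists>U h. open U \<and> x \<in> U \<and> (\<forall>k. Ck_on k U h) \<and> (\<forall>y\<in>T \<inter> U. h y = (g \<circ> f) y)"
    using U V x assms(3) by (intro exI[of _ "f' -` V \<inter> U"] exI[of _ "g' \<circ> f'"]) auto
qed

lemma smooth_on_differentiable: "open U \<Longrightarrow> smooth_on U f \<Longrightarrow> x \<in> U \<Longrightarrow> f differentiable (at x)"
  by (metis smooth_on_open_iff Ck_on.simps(2))

lemma smooth_on_has_derivative:
  "open U \<Longrightarrow> smooth_on U f \<Longrightarrow> x \<in> U \<Longrightarrow> (f has_derivative frechet_derivative f (at x)) (at x)"
  by (simp add: smooth_on_differentiable flip: frechet_derivative_works)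

lemma smooth_on_derivative:
  "open U \<Longrightarrow> smooth_on U f \<Longrightarrow> smooth_on U (\<lambda>x. frechet_derivative f (at x) v)"
  by (metis smooth_on_open_iff Ck_on.simps(2))

lemma smooth_on_imp_continuous_on: "open U \<Longrightarrow> smooth_on U f \<Longrightarrow> continuous_on U f"
  by (metis smooth_on_open_iff Ck_on.simps(1))

section \<open>Symmetry of second derivatives\<close>

lemma has_vector_derivative_along_line:
  fixes f :: "'a::real_normed_vector \<Rightarrow> 'b::real_normed_vector"
  assumes "(f has_derivative f') (at (x + t *\<^sub>R u))"
  shows "((\<lambda>t. f (x + t *\<^sub>R u)) has_vector_derivative f' u) (at t)"
proof -
  have "((\<lambda>t. x + t *\<^sub>R u) has_derivative (\<lambda>s. s *\<^sub>R u)) (at t)"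
    by (auto intro!: derivative_eq_intros)
  from diff_chain_at[OF this] assms
  have "(f \<circ> (\<lambda>t. x + t *\<^sub>R u) has_derivative f' \<circ> (\<lambda>s. s *\<^sub>R u)) (at t)" by blast
  moreover have "f' (s *\<^sub>R u) = s *\<^sub>R f' u" for s
    using assms linear_scale[OF has_derivative_linear] by blast
  ultimately show ?thesis by (simp add: has_vector_derivative_def o_def)
qed

text \<open>The mean value theorem twice: for f(x + h v + s u) - f(x + s u) as a function of s, and
  then for the increment in direction v of the derivative in direction u.\<close>

lemma second_difference_mean_value:
  fixes f :: "'a::real_normed_vector \<Rightarrow> real"
  assumes f: "Ck_on 2 U f" and h: "h > 0"
    and U: "\<And>s t. 0 \<le> s \<Longrightarrow> s \<le> h \<Longrightarrow> 0 \<le> t \<Longrightarrow> t \<le> h \<Longrightarrow> x + s *\<^sub>R u + t *\<^sub>R v \<in> U"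
  obtains s t where "0 \<le> s" "s \<le> h" "0 \<le> t" "t \<le> h"
    "f (x + h *\<^sub>R u + h *\<^sub>R v) - f (x + h *\<^sub>R u) - f (x + h *\<^sub>R v) + f x =
      h * h * frechet_derivative (\<lambda>y. frechet_derivative f (at y) u) (at (x + s *\<^sub>R u + t *\<^sub>R v)) v"
proof -
  let ?D = "\<lambda>y. frechet_derivative f (at y)"
  have f1: "(f has_derivative ?D y) (at y)" if "y \<in> U" for y
    using f that Ck_on_has_derivative[of 1 U f] by (simp add: numeral_2_eq_2)
  have f2: "((\<lambda>y. ?D y u) has_derivative frechet_derivative (\<lambda>y. ?D y u) (at y)) (at y)" if "y \<in> U" for y
    using f that Ck_on_has_derivative[of 0 U "\<lambda>y. ?D y u"] by (simp add: numeral_2_eq_2)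
  have "((\<lambda>s. f ((x + h *\<^sub>R v) + s *\<^sub>R u) - f (x + s *\<^sub>R u)) has_real_derivative
      ?D (x + s *\<^sub>R u + h *\<^sub>R v) u - ?D (x + s *\<^sub>R u) u) (at s)" if "0 \<le> s" "s \<le> h" for s
  proof -
    have "x + h *\<^sub>R v + s *\<^sub>R u \<in> U" "x + s *\<^sub>R u \<in> U"
      using U[of s h] U[of s 0] that h by (auto simp: algebra_simps)
    from has_vector_derivative_along_line[OF f1[OF this(1)]] has_vector_derivative_along_line[OF f1[OF this(2)]]
    show ?thesis
      by (auto intro!: derivative_eq_intros simp: has_real_derivative_iff_has_vector_derivative[symmetric] algebra_simps)
  qed
  from MVT2[OF h this] obtain s where s: "0 < s" "s < h" and
    eq1: "f (x + h *\<^sub>R u + h *\<^sub>R v) - f (x + h *\<^sub>R u) - (f (x + h *\<^sub>R v) - f x) =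
      h * (?D (x + s *\<^sub>R u + h *\<^sub>R v) u - ?D (x + s *\<^sub>R u) u)"
    by (auto simp: algebra_simps)
  have "((\<lambda>t. ?D (x + s *\<^sub>R u + t *\<^sub>R v) u) has_real_derivative
      frechet_derivative (\<lambda>y. ?D y u) (at (x + s *\<^sub>R u + t *\<^sub>R v)) v) (at t)" if "0 \<le> t" "t \<le> h" for t
    using has_vector_derivative_along_line[OF f2[OF U[of s t]]] that s
    by (simp add: has_real_derivative_iff_has_vector_derivative)
  from MVT2[OF h this] obtain t where t: "0 < t" "t < h" and
    eq2: "?D (x + s *\<^sub>R u + h *\<^sub>R v) u - ?D (x + s *\<^sub>R u) u =
      h * frechet_derivative (\<lambda>y. ?D y u) (at (x + s *\<^sub>R u + t *\<^sub>R v)) v"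
    by auto
  show thesis
    by (rule that[of s t]) (use s t eq1 eq2 in \<open>auto simp: algebra_simps\<close>)
qed

text \<open>The second difference over the parallelogram spanned by h u and h v is symmetric in u
  and v, so the two mixed derivatives take a common value at points near x. By continuity this is
  impossible if they differ at x.\<close>

lemma second_derivative_symmetric:
  fixes f :: "'a::real_normed_vector \<Rightarrow> real"
  assumes f: "Ck_on 2 U f" and "open U" "x \<in> U"
  shows "frechet_derivative (\<lambda>y. frechet_derivative f (at y) u) (at x) v =
    frechet_derivative (\<lambda>y. frechet_derivative f (at y) v) (at x) u"
proof (rule ccontr)
  let ?A = "\<lambda>u v x. frechet_derivative (\<lambda>y. frechet_derivative f (at y) u) (at x) v"
  assume "?A u v x \<noteq> ?A v u x"
  \<comment> \<open>Half the gap: two numbers that lie within \<epsilon> of the respective values at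
    x cannot coincide.\<close>
  define \<epsilon> where "\<epsilon> = \<bar>?A u v x - ?A v u x\<bar> / 2"
  have "\<epsilon> > 0" using \<open>?A u v x \<noteq> ?A v u x\<close> by (simp add: \<epsilon>_def)
  have "isCont (?A u v) x" for u v
    using f assms(2,3) by (auto simp: numeral_2_eq_2 continuous_on_eq_continuous_at)
  then have "\<exists>\<delta>>0. \<forall>y. dist y x < \<delta> \<longrightarrow> dist (?A u v y) (?A u v x) < \<epsilon>" for u v
    using \<open>\<epsilon> > 0\<close> by (auto simp: continuous_at_eps_delta)
  then obtain \<delta>1 \<delta>2 where \<delta>: "\<delta>1 > 0" "\<And>y. dist y x < \<delta>1 \<Longrightarrow> dist (?A u v y) (?A u v x) < \<epsilon>"
    "\<delta>2 > 0" "\<And>y. dist y x < \<delta>2 \<Longrightarrow> dist (?A v u y) (?A v u x) < \<epsilon>"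
    by metis
  obtain \<delta>3 where \<delta>3: "\<delta>3 > 0" "\<And>y. dist y x < \<delta>3 \<Longrightarrow> y \<in> U"
    using assms(2,3) by (auto simp: open_dist)
  define \<delta> where "\<delta> = min \<delta>1 (min \<delta>2 \<delta>3)"
  have "\<delta> > 0" using \<delta> \<delta>3 by (simp add: \<delta>_def)
  \<comment> \<open>Small enough for the whole parallelogram to stay in the \<delta>-ball; the
    summand 1 keeps the denominator positive when u = v = 0.\<close>
  define h where "h = \<delta> / (2 * (norm u + norm v + 1))"
  have pos: "norm u + norm v + 1 > 0" by (smt (verit) norm_ge_zero)
  have h: "h > 0" using \<open>\<delta> > 0\<close> pos by (simp add: h_def)
  have near: "dist (x + s *\<^sub>R a + t *\<^sub>R b) x < \<delta>"
    if "0 \<le> s" "s \<le> h" "0 \<le> t" "t \<le> h" "norm a + norm b = norm u + norm v" for s t a b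
  proof -
    have "dist (x + s *\<^sub>R a + t *\<^sub>R b) x \<le> norm (s *\<^sub>R a) + norm (t *\<^sub>R b)"
      using norm_triangle_ineq[of "s *\<^sub>R a" "t *\<^sub>R b"] by (simp add: dist_norm add.assoc)
    also have "\<dots> \<le> h * norm a + h * norm b"
      using that by (auto intro!: add_mono mult_right_mono)
    also have "\<dots> = h * (norm u + norm v)"
      by (metis distrib_left that(5))
    also have "\<dots> < h * (2 * (norm u + norm v + 1))"
      by (rule mult_strict_left_mono[OF _ h]) (smt (verit) norm_ge_zero)
    also have "\<dots> = \<delta>" using pos by (simp add: h_def)
    finally show ?thesis .
  qed
  obtain s t where st: "0 \<le> s" "s \<le> h" "0 \<le> t" "t \<le> h"
    "f (x + h *\<^sub>R u + h *\<^sub>R v) - f (x + h *\<^sub>R u) - f (x + h *\<^sub>R v) + f x = h * h * ?A u v (x + s *\<^sub>R u + t *\<^sub>R v)"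
    by (rule second_difference_mean_value[OF f h, of x u v]) (use near \<delta>3 in \<open>auto simp: \<delta>_def\<close>)
  obtain s' t' where st': "0 \<le> s'" "s' \<le> h" "0 \<le> t'" "t' \<le> h"
    "f (x + h *\<^sub>R v + h *\<^sub>R u) - f (x + h *\<^sub>R v) - f (x + h *\<^sub>R u) + f x = h * h * ?A v u (x + s' *\<^sub>R v + t' *\<^sub>R u)"
    by (rule second_difference_mean_value[OF f h, of x v u]) (use near \<delta>3 in \<open>auto simp: \<delta>_def\<close>)
  have "h * h * ?A u v (x + s *\<^sub>R u + t *\<^sub>R v) = h * h * ?A v u (x + s' *\<^sub>R v + t' *\<^sub>R u)"
    using st(5) st'(5) by (simp add: algebra_simps)
  then have "?A u v (x + s *\<^sub>R u + t *\<^sub>R v) = ?A v u (x + s' *\<^sub>R v + t' *\<^sub>R u)"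
    using h by simp
  moreover have "dist (?A u v (x + s *\<^sub>R u + t *\<^sub>R v)) (?A u v x) < \<epsilon>"
    by (rule \<delta>(2)) (use near[of s t u v] st in \<open>auto simp: \<delta>_def\<close>)
  moreover have "dist (?A v u (x + s' *\<^sub>R v + t' *\<^sub>R u)) (?A v u x) < \<epsilon>"
    by (rule \<delta>(4)) (use near[of s' t' v u] st' in \<open>auto simp: \<delta>_def\<close>)
  ultimately show False
    unfolding \<epsilon>_def dist_real_def by argo
qed

section \<open>Smooth cutoff functions\<close>

text \<open>The exponent \<open>n\<close> makes the family closed under differentiation up to linear combinations.\<close>

definition flat_exp :: "nat \<Rightarrow> real \<Rightarrow> real"
  where "flat_exp n x = (if x > 0 then inverse x ^ n * exp (- inverse x) else 0)"

lemma inverse_power_has_derivative: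
  assumes "x > 0"
  shows "((\<lambda>x::real. inverse x ^ n) has_real_derivative - real n * inverse x ^ (n + 1)) (at x)"
proof (cases n)
  case (Suc m)
  have "((\<lambda>x. inverse x ^ Suc m) has_real_derivative (1 + real m) * (- (inverse x ^ Suc (Suc 0)) * inverse x ^ m)) (at x)"
    using DERIV_power_Suc[OF DERIV_inverse[of x]] assms by simp
  then show ?thesis
    unfolding Suc by (simp add: algebra_simps)
qed simp

lemma flat_exp_has_derivative:
  "(flat_exp n has_real_derivative flat_exp (n + 2) x - n * flat_exp (n + 1) x) (at x)"
proof -
  consider "x < 0" | "x = 0" | "x > 0" by linarith
  then show ?thesis
  proof cases
    case 1
    have "((\<lambda>x. 0) has_real_derivative 0) (at x)" by simp
    then have "(flat_exp n has_real_derivative 0) (at x)"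
      by (rule has_field_derivative_transform_within_open[of _ _ _ "{..<0}"]) (use 1 in \<open>auto simp: flat_exp_def\<close>)
    then show ?thesis using 1 by (simp add: flat_exp_def)
  next
    case 2
    \<comment> \<open>With y = 1/x the difference quotient at 0 from the right is y^(n+1) / exp y,
      and y tends to infinity.\<close>
    have "((\<lambda>x. inverse x ^ (n + 1) / exp (inverse x)) \<longlongrightarrow> (0::real)) (at_right 0)"
      by (rule filterlim_compose[OF tendsto_power_div_exp_0 filterlim_inverse_at_top_right])
    then have "((\<lambda>x. flat_exp n x / x) \<longlongrightarrow> 0) (at_right 0)"
      by (rule Lim_transform_eventually)
        (auto simp: eventually_at_filter flat_exp_def exp_minus divide_simps)
    moreover have "((\<lambda>x. flat_exp n x / x) \<longlongrightarrow> 0) (at_left 0)"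
      by (rule Lim_transform_eventually[of "\<lambda>_. 0"]) (auto simp: eventually_at_filter flat_exp_def)
    ultimately have "((\<lambda>x. flat_exp n x / x) \<longlongrightarrow> 0) (at 0)"
      by (simp add: filterlim_split_at)
    then show ?thesis
      using 2 by (simp add: has_field_derivative_iff flat_exp_def)
  next
    case 3
    have "((\<lambda>x. inverse x ^ n * exp (- inverse x)) has_real_derivative
        flat_exp (n + 2) x - n * flat_exp (n + 1) x) (at x)"
      using 3 by (intro DERIV_cong[OF DERIV_mult[OF inverse_power_has_derivative
            DERIV_chain2[OF DERIV_exp DERIV_minus[OF DERIV_inverse]]]])
        (auto simp: flat_exp_def power2_eq_square algebra_simps)
    then show ?thesis
      by (rule has_field_derivative_transform_within_open[of _ _ _ "{0<..}"]) (use 3 in \<open>auto simp: flat_exp_def\<close>)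
  qed
qed

lemma Ck_on_flat_exp: "Ck_on k UNIV (flat_exp n)"
proof (induction k arbitrary: n)
  case 0
  show ?case
    using DERIV_isCont[OF flat_exp_has_derivative] by (simp add: continuous_at_imp_continuous_on)
next
  case (Suc k)
  show ?case
  proof (rule Ck_on_SucI)
    show "(flat_exp n has_derivative (\<lambda>v. (flat_exp (n + 2) x - n * flat_exp (n + 1) x) * v)) (at x)" for x
      using flat_exp_has_derivative by (simp add: has_field_derivative_def)
    have "Ck_on k UNIV (\<lambda>x. (flat_exp (n + 2) x + (- real n) * flat_exp (n + 1) x) * v)" for v
      by (intro Ck_on_bilinear[OF bounded_bilinear_mult] Ck_on_add Ck_on_const Suc.IH open_UNIV)
    then show "Ck_on k UNIV (\<lambda>x. (flat_exp (n + 2) x - n * flat_exp (n + 1) x) * v)" for v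
      by simp
  qed simp
qed

lemma Ck_on_inverse_power: "Ck_on k {0<..} (\<lambda>x::real. inverse x ^ n)"
proof (induction k arbitrary: n)
  case 0
  show ?case by (auto intro!: continuous_intros)
next
  case (Suc k)
  show ?case
  proof (rule Ck_on_SucI)
    fix x :: real assume "x \<in> {0<..}"
    then have "((\<lambda>x. inverse x ^ n) has_real_derivative (- real n * inverse x ^ (n + 1))) (at x)"
      using inverse_power_has_derivative by blast
    then show "((\<lambda>x. inverse x ^ n) has_derivative (\<lambda>v. (- real n * inverse x ^ (n + 1)) * v)) (at x)"
      by (rule has_field_derivative_imp_has_derivative)
  next
    show "Ck_on k {0<..} (\<lambda>x::real. (- real n * inverse x ^ (n + 1)) * v)" for v
      by (intro Ck_on_bilinear[OF bounded_bilinear_mult] Ck_on_const Suc.IH open_greaterThan)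
  qed simp
qed

lemma smooth_step:
  obtains s :: "real \<Rightarrow> real" where "smooth_on UNIV s" "\<And>t. t \<le> 0 \<Longrightarrow> s t = 0" "\<And>t. t \<ge> 1 \<Longrightarrow> s t = 1"
proof
  let ?g = "flat_exp 0"
  \<comment> \<open>The denominator never vanishes, since t > 0 or 1 - t > 0. For t \<le> 0 the
    numerator is 0; for t \<ge> 1 the second summand of the denominator is 0.\<close>
  let ?s = "\<lambda>t. ?g t * inverse (?g t + ?g (1 - t))"
  have g: "smooth_on UNIV ?g" by (simp add: smooth_on_open_iff Ck_on_flat_exp)
  have "smooth_on UNIV (?g \<circ> (\<lambda>t. 1 - t))"
    by (rule smooth_on_compose[OF _ g]) (intro smooth_on_diff smooth_on_const smooth_on_bounded_linear[OF bounded_linear_ident], simp)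
  then have d: "smooth_on UNIV (\<lambda>t. ?g t + ?g (1 - t))"
    by (intro smooth_on_add g) (simp add: o_def)
  have "smooth_on {0<..} (\<lambda>x::real. inverse x)"
    using Ck_on_inverse_power[of _ 1] by (simp add: smooth_on_open_iff)
  moreover have "?g t + ?g (1 - t) > 0" for t
    by (auto simp: flat_exp_def add_pos_nonneg)
  ultimately have "smooth_on UNIV (inverse \<circ> (\<lambda>t. ?g t + ?g (1 - t)))"
    by (intro smooth_on_compose[OF d]) auto
  then show "smooth_on UNIV ?s"
    by (intro smooth_on_mult g) (simp add: o_def)
qed (auto simp: flat_exp_def)

text \<open>The support is enclosed in a compact K inside U because its preimage under a chart is
  then compact, hence closed in the Hausdorff space M, as extension by zero requires.\<close>

lemma smooth_cutoff:
  fixes x :: "'a::euclidean_space"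
  assumes "open U" "x \<in> U"
  obtains \<psi> :: "'a \<Rightarrow> real" and V K where "smooth_on UNIV \<psi>" "open V" "x \<in> V" "\<And>y. y \<in> V \<Longrightarrow> \<psi> y = 1"
    "compact K" "K \<subseteq> U" "V \<subseteq> K" "\<And>y. y \<notin> K \<Longrightarrow> \<psi> y = 0"
proof -
  obtain r where r: "r > 0" "cball x r \<subseteq> U"
    using assms open_contains_cball by blast
  obtain s :: "real \<Rightarrow> real" where s: "smooth_on UNIV s" "\<And>t. t \<le> 0 \<Longrightarrow> s t = 0" "\<And>t. t \<ge> 1 \<Longrightarrow> s t = 1"
    using smooth_step by blast
  \<comment> \<open>The square of the norm is smooth at x, unlike the norm. The coefficients give 2
    at x, at least 1 within radius r/2 and at most 0 from radius r on.\<close>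
  define a where "a y = 2 - (2 / r\<^sup>2) * ((y - x) \<bullet> (y - x))" for y
  have "smooth_on UNIV a"
    unfolding a_def
    by (intro smooth_on_diff smooth_on_mult smooth_on_const smooth_on_bilinear[OF bounded_bilinear_inner]
        smooth_on_bounded_linear bounded_linear_ident)
  then have "smooth_on UNIV (s \<circ> a)"
    by (rule smooth_on_compose[OF _ s(1)]) auto
  moreover have "(s \<circ> a) y = 1" if "dist x y < r / 2" for y
  proof -
    have "(norm (y - x))\<^sup>2 \<le> (r/2)\<^sup>2"
      using that by (intro power_mono) (auto simp: dist_norm norm_minus_commute)
    also have "\<dots> \<le> r\<^sup>2 / 2" by (simp add: power2_eq_square)
    finally have "(2 / r\<^sup>2) * (norm (y - x))\<^sup>2 \<le> 1" using r by (simp add: field_simps)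
    then have "a y \<ge> 1" by (simp add: a_def power2_norm_eq_inner)
    then show ?thesis by (simp add: s)
  qed
  moreover have "(s \<circ> a) y = 0" if "y \<notin> cball x r" for y
  proof -
    have "r\<^sup>2 \<le> (norm (y - x))\<^sup>2"
      using that r by (intro power_mono) (auto simp: dist_norm norm_minus_commute)
    then have "2 \<le> (2 / r\<^sup>2) * (norm (y - x))\<^sup>2" using r by (simp add: field_simps)
    then have "a y \<le> 0" by (simp add: a_def power2_norm_eq_inner)
    then show ?thesis by (simp add: s)
  qed
  ultimately show thesis
    using r by (intro that[of "s \<circ> a" "ball x (r/2)" "cball x r"]) auto
qed

section \<open>Charts, tangent vectors and differentials\<close>

lemma frechet_cong_open:
  assumes "open U" "x \<in> U" "\<And>y. y \<in> U \<Longrightarrow> f y = g y"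
  shows "frechet_derivative f (at x) = frechet_derivative g (at x)"
    and "f differentiable (at x) \<Longrightarrow> g differentiable (at x)"
proof -
  have "(f has_derivative f') (at x) \<longleftrightarrow> (g has_derivative f') (at x)" for f'
    using has_derivative_transform_within_open[OF _ assms(1,2), of f f' UNIV g]
      has_derivative_transform_within_open[OF _ assms(1,2), of g f' UNIV f] assms(3) by auto
  then show "frechet_derivative f (at x) = frechet_derivative g (at x)"
    and "f differentiable (at x) \<Longrightarrow> g differentiable (at x)"
    by (simp_all add: frechet_derivative_def differentiable_def)
qed

lemma chart_inv_right:
  "x \<in> snd c ` fst c \<Longrightarrow> snd c (chart_inv c x) = x"
  "x \<in> snd c ` fst c \<Longrightarrow> chart_inv c x \<in> fst c"
  by (auto simp: chart_inv_def f_inv_into_f inv_into_into)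

lemma chart_inv_left:
  "inj_on (snd c) (fst c) \<Longrightarrow> p \<in> fst c \<Longrightarrow> chart_inv c (snd c p) = p"
  by (simp add: chart_inv_def)

text \<open>Injectivity of the charts makes images commute with intersections. The statement is
  about arbitrary chart families because it also serves the restricted atlas on e(E) and the atlas
  of the normal bundle.\<close>

lemma istopology_atlas:
  assumes "\<And>c. c \<in> M \<Longrightarrow> inj_on (snd c) (fst c)"
  shows "istopology (\<lambda>W. W \<subseteq> points M \<and> (\<forall>c\<in>M. open (snd c ` (W \<inter> fst c))))"
  unfolding istopology_def
proof (intro conjI allI impI ballI)
  fix V W c
  assume "V \<subseteq> points M \<and> (\<forall>c\<in>M. open (snd c ` (V \<inter> fst c)))"
    "W \<subseteq> points M \<and> (\<forall>c\<in>M. open (snd c ` (W \<inter> fst c)))" and c: "c \<in> M"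
  then have "open (snd c ` (V \<inter> fst c) \<inter> snd c ` (W \<inter> fst c))" by (auto intro: open_Int)
  moreover have "snd c ` (V \<inter> fst c) \<inter> snd c ` (W \<inter> fst c) = snd c ` (V \<inter> W \<inter> fst c)"
    using inj_on_image_Int[OF assms[OF c], of "V \<inter> fst c" "W \<inter> fst c"] by (simp add: Int_ac)
  ultimately show "open (snd c ` (V \<inter> W \<inter> fst c))" by simp
next
  fix \<K> c
  assume "\<forall>K\<in>\<K>. K \<subseteq> points M \<and> (\<forall>c\<in>M. open (snd c ` (K \<inter> fst c)))" and "c \<in> M"
  then have "open (\<Union>K\<in>\<K>. snd c ` (K \<inter> fst c))" by auto
  moreover have "(\<Union>K\<in>\<K>. snd c ` (K \<inter> fst c)) = snd c ` (\<Union>\<K> \<inter> fst c)" by auto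
  ultimately show "open (snd c ` (\<Union>\<K> \<inter> fst c))" by simp
qed auto

lemma openin_atlas_topology:
  assumes "\<And>c. c \<in> M \<Longrightarrow> inj_on (snd c) (fst c)"
  shows "openin (atlas_topology M) V \<longleftrightarrow> V \<subseteq> points M \<and> (\<forall>c\<in>M. open (snd c ` (V \<inter> fst c)))"
  unfolding atlas_topology_def using topology_inverse'[OF istopology_atlas[OF assms]] by simp

lemma topspace_atlas_topology:
  assumes "\<And>c. c \<in> M \<Longrightarrow> inj_on (snd c) (fst c)" "\<And>c. c \<in> M \<Longrightarrow> open (snd c ` fst c)"
  shows "topspace (atlas_topology M) = points M"
proof -
  have "points M \<inter> fst c = fst c" if "c \<in> M" for c
    using that by (auto simp: points_def)
  then have "openin (atlas_topology M) (points M)"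
    using assms by (auto simp: openin_atlas_topology)
  then show ?thesis
    using openin_topspace[of "atlas_topology M"] openin_subset openin_atlas_topology[OF assms(1)]
    by (metis subset_antisym)
qed

section \<open>Derivatives in charts and tangent vectors\<close>

abbreviation cderiv :: "('m, 'a::euclidean_space) chart \<Rightarrow> ('m \<Rightarrow> 'b::real_normed_vector) \<Rightarrow> 'm \<Rightarrow> 'a \<Rightarrow> 'b"
  where "cderiv c F q \<equiv> frechet_derivative (F \<circ> chart_inv c) (at (snd c q))"

abbreviation cdiff :: "('m, 'a::euclidean_space) chart \<Rightarrow> ('m \<Rightarrow> 'b::real_normed_vector) \<Rightarrow> 'm \<Rightarrow> bool"
  where "cdiff c F q \<equiv> (F \<circ> chart_inv c) differentiable (at (snd c q))"

locale manifold =
  fixes M :: "('m, 'a::euclidean_space) chart set"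
  assumes smooth_manifold: "smooth_manifold M"
begin

abbreviation "mtop \<equiv> atlas_topology M"
abbreviation "TM q \<equiv> tangent_space M q"
abbreviation "CTM q \<equiv> cotangent_space M q"
abbreviation "dM \<equiv> differential M"
abbreviation "Cinf \<equiv> smooth_functions M (points M)"
abbreviation "Forms \<equiv> covector_fields M (points M)"

lemma inj_chart: "c \<in> M \<Longrightarrow> inj_on (snd c) (fst c)"
  using smooth_manifold by (simp add: smooth_manifold_def smooth_atlas_def)

lemma open_chart: "c \<in> M \<Longrightarrow> open (snd c ` fst c)"
  using smooth_manifold by (simp add: smooth_manifold_def smooth_atlas_def)

lemma open_transition: "c \<in> M \<Longrightarrow> d \<in> M \<Longrightarrow> open (snd c ` (fst c \<inter> fst d))"
  using smooth_manifold by (simp add: smooth_manifold_def smooth_atlas_def)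

lemma smooth_transition:
  "c \<in> M \<Longrightarrow> d \<in> M \<Longrightarrow> smooth_on (snd c ` (fst c \<inter> fst d)) (snd d \<circ> chart_inv c)"
  using smooth_manifold by (simp add: smooth_manifold_def smooth_atlas_def)

lemma chart_inv_chart [simp]: "c \<in> M \<Longrightarrow> p \<in> fst c \<Longrightarrow> chart_inv c (snd c p) = p"
  by (simp add: chart_inv_left inj_chart)

lemma openin_top: "openin mtop V \<longleftrightarrow> V \<subseteq> points M \<and> (\<forall>c\<in>M. open (snd c ` (V \<inter> fst c)))"
  by (rule openin_atlas_topology) (rule inj_chart)

lemma topspace_top: "topspace mtop = points M"
  by (rule topspace_atlas_topology) (auto intro: inj_chart open_chart)

lemma open_image: "openin mtop V \<Longrightarrow> c \<in> M \<Longrightarrow> open (snd c ` (V \<inter> fst c))"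
  by (simp add: openin_top)

lemma openin_points: "openin mtop (points M)"
  using openin_topspace[of mtop] by (simp add: topspace_top)

lemma openin_chart: "c \<in> M \<Longrightarrow> openin mtop (fst c)"
  using open_transition[of _ c] by (auto simp: openin_top points_def Int_commute)

lemma chart_exists:
  assumes "q \<in> points M"
  obtains c where "c \<in> M" "q \<in> fst c"
  using assms by (auto simp: points_def)

lemma chart_at: 
  assumes "c \<in> M" "q \<in> fst c"
  shows "chart_at M q \<in> M" "q \<in> fst (chart_at M q)"
  using someI[of "\<lambda>c. c \<in> M \<and> q \<in> fst c" c] assms by (auto simp: chart_at_def)

lemma openin_chart_vimage:
  assumes c: "c \<in> M" and B: "open B"
  shows "openin mtop {p \<in> fst c. snd c p \<in> B}"
  unfolding openin_top
proof (intro conjI ballI)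
  fix d assume d: "d \<in> M"
  let ?t = "snd c \<circ> chart_inv d" and ?U = "snd d ` (fst d \<inter> fst c)"
  have "continuous_on ?U ?t"
    by (intro smooth_on_imp_continuous_on open_transition smooth_transition c d)
  then have "open (?t -` B \<inter> ?U)"
    using B open_transition[OF d c] continuous_on_open_vimage by blast
  moreover have "?t -` B \<inter> ?U = snd d ` ({p \<in> fst c. snd c p \<in> B} \<inter> fst d)"
    using d by auto
  ultimately show "open (snd d ` ({p \<in> fst c. snd c p \<in> B} \<inter> fst d))" by simp
qed (use c in \<open>auto simp: points_def\<close>)

lemma transition_differentiable:
  assumes "c \<in> M" "d \<in> M" "q \<in> fst c" "q \<in> fst d"
  shows "cdiff c (snd d) q"
  by (rule smooth_on_differentiable[OF open_transition[OF assms(1,2)] smooth_transition[OF assms(1,2)]])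
    (use assms in simp)

text \<open>On the overlap, F read in d is F read in c after the transition map, so this is the
  chain rule. It makes the arbitrary chart \<open>chart_at\<close> in \<open>differential\<close>
  immaterial.\<close>

lemma cderiv_change:
  assumes c: "c \<in> M" "q \<in> fst c" and d: "d \<in> M" "q \<in> fst d"
    and F: "cdiff c F q"
  shows "cdiff d F q"
    and "cderiv d F q v = cderiv c F q (cderiv d (snd c) q v)"
proof -
  have t: "(snd c \<circ> chart_inv d) differentiable (at (snd d q))"
    by (rule transition_differentiable) (use c d in auto)
  have F': "(F \<circ> chart_inv c) differentiable (at ((snd c \<circ> chart_inv d) (snd d q)))"
    using F c d by simp
  have comp: "((F \<circ> chart_inv c) \<circ> (snd c \<circ> chart_inv d)) differentiable (at (snd d q))"
    by (rule differentiable_chain_at[OF t F'])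
  have op: "open (snd d ` (fst d \<inter> fst c))" using open_transition c d by simp
  have q: "snd d q \<in> snd d ` (fst d \<inter> fst c)" using c d by simp
  have eq: "((F \<circ> chart_inv c) \<circ> (snd c \<circ> chart_inv d)) y = (F \<circ> chart_inv d) y"
    if "y \<in> snd d ` (fst d \<inter> fst c)" for y
    using that c d by auto
  show "cdiff d F q"
    by (rule frechet_cong_open(2)[OF op q eq comp])
  have "cderiv d F q = frechet_derivative ((F \<circ> chart_inv c) \<circ> (snd c \<circ> chart_inv d)) (at (snd d q))"
    by (rule frechet_cong_open(1)[OF op q eq, symmetric])
  also have "\<dots> = cderiv c F q \<circ> cderiv d (snd c) q"
    using frechet_derivative_compose[OF t F'] chart_inv_chart[OF d] by (simp add: o_def)
  finally show "cderiv d F q v = cderiv c F q (cderiv d (snd c) q v)" by simp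
qed

lemma cderiv_self:
  assumes "c \<in> M" "q \<in> fst c"
  shows "cderiv c (snd c) q v = v"
proof -
  have "cderiv c (snd c) q = frechet_derivative (\<lambda>x. x) (at (snd c q))"
    by (rule frechet_cong_open(1)[OF open_chart[OF assms(1)]])
      (use assms chart_inv_right(1) in force)+
  then show ?thesis by simp
qed

lemma tangent_spaceD:
  assumes "X \<in> TM q" "c \<in> M" "q \<in> fst c" "d \<in> M" "q \<in> fst d"
  shows "X d = cderiv c (snd d) q (X c)"
  using assms unfolding tangent_space_def by blast

lemma tangent_space_outside: "X \<in> TM q \<Longrightarrow> \<not> (c \<in> M \<and> q \<in> fst c) \<Longrightarrow> X c = 0"
  unfolding tangent_space_def by blast

lemma linear_cderiv: "cdiff c F q \<Longrightarrow> linear (cderiv c F q)"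
  by (rule linear_frechet_derivative)

lemma subspace_TM: "subspace (TM q)"
proof -
  have l: "linear (cderiv c (snd d) q)" if "c \<in> M" "d \<in> M" "q \<in> fst c" "q \<in> fst d" for c d
    by (rule linear_cderiv[OF transition_differentiable]) (use that in auto)
  show ?thesis
    unfolding subspace_def
  proof (intro conjI ballI allI)
    show "0 \<in> TM q"
      by (simp add: tangent_space_def linear_0[OF l])
  next
    fix X Y and r :: real assume X: "X \<in> TM q" and Y: "Y \<in> TM q"
    show "X + Y \<in> TM q"
      unfolding tangent_space_def
    proof (intro CollectI conjI ballI impI allI)
      fix c d assume "c \<in> M" "d \<in> M" "q \<in> fst c" "q \<in> fst d"
      then show "(X + Y) d = cderiv c (snd d) q ((X + Y) c)"
        using tangent_spaceD[OF X, of c d] tangent_spaceD[OF Y, of c d] linear_add[OF l, of c d]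
        by (metis plus_fun_apply)
    qed (simp add: tangent_space_outside[OF X] tangent_space_outside[OF Y])
  next
    fix X and r :: real assume X: "X \<in> TM q"
    show "r *\<^sub>R X \<in> TM q"
      unfolding tangent_space_def scaleR_fun_def
    proof (intro CollectI conjI ballI impI allI)
      fix c d assume "c \<in> M" "d \<in> M" "q \<in> fst c" "q \<in> fst d"
      then show "r *\<^sub>R X d = cderiv c (snd d) q (r *\<^sub>R X c)"
        using tangent_spaceD[OF X, of c d] linear_scale[OF l, of c d] by metis
    qed (simp add: tangent_space_outside[OF X])
  qed
qed

lemma differential_eq:
  assumes c: "c \<in> M" "q \<in> fst c" and F: "cdiff c F q" and X: "X \<in> TM q"
  shows "dM F q X = cderiv c F q (X c)"
proof -
  note d = chart_at[OF c]
  show ?thesis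
    using cderiv_change(2)[OF c d F, of "X (chart_at M q)"] tangent_spaceD[OF X d c] X
    by (simp add: differential_def Let_def)
qed

text \<open>Compatibility of the components in d and e is the chain rule for the transition from c
  through d to e.\<close>

lemma coord_vec_in:
  assumes c: "c \<in> M" "q \<in> fst c"
  shows "coord_vec M c v q \<in> TM q"
  unfolding tangent_space_def
proof (intro CollectI conjI ballI impI allI)
  fix d e assume d: "d \<in> M" "e \<in> M" "q \<in> fst d" "q \<in> fst e"
  then show "coord_vec M c v q e = cderiv d (snd e) q (coord_vec M c v q d)"
    using cderiv_change(2)[of d q c "snd e" v] transition_differentiable[of d e q] c
    by (simp add: coord_vec_def)
qed (auto simp: coord_vec_def)

lemma coord_vec_self: "c \<in> M \<Longrightarrow> q \<in> fst c \<Longrightarrow> coord_vec M c v q c = v"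
  by (simp add: coord_vec_def cderiv_self)

lemma coord_vec_of_tangent:
  assumes X: "X \<in> TM q" and c: "c \<in> M" "q \<in> fst c"
  shows "coord_vec M c (X c) q = X"
proof
  fix d
  show "coord_vec M c (X c) q d = X d"
    using tangent_spaceD[OF X c, of d] tangent_space_outside[OF X, of d]
    by (auto simp: coord_vec_def)
qed

lemma linear_coord_vec:
  assumes c: "c \<in> M" "q \<in> fst c"
  shows "linear (\<lambda>v. coord_vec M c v q)"
proof -
  have l: "linear (cderiv c (snd d) q)" if "d \<in> M" "q \<in> fst d" for d
    by (rule linear_cderiv[OF transition_differentiable]) (use that c in auto)
  show ?thesis
  proof (intro linearI ext)
    fix v w d
    show "coord_vec M c (v + w) q d = (coord_vec M c v q + coord_vec M c w q) d"
      using linear_add[OF l, of d] by (simp add: coord_vec_def)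
  next
    fix r v d
    show "coord_vec M c (r *\<^sub>R v) q d = (r *\<^sub>R coord_vec M c v q) d"
      using linear_scale[OF l, of d] by (simp add: coord_vec_def scaleR_fun_def)
  qed
qed

lemma differential_coord_vec:
  assumes "c \<in> M" "q \<in> fst c" "cdiff c F q"
  shows "dM F q (coord_vec M c v q) = cderiv c F q v"
  using differential_eq[OF assms coord_vec_in] assms by (simp add: coord_vec_self)

lemma differential_in:
  assumes c: "c \<in> M" "q \<in> fst c" and F: "cdiff c F q"
  shows "dM F q \<in> CTM q"
proof -
  note l = linear_cderiv[OF F]
  show ?thesis
    unfolding dual_space_def
    using subspace_add[OF subspace_TM] subspace_scale[OF subspace_TM]
    by (simp add: differential_eq[OF c F] linear_add[OF l] linear_scale[OF l] scaleR_fun_def)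
      (simp add: differential_def)
qed

lemma differential_cong:
  assumes "openin mtop V" "q \<in> V" "\<And>p. p \<in> V \<Longrightarrow> F p = G p"
  shows "dM F q = dM G q"
proof -
  obtain c where "c \<in> M" "q \<in> fst c"
    using assms(1,2) chart_exists openin_top by blast
  note d = chart_at[OF this]
  have "cderiv (chart_at M q) F q = cderiv (chart_at M q) G q"
    by (rule frechet_cong_open[OF open_image[OF assms(1) d(1)]])
      (use assms d in auto)
  then show ?thesis by (simp add: differential_def Let_def fun_eq_iff)
qed

lemma cderiv_cong:
  assumes "openin mtop V" "q \<in> V" "c \<in> M" "q \<in> fst c" "\<And>p. p \<in> V \<Longrightarrow> p \<in> fst c \<Longrightarrow> F p = G p"
  shows "cderiv c F q = cderiv c G q"
    and "cdiff c F q \<Longrightarrow> cdiff c G q"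
proof -
  have *: "snd c q \<in> snd c ` (V \<inter> fst c)" "\<And>y. y \<in> snd c ` (V \<inter> fst c) \<Longrightarrow> (F \<circ> chart_inv c) y = (G \<circ> chart_inv c) y"
    using assms by auto
  show "cderiv c F q = cderiv c G q"
    by (rule frechet_cong_open(1)[OF open_image[OF assms(1,3)] *(1) *(2)])
  show "cdiff c F q \<Longrightarrow> cdiff c G q"
    by (rule frechet_cong_open(2)[OF open_image[OF assms(1,3)] *(1) *(2)])
qed

subsection \<open>Smooth functions on open sets\<close>

lemma smooth_fun_chart: "smooth_fun M V F \<Longrightarrow> c \<in> M \<Longrightarrow> smooth_on (snd c ` (V \<inter> fst c)) (F \<circ> chart_inv c)"
  by (simp add: smooth_fun_def)

lemma smooth_fun_chart_diff:
  "openin mtop V \<Longrightarrow> smooth_fun M V F \<Longrightarrow> q \<in> V \<Longrightarrow> c \<in> M \<Longrightarrow> q \<in> fst c \<Longrightarrow> cdiff c F q"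
  by (rule smooth_on_differentiable[OF open_image smooth_fun_chart]) auto

lemma smooth_fun_subset: "smooth_fun M V F \<Longrightarrow> W \<subseteq> V \<Longrightarrow> smooth_fun M W F"
  unfolding smooth_fun_def by (blast intro: smooth_on_subset)

lemma smooth_fun_cong:
  assumes "smooth_fun M V F" "\<And>p. p \<in> V \<Longrightarrow> F p = G p"
  shows "smooth_fun M V G"
  unfolding smooth_fun_def
proof
  fix c assume "c \<in> M"
  then show "smooth_on (snd c ` (V \<inter> fst c)) (G \<circ> chart_inv c)"
    by (intro smooth_on_cong[OF smooth_fun_chart[OF assms(1)]]) (auto simp: assms(2))
qed

lemma smooth_fun_const: "smooth_fun M V (\<lambda>p. a)"
  by (simp add: smooth_fun_def o_def)

lemma smooth_fun_add: "smooth_fun M V F \<Longrightarrow> smooth_fun M V G \<Longrightarrow> smooth_fun M V (\<lambda>p. F p + G p)"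
  unfolding smooth_fun_def o_def by (intro ballI smooth_on_add; blast)

lemma smooth_fun_diff: "smooth_fun M V F \<Longrightarrow> smooth_fun M V G \<Longrightarrow> smooth_fun M V (\<lambda>p. F p - G p)"
  unfolding smooth_fun_def o_def by (intro ballI smooth_on_diff; blast)

lemma smooth_fun_mult: "smooth_fun M V F \<Longrightarrow> smooth_fun M V G \<Longrightarrow> smooth_fun M V (\<lambda>p. F p * G p)"
  unfolding smooth_fun_def o_def by (intro ballI smooth_on_mult; blast)

text \<open>Since transition maps are smooth, one chart around each point decides smoothness in all
  charts.\<close>

lemma smooth_funI:
  assumes "\<And>p. p \<in> V \<Longrightarrow> \<exists>c\<in>M. \<exists>W. p \<in> fst c \<and> p \<in> W \<and> openin mtop W \<and>
    smooth_on (snd c ` (W \<inter> fst c)) (F \<circ> chart_inv c)"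
  shows "smooth_fun M V F"
  unfolding smooth_fun_def
proof (intro ballI smooth_on_local)
  fix d x assume d: "d \<in> M" and "x \<in> snd d ` (V \<inter> fst d)"
  then obtain p where p: "p \<in> V" "p \<in> fst d" "x = snd d p" by auto
  from assms[OF p(1)] obtain c W where c: "c \<in> M" "p \<in> fst c" "p \<in> W" "openin mtop W"
    and F: "smooth_on (snd c ` (W \<inter> fst c)) (F \<circ> chart_inv c)" by blast
  let ?B = "snd d ` (W \<inter> fst c \<inter> fst d)"
  have "openin mtop (W \<inter> fst c)" using c openin_chart by blast
  then have "open ?B" using d by (rule open_image)
  moreover have "x \<in> ?B" using p c by auto
  moreover have "smooth_on (snd d ` (V \<inter> fst d) \<inter> ?B) (F \<circ> chart_inv d)"
  proof -
    have "smooth_on ?B (snd c \<circ> chart_inv d)"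
      by (rule smooth_on_subset[OF smooth_transition[OF d c(1)]]) auto
    then have "smooth_on ?B ((F \<circ> chart_inv c) \<circ> (snd c \<circ> chart_inv d))"
      by (rule smooth_on_compose[OF _ F]) (use d in auto)
    then have "smooth_on ?B (F \<circ> chart_inv d)"
      by (rule smooth_on_cong) (use c d in auto)
    then show ?thesis by (rule smooth_on_subset) auto
  qed
  ultimately show "\<exists>U. open U \<and> x \<in> U \<and> smooth_on (snd d ` (V \<inter> fst d) \<inter> U) (F \<circ> chart_inv d)" by blast
qed

lemma smooth_on_cderiv:
  assumes "openin mtop V" "smooth_fun M V F" "c \<in> M"
  shows "smooth_on (snd c ` (V \<inter> fst c)) ((\<lambda>q. cderiv c F q v) \<circ> chart_inv c)"
  by (rule smooth_on_cong[OF smooth_on_derivative[OF open_image[OF assms(1,3)] smooth_fun_chart[OF assms(2,3)], of v]])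
    (use assms(3) in auto)

text \<open>The Jacobi identity of \<open>poisson_manifold\<close> and, through exact forms, the
  algebroid bracket are stated for global objects. Multiplication by a cutoff in a chart preserves
  only the germ at p, which suffices because brackets are local.\<close>

lemma smooth_extension:
  assumes V: "openin mtop V" "p \<in> V" and F: "smooth_fun M V F"
  obtains F' W where "F' \<in> Cinf" "openin mtop W" "p \<in> W" "W \<subseteq> V"
    "\<And>q. q \<in> W \<Longrightarrow> F' q = F q"
proof -
  obtain c where c: "c \<in> M" "p \<in> fst c"
    using V chart_exists openin_top by blast
  let ?U = "snd c ` (V \<inter> fst c)"
  have "open ?U" "snd c p \<in> ?U" using open_image V c by auto
  then obtain \<psi> B K where \<psi>: "smooth_on UNIV \<psi>" "open B" "snd c p \<in> B" "\<And>y. y \<in> B \<Longrightarrow> \<psi> y = (1::real)"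
    "compact K" "K \<subseteq> ?U" "B \<subseteq> K" "\<And>y. y \<notin> K \<Longrightarrow> \<psi> y = 0"
    using smooth_cutoff by metis
  define F' where "F' q = (if q \<in> fst c \<inter> V then \<psi> (snd c q) * F q else 0)" for q
  define W where "W = {q \<in> fst c. snd c q \<in> B}"
  let ?KM = "chart_inv c ` K"
  have KV: "?KM \<subseteq> fst c \<inter> V" using \<psi>(6) c by auto
  have Ksub: "K \<subseteq> snd c ` fst c" using \<psi>(6) by auto
  have "continuous_map (top_of_set (snd c ` fst c)) mtop (chart_inv c)"
    unfolding continuous_map_def
  proof (intro conjI allI impI)
    show "chart_inv c \<in> topspace (top_of_set (snd c ` fst c)) \<rightarrow> topspace mtop"
      using c by (auto simp: topspace_top points_def)
  next
    fix A assume "openin mtop A"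
    then have "open (snd c ` (A \<inter> fst c))" using c open_image by blast
    moreover have "{x \<in> topspace (top_of_set (snd c ` fst c)). chart_inv c x \<in> A} =
        snd c ` fst c \<inter> snd c ` (A \<inter> fst c)"
      using c by auto
    ultimately show "openin (top_of_set (snd c ` fst c)) {x \<in> topspace (top_of_set (snd c ` fst c)). chart_inv c x \<in> A}"
      by (metis openin_open_Int)
  qed
  moreover have "compactin (top_of_set (snd c ` fst c)) K"
    using \<psi>(5) Ksub by (simp add: compactin_subtopology compactin_euclidean_iff)
  ultimately have "compactin mtop ?KM" by (rule image_compactin[rotated])
  then have "closedin mtop ?KM"
    using smooth_manifold compactin_imp_closedin by (auto simp: smooth_manifold_def)
  then have co: "openin mtop (points M - ?KM)" by (metis closedin_def topspace_top)
  have "smooth_fun M (points M) F'"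
  proof (rule smooth_funI)
    fix q assume q: "q \<in> points M"
    show "\<exists>d\<in>M. \<exists>A. q \<in> fst d \<and> q \<in> A \<and> openin mtop A \<and>
      smooth_on (snd d ` (A \<inter> fst d)) (F' \<circ> chart_inv d)"
    proof (cases "q \<in> ?KM")
      case True
      have "smooth_on ?U (\<lambda>x. \<psi> x * (F \<circ> chart_inv c) x)"
        by (intro smooth_on_mult smooth_on_subset[OF \<psi>(1)] smooth_fun_chart F c) auto
      then have "smooth_on ?U (F' \<circ> chart_inv c)"
        by (rule smooth_on_cong) (use c in \<open>auto simp: F'_def\<close>)
      then show ?thesis using True KV V c by (intro bexI[of _ c] exI[of _ V]) auto
    next
      case False
      obtain d where d: "d \<in> M" "q \<in> fst d" using q chart_exists by blast
      have "F' r = 0" if "r \<notin> ?KM" for r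
      proof (cases "r \<in> fst c \<inter> V")
        case True
        then have "snd c r \<notin> K" using that c by force
        then show ?thesis by (simp add: F'_def \<psi>)
      qed (auto simp: F'_def)
      then have "smooth_on (snd d ` ((points M - ?KM) \<inter> fst d)) (F' \<circ> chart_inv d)"
        by (intro smooth_on_cong[OF smooth_on_const[of _ 0]]) (use d in auto)
      then show ?thesis using False q d co by (intro bexI[of _ d] exI[of _ "points M - ?KM"]) auto
    qed
  qed
  then have "F' \<in> Cinf"
    using c by (auto simp: smooth_functions_def F'_def points_def)
  moreover have "openin mtop W" unfolding W_def using c \<psi> by (intro openin_chart_vimage) auto
  moreover have "W \<subseteq> V"
  proof
    fix q assume "q \<in> W"
    then have "q \<in> fst c" "snd c q \<in> K" using \<psi>(7) by (auto simp: W_def)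
    then have "q \<in> ?KM" using c by force
    then show "q \<in> V" using KV by auto
  qed
  moreover have "F' q = F q" if "q \<in> W" for q
    using that \<open>W \<subseteq> V\<close> \<psi>(4) by (auto simp: F'_def W_def)
  moreover have "p \<in> W" using c \<psi>(3) by (auto simp: W_def)
  ultimately show thesis using that by blast
qed

end

section \<open>Poisson manifolds\<close>

lemma subspace_dual: "subspace (dual_space V)"
  unfolding subspace_def dual_space_def by (simp add: scaleR_fun_def algebra_simps)

lemma bivectors_linear:
  assumes "B \<in> bivectors D V" "subspace D" "\<beta> \<in> D"
  shows "\<alpha> \<in> D \<Longrightarrow> \<alpha>' \<in> D \<Longrightarrow> B (\<alpha> + \<alpha>') \<beta> = B \<alpha> \<beta> + B \<alpha>' \<beta>"
    and "\<alpha> \<in> D \<Longrightarrow> B (r *\<^sub>R \<alpha>) \<beta> = r * B \<alpha> \<beta>"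
    and "\<alpha> \<in> D \<Longrightarrow> B \<alpha> \<beta> = - B \<beta> \<alpha>"
proof -
  obtain n :: nat and x y where B: "B = (\<lambda>\<alpha> \<beta>. if \<alpha> \<in> D \<and> \<beta> \<in> D
      then \<Sum>i<n. \<alpha> (x i) * \<beta> (y i) - \<alpha> (y i) * \<beta> (x i) else 0)"
    using assms(1) unfolding bivectors_def by blast
  show "\<alpha> \<in> D \<Longrightarrow> \<alpha>' \<in> D \<Longrightarrow> B (\<alpha> + \<alpha>') \<beta> = B \<alpha> \<beta> + B \<alpha>' \<beta>"
    using assms subspace_add[OF assms(2)]
    by (simp add: B algebra_simps flip: sum.distrib)
  show "\<alpha> \<in> D \<Longrightarrow> B (r *\<^sub>R \<alpha>) \<beta> = r * B \<alpha> \<beta>"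
    using assms subspace_scale[OF assms(2)]
    by (simp add: B scaleR_fun_def algebra_simps sum_distrib_left)
  show "\<alpha> \<in> D \<Longrightarrow> B \<alpha> \<beta> = - B \<beta> \<alpha>"
    using assms by (simp add: B algebra_simps flip: sum_negf)
qed

lemma dual_space_additive: "\<alpha> \<in> dual_space V \<Longrightarrow> x \<in> V \<Longrightarrow> y \<in> V \<Longrightarrow> \<alpha> (x + y) = \<alpha> x + \<alpha> y"
  and dual_space_scale: "\<alpha> \<in> dual_space V \<Longrightarrow> x \<in> V \<Longrightarrow> \<alpha> (r *\<^sub>R x) = r * \<alpha> x"
  and dual_space_outside: "\<alpha> \<in> dual_space V \<Longrightarrow> x \<notin> V \<Longrightarrow> \<alpha> x = 0"
  by (auto simp: dual_space_def)

lemma dual_space_minus: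
  assumes "\<alpha> \<in> dual_space V" "subspace V" "x \<in> V" "y \<in> V"
  shows "\<alpha> (x - y) = \<alpha> x - \<alpha> y"
proof -
  have "\<alpha> (x + (-1) *\<^sub>R y) = \<alpha> x + (-1) * \<alpha> y"
    using assms dual_space_additive dual_space_scale subspace_scale by metis
  then show ?thesis by simp
qed

lemma dual_space_sum:
  assumes "\<alpha> \<in> dual_space V" "subspace V" "\<And>i. i \<in> I \<Longrightarrow> x i \<in> V"
  shows "\<alpha> (\<Sum>i\<in>I. x i) = (\<Sum>i\<in>I. \<alpha> (x i))"
proof -
  have "\<alpha> 0 = 0" using dual_space_scale[OF assms(1) subspace_0[OF assms(2)], of 0] by simp
  then show ?thesis
    using assms(3)
  proof (induction I rule: infinite_finite_induct)
    case (insert i I)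
    then show ?case
      using dual_space_additive[OF assms(1), of "x i" "sum x I"] subspace_sum[OF assms(2), of I x] by simp
  qed auto
qed

context manifold
begin

lemma differential_has_derivative:
  assumes "c \<in> M" "q \<in> fst c" "((F \<circ> chart_inv c) has_derivative D) (at (snd c q))"
  shows "dM F q = (\<lambda>X. if X \<in> TM q then D (X c) else 0)"
proof
  fix X
  have "cderiv c F q = D" using frechet_derivative_at[OF assms(3)] by simp
  moreover have "cdiff c F q" using assms(3) by (auto simp: differentiable_def)
  ultimately show "dM F q X = (if X \<in> TM q then D (X c) else 0)"
    using differential_eq[OF assms(1,2), of F X] by (simp add: differential_def)
qed

lemma smooth_fun_has_derivative:
  "openin mtop V \<Longrightarrow> smooth_fun M V F \<Longrightarrow> q \<in> V \<Longrightarrow> c \<in> M \<Longrightarrow> q \<in> fst c \<Longrightarrow>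
    ((F \<circ> chart_inv c) has_derivative cderiv c F q) (at (snd c q))"
  using smooth_fun_chart_diff frechet_derivative_works by blast

lemma differential_smooth:
  assumes "openin mtop V" "q \<in> V" "smooth_fun M V F"
  shows "dM F q \<in> CTM q"
proof -
  obtain c where "c \<in> M" "q \<in> fst c" using assms(1,2) chart_exists openin_top by blast
  then show ?thesis
    by (rule differential_in) (use assms smooth_fun_chart_diff \<open>c \<in> M\<close> \<open>q \<in> fst c\<close> in blast)
qed

lemma differential_arith:
  assumes "openin mtop V" "q \<in> V" "smooth_fun M V F" "smooth_fun M V G"
  shows "dM (\<lambda>p. F p + G p) q = dM F q + dM G q"
    and "dM (\<lambda>p. F p - G p) q = dM F q - dM G q"
    and "dM (\<lambda>p. F p * G p) q = F q *\<^sub>R dM G q + G q *\<^sub>R dM F q"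
proof -
  obtain c where c: "c \<in> M" "q \<in> fst c" using assms(1,2) chart_exists openin_top by blast
  note F = smooth_fun_has_derivative[OF assms(1,3,2) c]
  note G = smooth_fun_has_derivative[OF assms(1,4,2) c]
  note dF = differential_has_derivative[OF c F] and dG = differential_has_derivative[OF c G]
  have "(((\<lambda>p. F p + G p) \<circ> chart_inv c) has_derivative (\<lambda>v. cderiv c F q v + cderiv c G q v)) (at (snd c q))"
    using has_derivative_add[OF F G] by (simp add: o_def)
  from differential_has_derivative[OF c this]
  show "dM (\<lambda>p. F p + G p) q = dM F q + dM G q"
    by (simp add: dF dG fun_eq_iff)
  have "(((\<lambda>p. F p - G p) \<circ> chart_inv c) has_derivative (\<lambda>v. cderiv c F q v - cderiv c G q v)) (at (snd c q))"
    using has_derivative_diff[OF F G] by (simp add: o_def)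
  from differential_has_derivative[OF c this]
  show "dM (\<lambda>p. F p - G p) q = dM F q - dM G q"
    by (simp add: dF dG fun_eq_iff)
  have "(((\<lambda>p. F p * G p) \<circ> chart_inv c) has_derivative (\<lambda>v. F q * cderiv c G q v + cderiv c F q v * G q)) (at (snd c q))"
    using has_derivative_mult[OF F G] c by (simp add: o_def)
  from differential_has_derivative[OF c this]
  show "dM (\<lambda>p. F p * G p) q = F q *\<^sub>R dM G q + G q *\<^sub>R dM F q"
    by (simp add: dF dG fun_eq_iff scaleR_fun_def)
qed

lemma differential_const: "q \<in> points M \<Longrightarrow> dM (\<lambda>p. a) q = 0"
proof -
  assume "q \<in> points M"
  then obtain c where c: "c \<in> M" "q \<in> fst c" using chart_exists by blast
  have "((\<lambda>p. a) \<circ> chart_inv c has_derivative (\<lambda>v. 0)) (at (snd c q))"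
    by (simp add: o_def)
  from differential_has_derivative[OF c this] show "dM (\<lambda>p. a) q = 0"
    by (simp add: fun_eq_iff)
qed

lemma coord_covec_in: "coord_covec M c v q \<in> CTM q"
  unfolding dual_space_def coord_covec_def
  using subspace_add[OF subspace_TM] subspace_scale[OF subspace_TM]
  by (simp add: inner_add_right scaleR_fun_def)

lemma coord_covec_linear:
  "coord_covec M c (u + v) q = coord_covec M c u q + coord_covec M c v q"
  "coord_covec M c (r *\<^sub>R v) q = r *\<^sub>R coord_covec M c v q"
  by (auto simp: coord_covec_def fun_eq_iff inner_add_left scaleR_fun_def)

lemma linear_covec_coord:
  assumes "\<alpha> \<in> CTM q" "c \<in> M" "q \<in> fst c"
  shows "linear (\<lambda>v. \<alpha> (coord_vec M c v q))"
  by (intro linearI) (simp_all add: linear_add[OF linear_coord_vec[OF assms(2,3)]]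
      linear_scale[OF linear_coord_vec[OF assms(2,3)]] dual_space_additive[OF assms(1)]
      dual_space_scale[OF assms(1)] coord_vec_in[OF assms(2,3)])

lemma covec_eq_coord_covec:
  assumes "\<alpha> \<in> CTM q" "c \<in> M" "q \<in> fst c"
  shows "\<alpha> = coord_covec M c (\<Sum>b\<in>Basis. \<alpha> (coord_vec M c b q) *\<^sub>R b) q"
proof
  fix X
  show "\<alpha> X = coord_covec M c (\<Sum>b\<in>Basis. \<alpha> (coord_vec M c b q) *\<^sub>R b) q X"
  proof (cases "X \<in> TM q")
    case True
    have "\<alpha> X = \<alpha> (coord_vec M c (X c) q)" using coord_vec_of_tangent[OF True assms(2,3)] by simp
    also have "\<dots> = (\<Sum>b\<in>Basis. (X c \<bullet> b) *\<^sub>R \<alpha> (coord_vec M c b q))"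
      by (rule linear_basis_expansion[OF linear_covec_coord[OF assms]])
    finally show ?thesis
      using True by (simp add: coord_covec_def inner_sum_left) (simp add: inner_commute mult.commute)
  qed (simp add: coord_covec_def dual_space_outside[OF assms(1)])
qed

text \<open>Coordinate covectors separate tangent vectors; this makes the description in
  \<open>sharp\<close> unique.\<close>

lemma tangent_eqI:
  assumes "q \<in> points M" "X \<in> TM q" "Y \<in> TM q"
    and "\<And>\<beta>. \<beta> \<in> CTM q \<Longrightarrow> \<beta> X = \<beta> Y"
  shows "X = Y"
proof -
  obtain c where c: "c \<in> M" "q \<in> fst c" using assms(1) chart_exists by blast
  have "v \<bullet> X c = v \<bullet> Y c" for v
    using assms(4)[OF coord_covec_in[of c v q]] assms(2,3) by (simp add: coord_covec_def)
  then have "X c = Y c" using vector_eq_ldot[of "X c" "Y c"] by blast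
  then show ?thesis
    using coord_vec_of_tangent[OF assms(2) c] coord_vec_of_tangent[OF assms(3) c] by metis
qed

end

locale poisson = manifold M for M :: "('m, 'a::euclidean_space) chart set" +
  fixes \<pi> :: "('m, 'a) tensor"
  assumes poisson_manifold: "poisson_manifold M \<pi>"
begin

abbreviation "bracket \<equiv> poisson_bracket M \<pi>"

lemma bivector: "q \<in> points M \<Longrightarrow> \<pi> q \<in> bivectors (CTM q) (TM q)"
  using poisson_manifold by (simp add: poisson_manifold_def)

lemma smooth_tensor:
  "c \<in> M \<Longrightarrow> smooth_on (snd c ` fst c) ((\<lambda>q. \<pi> q (coord_covec M c u q) (coord_covec M c v q)) \<circ> chart_inv c)"
  using poisson_manifold by (simp add: poisson_manifold_def)

lemma tensor_antisym:
  "q \<in> points M \<Longrightarrow> \<alpha> \<in> CTM q \<Longrightarrow> \<beta> \<in> CTM q \<Longrightarrow> \<pi> q \<alpha> \<beta> = - \<pi> q \<beta> \<alpha>"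
  by (rule bivectors_linear(3)[OF bivector subspace_dual])

lemma tensor_add_left:
  "q \<in> points M \<Longrightarrow> \<alpha> \<in> CTM q \<Longrightarrow> \<alpha>' \<in> CTM q \<Longrightarrow> \<beta> \<in> CTM q \<Longrightarrow>
    \<pi> q (\<alpha> + \<alpha>') \<beta> = \<pi> q \<alpha> \<beta> + \<pi> q \<alpha>' \<beta>"
  by (rule bivectors_linear(1)[OF bivector subspace_dual])

lemma tensor_scale_left:
  "q \<in> points M \<Longrightarrow> \<alpha> \<in> CTM q \<Longrightarrow> \<beta> \<in> CTM q \<Longrightarrow> \<pi> q (r *\<^sub>R \<alpha>) \<beta> = r * \<pi> q \<alpha> \<beta>"
  by (rule bivectors_linear(2)[OF bivector subspace_dual])

lemma tensor_add_right:
  assumes "q \<in> points M" "\<alpha> \<in> CTM q" "\<beta> \<in> CTM q" "\<beta>' \<in> CTM q"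
  shows "\<pi> q \<alpha> (\<beta> + \<beta>') = \<pi> q \<alpha> \<beta> + \<pi> q \<alpha> \<beta>'"
  using tensor_antisym[OF assms(1,2,3)] tensor_antisym[OF assms(1,2,4)] tensor_add_left[OF assms(1,3,4,2)]
    tensor_antisym[OF assms(1,2) subspace_add[OF subspace_dual assms(3,4)]] by linarith

lemma tensor_scale_right:
  assumes "q \<in> points M" "\<alpha> \<in> CTM q" "\<beta> \<in> CTM q"
  shows "\<pi> q \<alpha> (r *\<^sub>R \<beta>) = r * \<pi> q \<alpha> \<beta>"
  using tensor_antisym[OF assms(1,2,3)] tensor_scale_left[OF assms(1,3,2), of r]
    tensor_antisym[OF assms(1,2) subspace_scale[OF subspace_dual assms(3)], of r] by simp

section \<open>The tensor and its anchor in coordinates\<close>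

abbreviation tensor_coeff :: "('m, 'a) chart \<Rightarrow> 'a \<Rightarrow> 'a \<Rightarrow> 'm \<Rightarrow> real"
  where "tensor_coeff c u v q \<equiv> \<pi> q (coord_covec M c u q) (coord_covec M c v q)"

lemma tensor_coords_right:
  assumes q: "q \<in> points M" and \<alpha>: "\<alpha> \<in> CTM q" and \<beta>: "\<beta> \<in> CTM q"
    and c: "c \<in> M" "q \<in> fst c"
  shows "\<pi> q \<alpha> \<beta> = (\<Sum>b\<in>Basis. \<beta> (coord_vec M c b q) * \<pi> q \<alpha> (coord_covec M c b q))"
proof -
  have l: "linear (\<lambda>v. \<pi> q \<alpha> (coord_covec M c v q))"
    by (intro linearI) (simp_all add: coord_covec_linear tensor_add_right tensor_scale_right q \<alpha> coord_covec_in)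
  have "\<pi> q \<alpha> \<beta> = \<pi> q \<alpha> (coord_covec M c (\<Sum>b\<in>Basis. \<beta> (coord_vec M c b q) *\<^sub>R b) q)"
    using covec_eq_coord_covec[OF \<beta> c] by simp
  also have "\<dots> = (\<Sum>b\<in>Basis. \<beta> (coord_vec M c b q) * \<pi> q \<alpha> (coord_covec M c b q))"
    using linear_sum[OF l, of "\<lambda>b. \<beta> (coord_vec M c b q) *\<^sub>R b" Basis] by (simp add: linear_scale[OF l])
  finally show ?thesis .
qed

lemma tensor_coords_left:
  assumes q: "q \<in> points M" and \<alpha>: "\<alpha> \<in> CTM q" and \<beta>: "\<beta> \<in> CTM q"
    and c: "c \<in> M" "q \<in> fst c"
  shows "\<pi> q \<alpha> \<beta> = (\<Sum>b\<in>Basis. \<alpha> (coord_vec M c b q) * \<pi> q (coord_covec M c b q) \<beta>)"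
  using tensor_coords_right[OF q \<beta> \<alpha> c] tensor_antisym[OF q \<alpha> \<beta>] tensor_antisym[OF q \<beta> coord_covec_in]
  by (simp add: sum_negf)

lemma tensor_coords:
  assumes q: "q \<in> points M" and \<alpha>: "\<alpha> \<in> CTM q" and \<beta>: "\<beta> \<in> CTM q"
    and c: "c \<in> M" "q \<in> fst c"
  shows "\<pi> q \<alpha> \<beta> = (\<Sum>b\<in>Basis. \<Sum>b'\<in>Basis.
    \<alpha> (coord_vec M c b q) * \<beta> (coord_vec M c b' q) * tensor_coeff c b b' q)"
  unfolding tensor_coords_left[OF q \<alpha> \<beta> c] tensor_coords_right[OF q coord_covec_in \<beta> c]
  by (simp add: sum_distrib_left mult.assoc)

text \<open>The subspace V is a parameter because the same contraction serves twice: with V = T_qM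
  it shows that \<open>sharp\<close> is well defined, with V = T_qS that it is tangent to a Poisson
  submanifold.\<close>

lemma sharp_exists:
  assumes q: "q \<in> points M" and \<alpha>: "\<alpha> \<in> CTM q"
    and V: "\<pi> q \<in> bivectors (CTM q) V" "subspace V" "V \<subseteq> TM q"
  shows "sharp M \<pi> q \<alpha> \<in> V" "\<And>\<beta>. \<beta> \<in> CTM q \<Longrightarrow> \<beta> (sharp M \<pi> q \<alpha>) = \<pi> q \<alpha> \<beta>"
proof -
  obtain n :: nat and x y where xy: "\<forall>i<n. x i \<in> V \<and> y i \<in> V"
    and P: "\<pi> q = (\<lambda>\<alpha> \<beta>. if \<alpha> \<in> CTM q \<and> \<beta> \<in> CTM q
      then \<Sum>i<n. \<alpha> (x i) * \<beta> (y i) - \<alpha> (y i) * \<beta> (x i) else 0)"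
    using V(1) unfolding bivectors_def by blast
  \<comment> \<open>The contraction of \<alpha> with the sum of the decomposables x_i wedge
    y_i.\<close>
  define Y where "Y = (\<Sum>i<n. \<alpha> (x i) *\<^sub>R y i - \<alpha> (y i) *\<^sub>R x i)"
  have mem: "\<alpha> (x i) *\<^sub>R y i - \<alpha> (y i) *\<^sub>R x i \<in> V" if "i < n" for i
    using xy that by (intro subspace_diff subspace_scale V) auto
  then have YV: "Y \<in> V" unfolding Y_def by (intro subspace_sum V) auto
  have Y: "\<beta> Y = \<pi> q \<alpha> \<beta>" if "\<beta> \<in> CTM q" for \<beta>
  proof -
    note T = subspace_TM[of q]
    have mem': "x i \<in> TM q" "y i \<in> TM q" if "i < n" for i
      using xy V(3) that by auto
    have "\<beta> Y = (\<Sum>i<n. \<beta> (\<alpha> (x i) *\<^sub>R y i - \<alpha> (y i) *\<^sub>R x i))"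
      unfolding Y_def using mem V(3) by (intro dual_space_sum[OF that T]) auto
    also have "\<dots> = (\<Sum>i<n. \<alpha> (x i) * \<beta> (y i) - \<alpha> (y i) * \<beta> (x i))"
      by (intro sum.cong) (simp_all add: dual_space_minus[OF that T] dual_space_scale[OF that] mem' subspace_scale[OF T])
    finally show ?thesis using that \<alpha> by (simp add: P)
  qed
  have "sharp M \<pi> q \<alpha> = Y"
    unfolding sharp_def
  proof (rule the_equality)
    show "Y \<in> TM q \<and> (\<forall>\<beta>\<in>CTM q. \<beta> Y = \<pi> q \<alpha> \<beta>)"
      using Y YV V(3) by auto
    fix X assume "X \<in> TM q \<and> (\<forall>\<beta>\<in>CTM q. \<beta> X = \<pi> q \<alpha> \<beta>)"
    then show "X = Y" using Y YV V(3) by (intro tangent_eqI[OF q]) auto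
  qed
  then show "sharp M \<pi> q \<alpha> \<in> V" "\<And>\<beta>. \<beta> \<in> CTM q \<Longrightarrow> \<beta> (sharp M \<pi> q \<alpha>) = \<pi> q \<alpha> \<beta>"
    using Y YV by auto
qed

lemmas sharp_in = sharp_exists(1)[OF _ _ bivector subspace_TM subset_refl]
lemmas covec_sharp = sharp_exists(2)[OF _ _ bivector subspace_TM subset_refl]

lemma sharp_coord:
  assumes "q \<in> points M" "\<alpha> \<in> CTM q" "c \<in> M" "q \<in> fst c"
  shows "sharp M \<pi> q \<alpha> c \<bullet> b = (\<Sum>b'\<in>Basis. \<alpha> (coord_vec M c b' q) * tensor_coeff c b' b q)"
proof -
  have "b \<bullet> sharp M \<pi> q \<alpha> c = coord_covec M c b q (sharp M \<pi> q \<alpha>)"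
    using sharp_in[OF assms(1,2)] assms(1) by (simp add: coord_covec_def)
  also have "\<dots> = \<pi> q \<alpha> (coord_covec M c b q)"
    using covec_sharp[OF assms(1,2)] assms(1) coord_covec_in by blast
  also have "\<dots> = (\<Sum>b'\<in>Basis. \<alpha> (coord_vec M c b' q) * tensor_coeff c b' b q)"
    by (rule tensor_coords_left[OF assms(1,2) coord_covec_in assms(3,4)])
  finally show ?thesis by (simp add: inner_commute)
qed

subsection \<open>The bracket of functions\<close>

lemma bracket_cong:
  assumes "openin mtop V" "q \<in> V" "\<And>p. p \<in> V \<Longrightarrow> F p = F' p" "\<And>p. p \<in> V \<Longrightarrow> G p = G' p"
  shows "bracket F G q = bracket F' G' q"
  using differential_cong[OF assms(1,2), of F F'] differential_cong[OF assms(1,2), of G G'] assms(3,4)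
  by (simp add: poisson_bracket_def)

lemma bracket_coords:
  assumes V: "openin mtop V" "q \<in> V" and F: "smooth_fun M V F" and G: "smooth_fun M V G"
    and c: "c \<in> M" "q \<in> fst c"
  shows "bracket F G q = (\<Sum>b\<in>Basis. \<Sum>b'\<in>Basis. cderiv c F q b * cderiv c G q b' * tensor_coeff c b b' q)"
proof -
  have q: "q \<in> points M" using c by (auto simp: points_def)
  have "cdiff c F q" "cdiff c G q"
    using smooth_fun_chart_diff V F G c by blast+
  then show ?thesis
    using tensor_coords[OF q differential_smooth[OF V F] differential_smooth[OF V G] c] q
    by (simp add: poisson_bracket_def differential_coord_vec[OF c])
qed

lemma bracket_smooth:
  assumes V: "openin mtop V" and F: "smooth_fun M V F" and G: "smooth_fun M V G"
  shows "smooth_fun M V (bracket F G)"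
proof (rule smooth_funI)
  fix p assume p: "p \<in> V"
  then obtain c where c: "c \<in> M" "p \<in> fst c" using V chart_exists openin_top by blast
  let ?U = "snd c ` (V \<inter> fst c)"
  let ?s = "\<lambda>f. f \<circ> chart_inv c"
  have "smooth_on ?U (\<lambda>x. \<Sum>b\<in>Basis. \<Sum>b'\<in>Basis. ?s (\<lambda>q. cderiv c F q b) x * ?s (\<lambda>q. cderiv c G q b') x
      * ?s (tensor_coeff c b b') x)"
    by (intro smooth_on_sum smooth_on_mult smooth_on_cderiv V F G c smooth_on_subset[OF smooth_tensor[OF c(1)]]) auto
  then have "smooth_on ?U (bracket F G \<circ> chart_inv c)"
  proof (rule smooth_on_cong)
    fix x assume "x \<in> ?U"
    then have "chart_inv c x \<in> V" "chart_inv c x \<in> fst c" using c by auto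
    from bracket_coords[OF V this(1) F G c(1) this(2)]
    show "(\<Sum>b\<in>Basis. \<Sum>b'\<in>Basis. ?s (\<lambda>q. cderiv c F q b) x * ?s (\<lambda>q. cderiv c G q b') x
      * ?s (tensor_coeff c b b') x) = (bracket F G \<circ> chart_inv c) x" by simp
  qed
  then show "\<exists>c\<in>M. \<exists>W. p \<in> fst c \<and> p \<in> W \<and> openin mtop W \<and> smooth_on (snd c ` (W \<inter> fst c)) (bracket F G \<circ> chart_inv c)"
    using c p V by blast
qed

context
  fixes V F G q
  assumes V: "openin mtop V" "q \<in> V" and F: "smooth_fun M V F" and G: "smooth_fun M V G"
begin

private lemma q: "q \<in> points M"
  using V by (auto simp: openin_top)

lemma bracket_antisym: "bracket F G q = - bracket G F q"
  using tensor_antisym[OF q differential_smooth[OF V F] differential_smooth[OF V G]]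
  by (simp add: poisson_bracket_def)

lemma bracket_add_left:
  "smooth_fun M V H \<Longrightarrow> bracket (\<lambda>p. F p + H p) G q = bracket F G q + bracket H G q"
  using tensor_add_left[OF q differential_smooth[OF V F] differential_smooth[OF V] differential_smooth[OF V G], of H]
  by (simp add: poisson_bracket_def differential_arith[OF V F])

lemma bracket_const_mult: "bracket (\<lambda>p. r * F p) G q = r * bracket F G q"
  using tensor_scale_left[OF q differential_smooth[OF V F] differential_smooth[OF V G], of r]
    differential_arith(3)[OF V smooth_fun_const F, of r]
  by (simp add: poisson_bracket_def differential_const[OF q] q)

lemma bracket_leibniz:
  assumes H: "smooth_fun M V H"
  shows "bracket F (\<lambda>p. G p * H p) q = bracket F G q * H q + G q * bracket F H q"
proof -
  note dF = differential_smooth[OF V F] and dG = differential_smooth[OF V G] and dH = differential_smooth[OF V H]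
  show ?thesis
    using subspace_scale[OF subspace_dual dG] subspace_scale[OF subspace_dual dH]
    by (simp add: poisson_bracket_def differential_arith[OF V G H] q tensor_add_right[OF q dF]
        tensor_scale_right[OF q dF dG] tensor_scale_right[OF q dF dH])
qed

text \<open>The three germs are extended to M, where the identity is an axiom, and locality of the
  bracket brings it back; on W all three extensions agree with the given functions.\<close>

lemma bracket_jacobi:
  assumes H: "smooth_fun M V H"
  shows "bracket F (bracket G H) q + bracket G (bracket H F) q + bracket H (bracket F G) q = 0"
proof -
  obtain F' A where F': "F' \<in> Cinf" "openin mtop A" "q \<in> A" "\<And>p. p \<in> A \<Longrightarrow> F' p = F p"
    using smooth_extension[OF V F] by metis
  obtain G' B where G': "G' \<in> Cinf" "openin mtop B" "q \<in> B" "\<And>p. p \<in> B \<Longrightarrow> G' p = G p"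
    using smooth_extension[OF V G] by metis
  obtain H' C where H': "H' \<in> Cinf" "openin mtop C" "q \<in> C" "\<And>p. p \<in> C \<Longrightarrow> H' p = H p"
    using smooth_extension[OF V H] by metis
  define W where "W = A \<inter> B \<inter> C"
  have W: "openin mtop W" "q \<in> W" using F' G' H' by (auto simp: W_def)
  have eq: "F' p = F p" "G' p = G p" "H' p = H p" if "p \<in> W" for p
    using that F' G' H' by (auto simp: W_def)
  have "bracket X (bracket Y Z) q = bracket X' (bracket Y' Z') q"
    if "\<And>p. p \<in> W \<Longrightarrow> X p = X' p" "\<And>p. p \<in> W \<Longrightarrow> Y p = Y' p" "\<And>p. p \<in> W \<Longrightarrow> Z p = Z' p" for X X' Y Y' Z Z'
    by (rule bracket_cong[OF W that(1) bracket_cong[OF W(1) _ that(2) that(3)]])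
  note c = this
  have "bracket F' (bracket G' H') + bracket G' (bracket H' F') + bracket H' (bracket F' G') = 0"
    using poisson_manifold F'(1) G'(1) H'(1) by (simp add: poisson_manifold_def)
  then have "bracket F' (bracket G' H') q + bracket G' (bracket H' F') q + bracket H' (bracket F' G') q = 0"
    by (auto dest: fun_cong[of _ _ q])
  then show ?thesis
    using c[of F' F G' G H' H, OF eq(1) eq(2) eq(3)] c[of G' G H' H F' F, OF eq(2) eq(3) eq(1)]
      c[of H' H F' F G' G, OF eq(3) eq(1) eq(2)] by simp
qed

end

subsection \<open>The bracket of 1-forms\<close>

lemma covector_fieldD:
  assumes "\<alpha> \<in> Forms"
  shows "q \<in> points M \<Longrightarrow> \<alpha> q \<in> CTM q"
    and "c \<in> M \<Longrightarrow> smooth_on (snd c ` fst c) ((\<lambda>q. \<alpha> q (coord_vec M c v q)) \<circ> chart_inv c)"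
proof -
  show "q \<in> points M \<Longrightarrow> \<alpha> q \<in> CTM q"
    using assms by (simp add: covector_fields_def)
  assume c: "c \<in> M"
  then have "points M \<inter> fst c = fst c" by (auto simp: points_def)
  with assms c show "smooth_on (snd c ` fst c) ((\<lambda>q. \<alpha> q (coord_vec M c v q)) \<circ> chart_inv c)"
    unfolding covector_fields_def by fastforce
qed

text \<open>All derivatives of \<alpha> and \<beta> in the direction X cancel: those from the two
  exterior derivatives against those from d<\<alpha>, sharp \<beta>>, by antisymmetry of the tensor.
  Derivatives along the two anchors survive, and a derivative of the tensor, in which \<alpha> and
  \<beta> enter only by their values at q. The chart is \<open>chart_at M q\<close> because
  \<open>ext_deriv\<close> is computed in it.\<close>

lemma form_bracket_coords:
  assumes \<alpha>: "\<alpha> \<in> Forms" and \<beta>: "\<beta> \<in> Forms"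
    and q: "q \<in> points M" and X: "X \<in> TM q" and c: "c = chart_at M q"
  shows "form_bracket M \<pi> \<alpha> \<beta> q X =
    cderiv c (\<lambda>p. \<beta> p (coord_vec M c (X c) p)) q (sharp M \<pi> q (\<alpha> q) c) -
    cderiv c (\<lambda>p. \<alpha> p (coord_vec M c (X c) p)) q (sharp M \<pi> q (\<beta> q) c) +
    (\<Sum>b\<in>Basis. \<Sum>b'\<in>Basis. \<alpha> q (coord_vec M c b q) * \<beta> q (coord_vec M c b' q) *
      cderiv c (tensor_coeff c b b') q (X c))"
proof -
  have cM: "c \<in> M" "q \<in> fst c"
    using chart_exists[OF q] chart_at c by metis+
  have pts: "p \<in> points M" if "p \<in> fst c" for p using that cM by (auto simp: points_def)
  let ?a = "\<lambda>v p. \<alpha> p (coord_vec M c v p)" and ?b = "\<lambda>v p. \<beta> p (coord_vec M c v p)"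
  let ?P = "tensor_coeff c"
  let ?D = "\<lambda>f. cderiv c f q"
  let ?Y = "sharp M \<pi> q (\<alpha> q)" and ?Z = "sharp M \<pi> q (\<beta> q)"
  note op = open_chart[OF cM(1)]
  have der: "((f \<circ> chart_inv c) has_derivative ?D f) (at (snd c q))"
    if "smooth_on (snd c ` fst c) (f \<circ> chart_inv c)" for f :: "'m \<Rightarrow> real"
    by (rule smooth_on_has_derivative[OF op that]) (use cM in auto)
  have da: "((?a v \<circ> chart_inv c) has_derivative ?D (?a v)) (at (snd c q))" for v
    by (rule der[OF covector_fieldD(2)[OF \<alpha> cM(1)]])
  have db: "((?b v \<circ> chart_inv c) has_derivative ?D (?b v)) (at (snd c q))" for v
    by (rule der[OF covector_fieldD(2)[OF \<beta> cM(1)]])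
  have dP: "((?P u v \<circ> chart_inv c) has_derivative ?D (?P u v)) (at (snd c q))" for u v
    by (rule der[OF smooth_tensor[OF cM(1)]])
  \<comment> \<open>Lets a vector such as \<open>?Y c\<close>, frozen at q, be replaced by basis
    vectors, so that all terms become double sums over the same derivatives.\<close>
  have expand: "?D (\<lambda>p. \<gamma> p (coord_vec M c v p)) w = (\<Sum>b\<in>Basis. (v \<bullet> b) * ?D (\<lambda>p. \<gamma> p (coord_vec M c b p)) w)"
    if \<gamma>: "\<gamma> \<in> Forms" for \<gamma> v w
  proof -
    have "?D (\<lambda>p. \<gamma> p (coord_vec M c v p)) = ?D (\<lambda>p. \<Sum>b\<in>Basis. (v \<bullet> b) * \<gamma> p (coord_vec M c b p))"
    proof (rule cderiv_cong(1)[OF openin_chart[OF cM(1)] cM(2) cM])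
      fix p assume "p \<in> fst c"
      then show "\<gamma> p (coord_vec M c v p) = (\<Sum>b\<in>Basis. (v \<bullet> b) * \<gamma> p (coord_vec M c b p))"
        using linear_basis_expansion[OF linear_covec_coord[OF covector_fieldD(1)[OF \<gamma> pts] cM(1)], of p v] by simp
    qed
    moreover have "(((\<lambda>p. \<Sum>b\<in>Basis. (v \<bullet> b) * \<gamma> p (coord_vec M c b p)) \<circ> chart_inv c) has_derivative
        (\<lambda>w. \<Sum>b\<in>Basis. (v \<bullet> b) * ?D (\<lambda>p. \<gamma> p (coord_vec M c b p)) w)) (at (snd c q))"
      using der[OF covector_fieldD(2)[OF \<gamma> cM(1)]]
      by (auto intro!: has_derivative_sum has_derivative_mult_right simp: o_def)
    ultimately show ?thesis by (simp add: frechet_derivative_at[symmetric])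
  qed
  \<comment> \<open><\<alpha>, sharp \<beta>> is \<pi>(\<beta>, \<alpha>), so the coefficients of
    \<beta> go with the first index of the tensor.\<close>
  have pair: "\<alpha> p (sharp M \<pi> p (\<beta> p)) = (\<Sum>b\<in>Basis. \<Sum>b'\<in>Basis. ?b b p * ?a b' p * ?P b b' p)"
    if "p \<in> fst c" for p
    using covec_sharp[OF pts[OF that] covector_fieldD(1)[OF \<beta> pts[OF that]] _ covector_fieldD(1)[OF \<alpha> pts[OF that]]]
      tensor_coords[OF pts[OF that] covector_fieldD(1)[OF \<beta> pts[OF that]] covector_fieldD(1)[OF \<alpha> pts[OF that]] cM(1) that]
      pts[OF that] by simp
  have "((\<lambda>p. \<Sum>b\<in>Basis. \<Sum>b'\<in>Basis. ?b b p * ?a b' p * ?P b b' p) \<circ> chart_inv c has_derivative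
      (\<lambda>w. \<Sum>b\<in>Basis. \<Sum>b'\<in>Basis. (?b b q * ?a b' q) * ?D (?P b b') w +
        (?b b q * ?D (?a b') w + ?D (?b b) w * ?a b' q) * ?P b b' q)) (at (snd c q))"
    using has_derivative_sum[OF has_derivative_sum[OF has_derivative_mult[OF has_derivative_mult[OF db da] dP]]] cM
    by (simp add: o_def)
  note dsum = this
  have eqp: "?D (\<lambda>p. \<Sum>b\<in>Basis. \<Sum>b'\<in>Basis. ?b b p * ?a b' p * ?P b b' p) = ?D (\<lambda>p. \<alpha> p (sharp M \<pi> p (\<beta> p)))"
    by (rule cderiv_cong(1)[OF openin_chart[OF cM(1)] cM(2) cM]) (rule pair[symmetric])
  have Dpair: "?D (\<lambda>p. \<alpha> p (sharp M \<pi> p (\<beta> p))) w = (\<Sum>b\<in>Basis. \<Sum>b'\<in>Basis. (?b b q * ?a b' q) * ?D (?P b b') w +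
        (?b b q * ?D (?a b') w + ?D (?b b) w * ?a b' q) * ?P b b' q)" for w
    unfolding eqp[symmetric] frechet_derivative_at[OF dsum, symmetric] ..
  have diffp: "cdiff c (\<lambda>p. \<alpha> p (sharp M \<pi> p (\<beta> p))) q"
    by (rule cderiv_cong(2)[OF openin_chart[OF cM(1)] cM(2) cM _ differentiableI[OF dsum]]) (rule pair[symmetric])
  have d: "dM (\<lambda>p. \<alpha> p (sharp M \<pi> p (\<beta> p))) q X = ?D (\<lambda>p. \<alpha> p (sharp M \<pi> p (\<beta> p))) (X c)"
    by (rule differential_eq[OF cM diffp X])
  have anti: "?P b b' p = - ?P b' b p" if "p \<in> fst c" for b b' p
    by (rule tensor_antisym[OF pts[OF that] coord_covec_in coord_covec_in])
  have DP: "?D (?P b b') w = - ?D (?P b' b) w" for b b' w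
  proof -
    have "?D (?P b b') = ?D (\<lambda>p. - ?P b' b p)"
      by (rule cderiv_cong(1)[OF openin_chart[OF cM(1)] cM(2) cM]) (rule anti)
    also have "((\<lambda>p. - ?P b' b p) \<circ> chart_inv c has_derivative (\<lambda>w. - ?D (?P b' b) w)) (at (snd c q))"
      using has_derivative_minus[OF dP] by (simp add: o_def)
    then have "?D (\<lambda>p. - ?P b' b p) = (\<lambda>w. - ?D (?P b' b) w)" by (simp add: frechet_derivative_at[symmetric])
    finally show ?thesis by simp
  qed
  have Yb: "?D (?b (?Y c)) w = (\<Sum>b\<in>Basis. \<Sum>b'\<in>Basis. ?a b' q * ?P b' b q * ?D (?b b) w)" for w
    unfolding expand[OF \<beta>, of "?Y c"] sharp_coord[OF q covector_fieldD(1)[OF \<alpha> q] cM] by (simp add: sum_distrib_right)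
  have Za: "?D (?a (?Z c)) w = (\<Sum>b'\<in>Basis. \<Sum>b\<in>Basis. ?b b q * ?P b b' q * ?D (?a b') w)" for w
    unfolding expand[OF \<alpha>, of "?Z c"] sharp_coord[OF q covector_fieldD(1)[OF \<beta> q] cM] by (simp add: sum_distrib_right)
  have Za': "?D (?a (?Z c)) w = (\<Sum>b\<in>Basis. \<Sum>b'\<in>Basis. ?b b q * ?P b b' q * ?D (?a b') w)" for w
    unfolding Za by (rule sum.swap)
  have S: "(\<Sum>b\<in>Basis. \<Sum>b'\<in>Basis. ?a b q * ?b b' q * ?D (?P b b') (X c)) =
      (\<Sum>b\<in>Basis. \<Sum>b'\<in>Basis. ?a b' q * ?b b q * ?D (?P b' b) (X c))"
    by (rule sum.swap)
  have "form_bracket M \<pi> \<alpha> \<beta> q X =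
      (?D (?b (X c)) (?Y c) - ?D (?b (?Y c)) (X c)) - (?D (?a (X c)) (?Z c) - ?D (?a (?Z c)) (X c))
      - ?D (\<lambda>p. \<alpha> p (sharp M \<pi> p (\<beta> p))) (X c)"
    using q X by (simp add: form_bracket_def ext_deriv_def Let_def d flip: c)
  \<comment> \<open>The cancellation is term by term once the tensor indices are swapped at the cost
    of a sign (\<open>anti\<close>, \<open>DP\<close>); the leftover carries the swapped indices,
    which \<open>S\<close> puts back in order.\<close>
  moreover have "- ?D (?b (?Y c)) (X c) + ?D (?a (?Z c)) (X c) - ?D (\<lambda>p. \<alpha> p (sharp M \<pi> p (\<beta> p))) (X c) =
      (\<Sum>b\<in>Basis. \<Sum>b'\<in>Basis. ?a b q * ?b b' q * ?D (?P b b') (X c))"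
  proof -
    have "- (?a b' q * ?P b' b q * ?D (?b b) (X c)) + ?b b q * ?P b b' q * ?D (?a b') (X c) -
        ((?b b q * ?a b' q) * ?D (?P b b') (X c) + (?b b q * ?D (?a b') (X c) + ?D (?b b) (X c) * ?a b' q) * ?P b b' q) =
        ?a b' q * ?b b q * ?D (?P b' b) (X c)" for b b'
      unfolding anti[OF cM(2), of b' b] DP[of b' b "X c"] by (simp add: algebra_simps)
    then show ?thesis
      unfolding Yb Za' Dpair S
      by (simp only: sum_negf[symmetric] sum.distrib[symmetric] sum_subtractf[symmetric])
  qed
  ultimately show ?thesis by linarith
qed

text \<open>The value 0 off \<open>points M\<close> is what \<open>covector_fields\<close> requires;
  there \<open>differential\<close> refers to an arbitrary chart.\<close>

definition exact_form :: "('m \<Rightarrow> real) \<Rightarrow> 'm \<Rightarrow> ('m, 'a) covec"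
  where "exact_form F = (\<lambda>p. if p \<in> points M then dM F p else 0)"

lemma exact_form_covector_field:
  assumes F: "F \<in> Cinf"
  shows "exact_form F \<in> Forms"
proof -
  have F: "smooth_fun M (points M) F" using assms by (simp add: smooth_functions_def)
  have "smooth_on (snd c ` (points M \<inter> fst c)) ((\<lambda>q. exact_form F q (coord_vec M c v q)) \<circ> chart_inv c)"
    if c: "c \<in> M" for c v
  proof (rule smooth_on_cong[OF smooth_on_cderiv[OF openin_points F c, of v]])
    fix x assume "x \<in> snd c ` (points M \<inter> fst c)"
    then have "chart_inv c x \<in> points M" "chart_inv c x \<in> fst c" using c by auto
    then show "((\<lambda>q. cderiv c F q v) \<circ> chart_inv c) x = ((\<lambda>q. exact_form F q (coord_vec M c v q)) \<circ> chart_inv c) x"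
      using differential_coord_vec[OF c, of "chart_inv c x" F v] smooth_fun_chart_diff[OF openin_points F _ c]
      by (simp add: exact_form_def)
  qed
  then show ?thesis
    using differential_smooth[OF openin_points _ F] by (auto simp: covector_fields_def exact_form_def)
qed

text \<open>Exact forms are closed, so of the three terms only -d<dF, sharp dG> = -d(\<pi>(dG, dF))
  is left, which is d{F, G} by antisymmetry.\<close>

lemma form_bracket_exact:
  assumes F: "F \<in> Cinf" and G: "G \<in> Cinf" and q: "q \<in> points M"
  shows "form_bracket M \<pi> (exact_form F) (exact_form G) q = dM (bracket F G) q"
proof
  fix X
  have sm: "smooth_fun M (points M) F" "smooth_fun M (points M) G" using F G by (simp_all add: smooth_functions_def)
  show "form_bracket M \<pi> (exact_form F) (exact_form G) q X = dM (bracket F G) q X"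
  proof (cases "X \<in> TM q")
    case True
    define c where "c = chart_at M q"
    have c: "c \<in> M" "q \<in> fst c"
      using chart_exists[OF q] chart_at c_def by metis+
    have pts: "p \<in> points M" if "p \<in> fst c" for p using that c by (auto simp: points_def)
    \<comment> \<open>In the chart, the two terms of \<open>ext_deriv\<close> are the two mixed
      second derivatives of H.\<close>
    have closed: "ext_deriv M (exact_form H) q Y Z = 0" if H: "smooth_fun M (points M) H" for H Y Z
    proof -
      have ch: "smooth_on (snd c ` fst c) (H \<circ> chart_inv c)"
        by (rule smooth_on_subset[OF smooth_fun_chart[OF H c(1)]]) (use pts in auto)
      have "cderiv c (\<lambda>p. exact_form H p (coord_vec M c v p)) q =
          frechet_derivative (\<lambda>y. frechet_derivative (H \<circ> chart_inv c) (at y) v) (at (snd c q))" for v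
      proof (rule frechet_cong_open(1)[OF open_chart[OF c(1)]])
        fix y assume "y \<in> snd c ` fst c"
        then obtain p where p: "p \<in> fst c" "y = snd c p" by auto
        then show "((\<lambda>p. exact_form H p (coord_vec M c v p)) \<circ> chart_inv c) y = frechet_derivative (H \<circ> chart_inv c) (at y) v"
          using differential_coord_vec[OF c(1) p(1) smooth_fun_chart_diff[OF openin_points H pts[OF p(1)] c(1) p(1)]]
            pts[OF p(1)] c by (simp add: exact_form_def)
      qed (use c in auto)
      moreover have "Ck_on 2 (snd c ` fst c) (H \<circ> chart_inv c)"
        using ch open_chart[OF c(1)] smooth_on_open_iff by blast
      ultimately show ?thesis
        using second_derivative_symmetric[OF _ open_chart[OF c(1)], of "H \<circ> chart_inv c" "snd c q" "Z c" "Y c"] c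
        by (simp add: ext_deriv_def Let_def flip: c_def)
    qed
    have "exact_form F p (sharp M \<pi> p (exact_form G p)) = 0 - bracket F G p" if "p \<in> points M" for p
      using covec_sharp[OF that differential_smooth[OF openin_points that sm(2)] that
          differential_smooth[OF openin_points that sm(1)]] that
        bracket_antisym[OF openin_points that sm]
      by (simp add: exact_form_def poisson_bracket_def)
    then have "dM (\<lambda>p. exact_form F p (sharp M \<pi> p (exact_form G p))) q = dM (\<lambda>p. 0 - bracket F G p) q"
      by (intro differential_cong[OF openin_points q])
    also have "\<dots> = dM (\<lambda>p. 0) q - dM (bracket F G) q"
      by (rule differential_arith(2)[OF openin_points q smooth_fun_const bracket_smooth[OF openin_points sm]])
    also have "\<dots> = - dM (bracket F G) q"
      using differential_const[OF q] by simp
    finally show ?thesis using True q by (simp add: form_bracket_def closed sm)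
  qed (simp add: form_bracket_def differential_def)
qed

end

section \<open>Poisson submanifolds\<close>

lemma scaleR_fun_apply: "(r *\<^sub>R f) x = r *\<^sub>R f x"
  by (simp add: scaleR_fun_def)

section \<open>Projections and derivatives in linear subspaces\<close>

lemma orthogonal_projection:
  fixes W :: "'a::euclidean_space set"
  assumes "subspace W"
  obtains p where "bounded_linear p" "\<And>x. p x \<in> W" "\<And>x. x \<in> W \<Longrightarrow> p x = x"
    "\<And>x. x - p x \<in> orthogonal_comp W" "\<And>x. x \<in> orthogonal_comp W \<Longrightarrow> p x = 0"
proof -
  obtain B where B: "B \<subseteq> W" "pairwise orthogonal B" "\<And>x. x \<in> B \<Longrightarrow> norm x = 1"
    "independent B" "span B = W"
    using orthonormal_basis_subspace[OF assms] by metis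
  have fin: "finite B" using B(4) independent_imp_finite by blast
  define p where "p x = (\<Sum>b\<in>B. (x \<bullet> b) *\<^sub>R b)" for x :: 'a
  have ip: "p x \<bullet> b = x \<bullet> b" if "b \<in> B" for x b
  proof -
    have "p x \<bullet> b = (\<Sum>b'\<in>B. (x \<bullet> b') * (b' \<bullet> b))"
      by (simp add: p_def inner_sum_left)
    also have "\<dots> = (\<Sum>b'\<in>B. if b' = b then x \<bullet> b else 0)"
      using B(2,3) that by (intro sum.cong) (auto simp: pairwise_def orthogonal_def norm_eq_1)
    also have "\<dots> = x \<bullet> b" using fin that by simp
    finally show ?thesis .
  qed
  have pW: "p x \<in> W" for x
    unfolding p_def using B(1) by (intro subspace_sum assms subspace_scale) auto
  have orth: "x - p x \<in> orthogonal_comp W" for x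
  proof -
    have "orthogonal (x - p x) y" if "y \<in> span B" for y
      using that by (rule orthogonal_to_span) (simp add: orthogonal_def inner_diff_left ip)
    then show ?thesis by (simp add: orthogonal_comp_def B(5) orthogonal_commute)
  qed
  have "p x = x" if "x \<in> W" for x
  proof -
    have "x - p x \<in> W" using that pW assms subspace_diff by blast
    then have "orthogonal (x - p x) (x - p x)" using orth by (simp add: orthogonal_comp_def)
    then show ?thesis by (simp add: orthogonal_def)
  qed
  moreover have "p x = 0" if "x \<in> orthogonal_comp W" for x
    using that B(1) by (auto simp: p_def orthogonal_comp_def orthogonal_def inner_commute intro!: sum.neutral)
  moreover have "bounded_linear p"
    unfolding p_def by (intro bounded_linear_sum bounded_linear_scaleR_const bounded_linear_inner_left)
  ultimately show thesis using that pW orth by blast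
qed

lemma has_vector_derivative_const_near:
  assumes "(g has_vector_derivative g') (at 0)" "\<epsilon> > 0" "\<And>t. \<bar>t\<bar> < \<epsilon> \<Longrightarrow> g t = a"
  shows "g' = 0"
proof -
  have "((\<lambda>t. a) has_vector_derivative g') (at 0)"
    by (rule has_vector_derivative_transform_within_open[OF assms(1), of "ball 0 \<epsilon>"])
      (use assms(2,3) in \<open>auto simp: dist_real_def\<close>)
  then show ?thesis using vector_derivative_unique_at has_vector_derivative_const by blast
qed

text \<open>Pair g with the component z of g' orthogonal to W: the product vanishes near 0, so its
  derivative, which is the squared length of z, is 0.\<close>

lemma has_vector_derivative_in_subspace:
  fixes g :: "real \<Rightarrow> 'a::euclidean_space"
  assumes "(g has_vector_derivative g') (at 0)" "\<epsilon> > 0" "\<And>t. \<bar>t\<bar> < \<epsilon> \<Longrightarrow> g t \<in> W" "subspace W"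
  shows "g' \<in> W"
proof -
  obtain y z where yz: "y \<in> W" "\<And>w. w \<in> W \<Longrightarrow> orthogonal z w" "g' = y + z"
    using orthogonal_subspace_decomp_exists[of W g'] assms(4) by (metis span_eq_iff)
  have "((\<lambda>t. g t \<bullet> z) has_vector_derivative g' \<bullet> z) (at 0)"
    by (rule bounded_linear.has_vector_derivative[OF bounded_linear_inner_left assms(1)])
  moreover have "g t \<bullet> z = 0" if "\<bar>t\<bar> < \<epsilon>" for t
    using yz(2)[OF assms(3)[OF that]] by (simp add: orthogonal_def inner_commute)
  ultimately have "g' \<bullet> z = 0"
    using has_vector_derivative_const_near[OF _ assms(2)] by blast
  then have "z \<bullet> z = 0"
    using yz(2)[OF yz(1)] yz(3) by (simp add: inner_add_left orthogonal_def inner_commute[of y z])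
  then have "z = 0" by simp
  then show ?thesis using yz by simp
qed

text \<open>A line through x in a direction of W stays in W, which pins the derivative down on such
  directions. These are all the directions that the differential of a function on S sees.\<close>

lemma has_derivative_within_subspace_unique:
  assumes "(g has_derivative D) (at x within W)" "(g has_derivative D') (at x within W)"
    and "subspace W" "x \<in> W" "w \<in> W"
  shows "D w = D' w"
proof -
  let ?l = "\<lambda>t. x + t *\<^sub>R w"
  have l: "(?l has_derivative (\<lambda>s. s *\<^sub>R w)) (at 0)"
    by (auto intro!: derivative_eq_intros)
  have sub: "range ?l \<subseteq> W" using assms(3-5) by (auto intro!: subspace_add subspace_scale)
  have *: "(g \<circ> ?l has_derivative E \<circ> (\<lambda>s. s *\<^sub>R w)) (at 0)" if "(g has_derivative E) (at x within W)" for E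
    using diff_chain_within[OF l, of g E] has_derivative_subset[OF that sub] by simp
  have "D \<circ> (\<lambda>s. s *\<^sub>R w) = D' \<circ> (\<lambda>s. s *\<^sub>R w)"
    by (rule has_derivative_unique[OF *[OF assms(1)] *[OF assms(2)]])
  from fun_cong[OF this, of 1] show ?thesis by simp
qed

locale poisson_sub = poisson M \<pi> for M :: "('m, 'a::euclidean_space) chart set" and \<pi> +
  fixes S :: "'m set"
  assumes poisson_submanifold: "poisson_submanifold M \<pi> S"
begin

abbreviation "TS \<equiv> tangent_subspace M S"
abbreviation "cls \<equiv> normal_class M S"
abbreviation "Conormal \<equiv> conormal_space M S"
abbreviation "nu \<equiv> nu_dual M S"

lemma S_points: "q \<in> S \<Longrightarrow> q \<in> points M"
  using poisson_submanifold by (auto simp: poisson_submanifold_def embedded_submanifold_def)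

section \<open>Tangent vectors of the submanifold and derivatives along them\<close>

lemma slice_exists:
  assumes "q \<in> S"
  obtains c W where "slice_chart M S c W" "q \<in> fst c"
  using poisson_submanifold assms by (auto simp: poisson_submanifold_def embedded_submanifold_def)

lemma slice_chart_in: "slice_chart M S c W \<Longrightarrow> c \<in> M"
  and slice_subspace: "slice_chart M S c W \<Longrightarrow> subspace W"
  and slice_image: "slice_chart M S c W \<Longrightarrow> snd c ` (fst c \<inter> S) = snd c ` fst c \<inter> W"
  by (auto simp: slice_chart_def)

lemma slice_mem: "slice_chart M S c W \<Longrightarrow> q \<in> S \<Longrightarrow> q \<in> fst c \<Longrightarrow> snd c q \<in> W"
  using slice_image by blast

lemma slice_inv_mem:
  assumes "slice_chart M S c W" "y \<in> snd c ` fst c" "y \<in> W"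
  shows "chart_inv c y \<in> S"
proof -
  have "y \<in> snd c ` (fst c \<inter> S)" using slice_image[OF assms(1)] assms(2,3) by blast
  then show ?thesis using slice_chart_in[OF assms(1)] by auto
qed

text \<open>Straight coordinate lines in directions of W supply the curves in S along which the
  tangential derivatives below are computed.\<close>

lemma slice_line:
  assumes c: "slice_chart M S c W" and q: "q \<in> S" "q \<in> fst c" and V: "openin mtop V" "q \<in> V" and w: "w \<in> W"
  obtains \<epsilon> where "\<epsilon> > 0"
    "\<And>t. \<bar>t\<bar> < \<epsilon> \<Longrightarrow> snd c q + t *\<^sub>R w \<in> snd c ` (V \<inter> fst c)"
    "\<And>t. \<bar>t\<bar> < \<epsilon> \<Longrightarrow> chart_inv c (snd c q + t *\<^sub>R w) \<in> S \<inter> V"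
proof -
  note cM = slice_chart_in[OF c]
  let ?l = "\<lambda>t::real. snd c q + t *\<^sub>R w"
  have "open (?l -` (snd c ` (V \<inter> fst c)))"
    by (intro continuous_open_vimage open_image V cM continuous_intros) 
  moreover have "0 \<in> ?l -` (snd c ` (V \<inter> fst c))" using q V by simp
  ultimately obtain \<epsilon> where \<epsilon>: "\<epsilon> > 0" "ball 0 \<epsilon> \<subseteq> ?l -` (snd c ` (V \<inter> fst c))"
    using open_contains_ball by blast
  have mem: "?l t \<in> snd c ` (V \<inter> fst c)" if "\<bar>t\<bar> < \<epsilon>" for t
    using \<epsilon>(2) that by (auto simp: subset_iff dist_real_def)
  have "?l t \<in> W" for t
    using slice_subspace[OF c] slice_mem[OF c q] w by (simp add: subspace_add subspace_scale)
  then have "chart_inv c (?l t) \<in> S \<inter> V" if "\<bar>t\<bar> < \<epsilon>" for t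
    using mem[OF that] slice_inv_mem[OF c, of "?l t"] cM by auto
  with mem \<epsilon>(1) show thesis using that by blast
qed

text \<open>The definition quantifies over all slice charts, but one decides: a coordinate line of c
  in a direction of W lies in S, so read in another slice chart d it runs in W', and its velocity
  lies there too.\<close>

lemma tangent_subspace_eq:
  assumes c: "slice_chart M S c W" and q: "q \<in> S" "q \<in> fst c"
  shows "X \<in> TS q \<longleftrightarrow> X \<in> TM q \<and> X c \<in> W"
proof
  assume "X \<in> TS q"
  then show "X \<in> TM q \<and> X c \<in> W" using c q unfolding tangent_subspace_def by blast
next
  assume X: "X \<in> TM q \<and> X c \<in> W"
  have "X d \<in> W'" if d: "slice_chart M S d W'" "q \<in> fst d" for d W'
  proof -
    note cM = slice_chart_in[OF c] and dM = slice_chart_in[OF d(1)]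
    have "X c \<in> W" using X by simp
    then obtain \<epsilon> where \<epsilon>: "\<epsilon> > 0"
      "\<And>t. \<bar>t\<bar> < \<epsilon> \<Longrightarrow> chart_inv c (snd c q + t *\<^sub>R X c) \<in> S \<inter> fst d"
      using slice_line[OF c q openin_chart[OF dM] d(2), of "X c" thesis] by blast
    have "((\<lambda>t. (snd d \<circ> chart_inv c) (snd c q + t *\<^sub>R X c)) has_vector_derivative cderiv c (snd d) q (X c)) (at 0)"
      using has_vector_derivative_along_line[of "snd d \<circ> chart_inv c" "cderiv c (snd d) q" "snd c q" 0 "X c"]
        transition_differentiable[OF cM dM q(2) d(2), unfolded frechet_derivative_works] by simp
    then have "cderiv c (snd d) q (X c) \<in> W'"
      by (rule has_vector_derivative_in_subspace[OF _ \<epsilon>(1) _ slice_subspace[OF d(1)]])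
        (use \<epsilon>(2) slice_mem[OF d(1)] in auto)
    then show ?thesis using tangent_spaceD[of X q c d] X cM dM q d by simp
  qed
  then show "X \<in> TS q" using X unfolding tangent_subspace_def by blast
qed

lemma TS_subset: "TS q \<subseteq> TM q"
  by (auto simp: tangent_subspace_def)

lemma subspace_TS:
  assumes "q \<in> S"
  shows "subspace (TS q)"
proof -
  obtain c W where c: "slice_chart M S c W" "q \<in> fst c" using slice_exists assms by blast
  note eq = tangent_subspace_eq[OF c(1) assms c(2)]
  note T = subspace_TM[of q] and W = slice_subspace[OF c(1)]
  show ?thesis
    by (rule subspaceI) (simp_all add: eq scaleR_fun_apply subspace_0[OF T] subspace_0[OF W] subspace_add[OF T]
        subspace_add[OF W] subspace_scale[OF T] subspace_scale[OF W])
qed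

text \<open>In a slice chart X is the velocity of a straight line in S, along which F is constant;
  \<open>cderiv_change\<close> carries the result to c, which need not be adapted to S.\<close>

lemma deriv_const_on_S:
  fixes F :: "'m \<Rightarrow> real"
  assumes q: "q \<in> S" and V: "openin mtop V" "q \<in> V" and F: "\<And>p. p \<in> V \<Longrightarrow> p \<in> S \<Longrightarrow> F p = a"
    and c: "c \<in> M" "q \<in> fst c" and d: "cdiff c F q" and X: "X \<in> TS q"
  shows "cderiv c F q (X c) = 0"
proof -
  obtain s W where s: "slice_chart M S s W" "q \<in> fst s" using slice_exists q by blast
  note sM = slice_chart_in[OF s(1)]
  have X': "X \<in> TM q" "X s \<in> W" using X tangent_subspace_eq[OF s(1) q s(2)] by auto
  obtain \<epsilon> where \<epsilon>: "\<epsilon> > 0" "\<And>t. \<bar>t\<bar> < \<epsilon> \<Longrightarrow> chart_inv s (snd s q + t *\<^sub>R X s) \<in> S \<inter> V"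
    using slice_line[OF s(1) q s(2) V X'(2), of thesis] by blast
  have ds: "cdiff s F q" by (rule cderiv_change(1)[OF c sM s(2) d])
  have "((\<lambda>t. (F \<circ> chart_inv s) (snd s q + t *\<^sub>R X s)) has_vector_derivative cderiv s F q (X s)) (at 0)"
    using has_vector_derivative_along_line[of "F \<circ> chart_inv s" "cderiv s F q" "snd s q" 0 "X s"]
      ds[unfolded frechet_derivative_works] by simp
  then have "cderiv s F q (X s) = 0"
    by (rule has_vector_derivative_const_near[OF _ \<epsilon>(1)]) (use \<epsilon>(2) F in auto)
  moreover have "cderiv s F q (X s) = cderiv c F q (X c)"
    using cderiv_change(2)[OF c sM s(2) d, of "X s"] tangent_spaceD[OF X'(1) sM s(2) c] by simp
  ultimately show ?thesis by simp
qed

lemma deriv_cong_on_S: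
  fixes F G :: "'m \<Rightarrow> real"
  assumes q: "q \<in> S" and V: "openin mtop V" "q \<in> V" and eq: "\<And>p. p \<in> V \<Longrightarrow> p \<in> S \<Longrightarrow> F p = G p"
    and c: "c \<in> M" "q \<in> fst c" and F: "cdiff c F q" and G: "cdiff c G q"
    and X: "X \<in> TS q"
  shows "cderiv c F q (X c) = cderiv c G q (X c)"
proof -
  have "((\<lambda>p. F p - G p) \<circ> chart_inv c has_derivative (\<lambda>v. cderiv c F q v - cderiv c G q v)) (at (snd c q))"
    using has_derivative_diff[OF F[unfolded frechet_derivative_works] G[unfolded frechet_derivative_works]]
    by (simp add: o_def)
  moreover from this have "cderiv c (\<lambda>p. F p - G p) q (X c) = 0"
    by (intro deriv_const_on_S[OF q V _ c _ X, where a = 0]) (auto simp: eq differentiable_def)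
  ultimately show ?thesis by (simp add: frechet_derivative_at[symmetric])
qed

lemma differential_on_TS:
  assumes q: "q \<in> S" and V: "openin mtop V" "q \<in> V" and F: "smooth_fun M V F"
    and "\<And>p. p \<in> V \<Longrightarrow> p \<in> S \<Longrightarrow> F p = a" and X: "X \<in> TS q"
  shows "dM F q X = 0"
proof -
  obtain c where c: "c \<in> M" "q \<in> fst c" using S_points[OF q] chart_exists by blast
  note d = smooth_fun_chart_diff[OF V(1) F V(2) c]
  show ?thesis
    using deriv_const_on_S[OF q V assms(5) c d X] differential_eq[OF c d, of X] X TS_subset by fastforce
qed

lemma bivector_S: "q \<in> S \<Longrightarrow> \<pi> q \<in> bivectors (CTM q) (TS q)"
  using poisson_submanifold by (simp add: poisson_submanifold_def)

text \<open>Together with \<open>deriv_cong_on_S\<close> this tangency makes brackets at points of S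
  depend on data along S only.\<close>

lemma sharp_in_TS: "q \<in> S \<Longrightarrow> \<alpha> \<in> CTM q \<Longrightarrow> sharp M \<pi> q \<alpha> \<in> TS q"
  by (rule sharp_exists(1)[OF S_points _ bivector_S subspace_TS TS_subset])

subsection \<open>The bracket on the submanifold\<close>

definition restrict_covec :: "'m \<Rightarrow> ('m, 'a) covec \<Rightarrow> ('m, 'a) covec"
  where "restrict_covec q \<alpha> = (\<lambda>X. if X \<in> TS q then \<alpha> X else 0)"

lemma restrict_covec_in:
  assumes "q \<in> S" "\<alpha> \<in> CTM q"
  shows "restrict_covec q \<alpha> \<in> dual_space (TS q)"
  unfolding dual_space_def restrict_covec_def
  using subspace_add[OF subspace_TS[OF assms(1)]] subspace_scale[OF subspace_TS[OF assms(1)]]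
    dual_space_additive[OF assms(2)] dual_space_scale[OF assms(2)] TS_subset
  by (simp add: subset_iff)

text \<open>Extend by projecting the coordinates of a tangent vector onto W before evaluating. That
  every covector on T_qS is a restriction gives uniqueness of the restricted tensor.\<close>

lemma restrict_covec_surj:
  assumes q: "q \<in> S" and \<gamma>: "\<gamma> \<in> dual_space (TS q)"
  obtains \<alpha> where "\<alpha> \<in> CTM q" "restrict_covec q \<alpha> = \<gamma>"
proof -
  obtain c W where c: "slice_chart M S c W" "q \<in> fst c" using slice_exists q by blast
  note cM = slice_chart_in[OF c(1)]
  obtain p where p: "bounded_linear p" "\<And>x. p x \<in> W" "\<And>x. x \<in> W \<Longrightarrow> p x = x"
    using orthogonal_projection[OF slice_subspace[OF c(1)]] by metis
  note lp = bounded_linear.linear[OF p(1)] and lc = linear_coord_vec[OF cM c(2)]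
  let ?r = "\<lambda>X. coord_vec M c (p (X c)) q"
  have r: "?r X \<in> TS q" for X
    using tangent_subspace_eq[OF c(1) q c(2)] coord_vec_in[OF cM c(2)] coord_vec_self[OF cM c(2)] p(2) by simp
  have add: "?r (X + Y) = ?r X + ?r Y" for X Y
    using linear_add[OF lp] linear_add[OF lc] by simp
  have scale: "?r (a *\<^sub>R X) = a *\<^sub>R ?r X" for a X
    using linear_scale[OF lp] linear_scale[OF lc] by (metis scaleR_fun_def)
  have rT: "?r X = X" if "X \<in> TS q" for X
    using that tangent_subspace_eq[OF c(1) q c(2)] p(3) coord_vec_of_tangent[OF _ cM c(2)] by simp
  define \<alpha> where "\<alpha> X = (if X \<in> TM q then \<gamma> (?r X) else 0)" for X
  have "\<alpha> \<in> CTM q"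
    unfolding dual_space_def
  proof (intro CollectI conjI ballI allI impI)
    fix X Y assume "X \<in> TM q" "Y \<in> TM q"
    then show "\<alpha> (X + Y) = \<alpha> X + \<alpha> Y"
      using subspace_add[OF subspace_TM] dual_space_additive[OF \<gamma> r r] by (simp only: \<alpha>_def add if_True)
  next
    fix a X assume "X \<in> TM q"
    then show "\<alpha> (a *\<^sub>R X) = a * \<alpha> X"
      using subspace_scale[OF subspace_TM] dual_space_scale[OF \<gamma> r] by (simp only: \<alpha>_def scale if_True)
  qed (simp add: \<alpha>_def)
  moreover have "restrict_covec q \<alpha> = \<gamma>"
    using TS_subset rT dual_space_outside[OF \<gamma>] by (fastforce simp: restrict_covec_def \<alpha>_def)
  ultimately show thesis using that by blast
qed

text \<open>Existence: the decomposables of \<pi> at q lie in T_qS and are read as a form on the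
  dual of T_qS. Uniqueness: all covectors of T_qS are restrictions, and both candidates are 0
  outside this dual.\<close>

lemma restricted_tensor_eq:
  assumes q: "q \<in> S" and \<alpha>: "\<alpha> \<in> CTM q" and \<beta>: "\<beta> \<in> CTM q"
  shows "restricted_tensor M \<pi> S q (restrict_covec q \<alpha>) (restrict_covec q \<beta>) = \<pi> q \<alpha> \<beta>"
proof -
  let ?D = "dual_space (TS q)"
  let ?P = "\<lambda>B. B \<in> bivectors ?D (TS q) \<and> (\<forall>\<alpha>\<in>CTM q. \<forall>\<beta>\<in>CTM q.
      B (restrict_covec q \<alpha>) (restrict_covec q \<beta>) = \<pi> q \<alpha> \<beta>)"
  obtain n :: nat and x y where xy: "\<forall>i<n. x i \<in> TS q \<and> y i \<in> TS q"
    and P: "\<pi> q = (\<lambda>\<alpha> \<beta>. if \<alpha> \<in> CTM q \<and> \<beta> \<in> CTM q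
      then \<Sum>i<n. \<alpha> (x i) * \<beta> (y i) - \<alpha> (y i) * \<beta> (x i) else 0)"
    using bivector_S[OF q] unfolding bivectors_def by blast
  define B where "B = (\<lambda>\<alpha> \<beta>. if \<alpha> \<in> ?D \<and> \<beta> \<in> ?D then \<Sum>i<n. \<alpha> (x i) * \<beta> (y i) - \<alpha> (y i) * \<beta> (x i) else 0)"
  have "B \<in> bivectors ?D (TS q)"
    unfolding bivectors_def B_def using xy by blast
  moreover have "B (restrict_covec q \<alpha>) (restrict_covec q \<beta>) = \<pi> q \<alpha> \<beta>"
    if "\<alpha> \<in> CTM q" "\<beta> \<in> CTM q" for \<alpha> \<beta>
    using that restrict_covec_in[OF q] xy by (simp add: B_def P) (simp add: restrict_covec_def)
  ultimately have ex: "?P B" by blast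
  have "B' = B" if B': "?P B'" for B'
  proof (intro ext)
    fix \<gamma> \<delta>
    show "B' \<gamma> \<delta> = B \<gamma> \<delta>"
    proof (cases "\<gamma> \<in> ?D \<and> \<delta> \<in> ?D")
      case True
      then obtain \<alpha> \<beta> where "\<alpha> \<in> CTM q" "restrict_covec q \<alpha> = \<gamma>"
        "\<beta> \<in> CTM q" "restrict_covec q \<beta> = \<delta>"
        using restrict_covec_surj[OF q] by metis
      then show ?thesis using ex B' by auto
    next
      case False
      have "B'' \<gamma> \<delta> = 0" if "B'' \<in> bivectors ?D (TS q)" for B''
        using that False unfolding bivectors_def by auto
      from this[of B] this[of B'] show ?thesis using ex B' by argo
    qed
  qed
  then have "(THE B. ?P B) = B" by (intro the_equality[of ?P, OF ex])
  then have "restricted_tensor M \<pi> S q = B"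
    unfolding restricted_tensor_def restrict_covec_def .
  then show ?thesis using ex \<alpha> \<beta> by blast
qed

text \<open>The definition picks some slice chart and differentiates within W. Near the point, f and
  F agree on W in coordinates, so the derivative of F is also one of f within W, and on W it is
  unique.\<close>

lemma sub_differential_eq:
  assumes q: "q \<in> S" and V: "openin mtop V" "q \<in> V" and F: "smooth_fun M V F"
    and f: "\<And>p. p \<in> V \<Longrightarrow> p \<in> S \<Longrightarrow> f p = F p"
  shows "sub_differential M S f q = restrict_covec q (dM F q)"
proof
  fix X
  obtain c W where cW: "(SOME (c, W). slice_chart M S c W \<and> q \<in> fst c) = (c, W)"
    by (rule prod.exhaust)
  obtain c' W' where "slice_chart M S c' W'" "q \<in> fst c'" using slice_exists[OF q] by blast
  then have "(\<lambda>(c, W). slice_chart M S c W \<and> q \<in> fst c) (SOME (c, W). slice_chart M S c W \<and> q \<in> fst c)"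
    by (intro someI[of "\<lambda>(c, W). slice_chart M S c W \<and> q \<in> fst c" "(c', W')"]) simp
  then have c: "slice_chart M S c W" "q \<in> fst c" unfolding cW by simp_all
  note cM = slice_chart_in[OF c(1)]
  let ?x = "snd c q"
  have xW: "?x \<in> W" using slice_mem[OF c(1) q c(2)] .
  note dF = smooth_fun_has_derivative[OF V(1) F V(2) cM c(2)]
  have "open (snd c ` (V \<inter> fst c))" "?x \<in> snd c ` (V \<inter> fst c)"
    using open_image V cM c(2) by auto
  then obtain \<epsilon> where \<epsilon>: "\<epsilon> > 0" "ball ?x \<epsilon> \<subseteq> snd c ` (V \<inter> fst c)" using open_contains_ball by blast
  have "(f \<circ> chart_inv c has_derivative cderiv c F q) (at ?x within W)"
  proof (rule has_derivative_transform_within[OF has_derivative_at_withinI[OF dF] \<epsilon>(1) xW])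
    fix y assume y: "y \<in> W" "dist y ?x < \<epsilon>"
    then have "y \<in> snd c ` (V \<inter> fst c)" using \<epsilon>(2) by (auto simp: dist_commute)
    moreover from this have "chart_inv c y \<in> S" using slice_inv_mem[OF c(1) _ y(1)] by blast
    moreover have "chart_inv c y \<in> V" using calculation(1) cM by auto
    ultimately show "(F \<circ> chart_inv c) y = (f \<circ> chart_inv c) y" using f[of "chart_inv c y"] by simp
  qed
  moreover from this have "(f \<circ> chart_inv c has_derivative frechet_derivative (f \<circ> chart_inv c) (at ?x within W)) (at ?x within W)"
    unfolding frechet_derivative_works[symmetric] by (rule differentiableI)
  ultimately have "frechet_derivative (f \<circ> chart_inv c) (at ?x within W) w = cderiv c F q w" if "w \<in> W" for w
    by (intro has_derivative_within_subspace_unique[OF _ _ slice_subspace[OF c(1)] xW that])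
  moreover have "sub_differential M S f q X =
      (if X \<in> TS q then frechet_derivative (f \<circ> chart_inv c) (at ?x within W) (X c) else 0)"
    unfolding sub_differential_def cW Let_def prod.case ..
  moreover have "X \<in> TS q \<Longrightarrow> X c \<in> W \<and> dM F q X = cderiv c F q (X c)"
    using tangent_subspace_eq[OF c(1) q c(2), of X]
      differential_eq[OF cM c(2) smooth_fun_chart_diff[OF V(1) F V(2) cM c(2)], of X] by blast
  ultimately show "sub_differential M S f q X = restrict_covec q (dM F q) X"
    unfolding restrict_covec_def by (cases "X \<in> TS q") simp_all
qed

lemma sub_bracket_eq:
  assumes q: "q \<in> S" and V: "openin mtop V" "q \<in> V" and F: "smooth_fun M V F" and G: "smooth_fun M V G"
    and "\<And>p. p \<in> V \<Longrightarrow> p \<in> S \<Longrightarrow> f p = F p" "\<And>p. p \<in> V \<Longrightarrow> p \<in> S \<Longrightarrow> g p = G p"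
  shows "sub_bracket M \<pi> S f g q = bracket F G q"
proof -
  have f: "sub_differential M S f q = restrict_covec q (dM F q)"
    by (rule sub_differential_eq[OF q V F]) (rule assms(6))
  have g: "sub_differential M S g q = restrict_covec q (dM G q)"
    by (rule sub_differential_eq[OF q V G]) (rule assms(7))
  show ?thesis
    unfolding sub_bracket_def poisson_bracket_def f g
      restricted_tensor_eq[OF q differential_smooth[OF V F] differential_smooth[OF V G]]
    using S_points[OF q] q by simp
qed

subsection \<open>The bracket of the restricted Lie algebroid\<close>

text \<open>The two derivative terms of \<open>form_bracket_coords\<close> are compared by
  \<open>deriv_cong_on_S\<close>; the remaining one involves values at q alone.\<close>

lemma form_bracket_cong_on_S:
  assumes q: "q \<in> S" and V: "openin mtop V" "q \<in> V"
    and \<alpha>: "\<alpha> \<in> Forms" "\<alpha>' \<in> Forms"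
    and \<beta>: "\<beta> \<in> Forms" "\<beta>' \<in> Forms"
    and eq: "\<And>p. p \<in> V \<Longrightarrow> p \<in> S \<Longrightarrow> \<alpha> p = \<alpha>' p" "\<And>p. p \<in> V \<Longrightarrow> p \<in> S \<Longrightarrow> \<beta> p = \<beta>' p"
  shows "form_bracket M \<pi> \<alpha> \<beta> q = form_bracket M \<pi> \<alpha>' \<beta>' q"
proof
  fix X
  show "form_bracket M \<pi> \<alpha> \<beta> q X = form_bracket M \<pi> \<alpha>' \<beta>' q X"
  proof (cases "X \<in> TM q")
    case True
    note qM = S_points[OF q]
    define c where "c = chart_at M q"
    have c: "c \<in> M" "q \<in> fst c" using chart_exists[OF qM] chart_at c_def by metis+
    have d: "cdiff c (\<lambda>p. \<gamma> p (coord_vec M c v p)) q"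
      if "\<gamma> \<in> Forms" for \<gamma> v
      by (rule smooth_on_differentiable[OF open_chart[OF c(1)] covector_fieldD(2)[OF that c(1)]]) (use c in simp)
    have q_eq: "\<alpha> q = \<alpha>' q" "\<beta> q = \<beta>' q" using eq V q by auto
    have sh: "sharp M \<pi> q (\<alpha>' q) \<in> TS q" "sharp M \<pi> q (\<beta>' q) \<in> TS q"
      by (intro sharp_in_TS[OF q] covector_fieldD(1)[OF \<alpha>(2) qM] covector_fieldD(1)[OF \<beta>(2) qM])+
    have 1: "cderiv c (\<lambda>p. \<beta> p (coord_vec M c v p)) q (sharp M \<pi> q (\<alpha>' q) c) =
        cderiv c (\<lambda>p. \<beta>' p (coord_vec M c v p)) q (sharp M \<pi> q (\<alpha>' q) c)" for v
      by (rule deriv_cong_on_S[OF q V _ c d[OF \<beta>(1)] d[OF \<beta>(2)] sh(1)]) (simp add: eq)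
    have 2: "cderiv c (\<lambda>p. \<alpha> p (coord_vec M c v p)) q (sharp M \<pi> q (\<beta>' q) c) =
        cderiv c (\<lambda>p. \<alpha>' p (coord_vec M c v p)) q (sharp M \<pi> q (\<beta>' q) c)" for v
      by (rule deriv_cong_on_S[OF q V _ c d[OF \<alpha>(1)] d[OF \<alpha>(2)] sh(2)]) (simp add: eq)
    show ?thesis
      unfolding form_bracket_coords[OF \<alpha>(1) \<beta>(1) qM True c_def] form_bracket_coords[OF \<alpha>(2) \<beta>(2) qM True c_def] q_eq 1 2 ..
  qed (simp add: form_bracket_def)
qed

lemma AS_bracket_eq:
  assumes q: "q \<in> S" and V: "openin mtop V" "q \<in> V"
    and \<alpha>: "\<alpha> \<in> Forms" and \<beta>: "\<beta> \<in> Forms"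
    and eq: "\<And>p. p \<in> V \<Longrightarrow> p \<in> S \<Longrightarrow> \<alpha> p = a p" "\<And>p. p \<in> V \<Longrightarrow> p \<in> S \<Longrightarrow> \<beta> p = b p"
  shows "AS_bracket M \<pi> S a b q = form_bracket M \<pi> \<alpha> \<beta> q"
proof -
  let ?P = "\<lambda>\<omega>. \<exists>\<alpha>\<in>Forms. \<exists>\<beta>\<in>Forms.
      \<exists>W. openin mtop W \<and> q \<in> W \<and> (\<forall>p\<in>W \<inter> S. \<alpha> p = a p \<and> \<beta> p = b p) \<and> \<omega> = form_bracket M \<pi> \<alpha> \<beta> q"
  have "(THE \<omega>. ?P \<omega>) = form_bracket M \<pi> \<alpha> \<beta> q"
  proof (rule the_equality)
    show "?P (form_bracket M \<pi> \<alpha> \<beta> q)"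
      using \<alpha> \<beta> V eq by (intro bexI[of _ \<alpha>] bexI[of _ \<beta>] exI[of _ V]) auto
  next
    fix \<omega> assume "?P \<omega>"
    then obtain \<alpha>' \<beta>' W where *: "\<alpha>' \<in> Forms" "\<beta>' \<in> Forms"
      "openin mtop W" "q \<in> W" "\<forall>p\<in>W \<inter> S. \<alpha>' p = a p \<and> \<beta>' p = b p" "\<omega> = form_bracket M \<pi> \<alpha>' \<beta>' q" by blast
    show "\<omega> = form_bracket M \<pi> \<alpha> \<beta> q"
      unfolding *(6) by (rule form_bracket_cong_on_S[OF q, of "V \<inter> W"]) (use * V \<alpha> \<beta> eq in auto)
  qed
  then show ?thesis using q by (simp add: AS_bracket_def)
qed

text \<open>Since the differential of \<open>{F, H}\<close> is the bracket of the 1-forms \<open>dF\<close> and \<open>dH\<close>, this is the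
  independence of \<^const>\<open>AS_bracket\<close> of the chosen extensions.\<close>

lemma bracket_second_order:
  assumes q: "q \<in> S" and V: "openin mtop V" "q \<in> V" and F: "smooth_fun M V F" and H: "smooth_fun M V H"
    and dF: "\<And>p. p \<in> V \<Longrightarrow> p \<in> S \<Longrightarrow> dM F p = 0"
  shows "bracket F H q = 0" "dM (bracket F H) q = 0"
proof -
  have bracket_zero: "bracket (\<lambda>p. 0) G p = 0" if "smooth_fun M U G" "openin mtop U" "p \<in> U" for U G p
    using bracket_const_mult[OF that(2,3) smooth_fun_const that(1), of 0 0] by simp
  have qM: "q \<in> points M" using S_points[OF q] .
  show "bracket F H q = 0"
    using tensor_scale_left[OF qM differential_smooth[OF V F] differential_smooth[OF V H], of 0] dF[OF V(2) q]
    by (simp add: poisson_bracket_def)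
  obtain F' A where F': "F' \<in> Cinf" "openin mtop A" "q \<in> A" "A \<subseteq> V" "\<And>p. p \<in> A \<Longrightarrow> F' p = F p"
    using smooth_extension[OF V F] by metis
  obtain H' B where H': "H' \<in> Cinf" "openin mtop B" "q \<in> B" "\<And>p. p \<in> B \<Longrightarrow> H' p = H p"
    using smooth_extension[OF V H] by metis
  have Z: "(\<lambda>p. 0) \<in> Cinf" by (simp add: smooth_functions_def smooth_fun_const)
  have W: "openin mtop (A \<inter> B)" "q \<in> A \<inter> B" using F' H' by auto
  \<comment> \<open>By the hypothesis on dF, the form dF' agrees along S with the exact form of the
    zero function. So d{F', H'} at q equals d{0, H'} = 0.\<close>
  have "form_bracket M \<pi> (exact_form F') (exact_form H') q = form_bracket M \<pi> (exact_form (\<lambda>p. 0)) (exact_form H') q"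
  proof (rule form_bracket_cong_on_S[OF q W])
    fix p assume p: "p \<in> A \<inter> B" "p \<in> S"
    then have "dM F' p = dM F p"
      using differential_cong[of A p F' F] F'(2,5) by blast
    then show "exact_form F' p = exact_form (\<lambda>p. 0) p"
      using p F'(4) dF differential_const[OF S_points] by (auto simp: exact_form_def)
  qed (auto intro!: exact_form_covector_field F' H' Z)
  then have "dM (bracket F' H') q = dM (bracket (\<lambda>p. 0) H') q"
    unfolding form_bracket_exact[OF F'(1) H'(1) qM] form_bracket_exact[OF Z H'(1) qM] .
  also have "\<dots> = dM (\<lambda>p. 0) q"
    by (rule differential_cong[OF openin_points qM])
      (use bracket_zero[OF _ openin_points] H'(1) in \<open>auto simp: smooth_functions_def\<close>)
  also have "\<dots> = 0" by (rule differential_const[OF qM])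
  finally show "dM (bracket F H) q = 0"
    using differential_cong[OF W, of "bracket F H" "bracket F' H'"] bracket_cong[OF W(1), of _ F F' H H'] F'(5) H'(4)
    by auto
qed

subsection \<open>Conormal covectors\<close>

lemma mem_normal_class: "Y \<in> cls q X \<longleftrightarrow> Y - X \<in> TS q"
  unfolding normal_class_def by (metis (no_types, lifting) add_diff_cancel_left' add_diff_eq diff_add_cancel image_iff)

lemma normal_class_eq_iff:
  assumes "q \<in> S"
  shows "cls q X = cls q Y \<longleftrightarrow> X - Y \<in> TS q"
proof
  assume "cls q X = cls q Y"
  moreover have "X \<in> cls q X" using subspace_0[OF subspace_TS[OF assms]] by (simp add: mem_normal_class)
  ultimately show "X - Y \<in> TS q" by (simp add: mem_normal_class)
next
  assume XY: "X - Y \<in> TS q"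
  have "Z - X \<in> TS q \<longleftrightarrow> Z - Y \<in> TS q" for Z
    using subspace_add[OF subspace_TS[OF assms], of "Z - X" "X - Y"]
      subspace_diff[OF subspace_TS[OF assms], of "Z - Y" "X - Y"] XY by auto
  then show "cls q X = cls q Y" by (auto simp: mem_normal_class)
qed

lemma normal_class_subset: "q \<in> S \<Longrightarrow> X \<in> TM q \<Longrightarrow> Y \<in> cls q X \<Longrightarrow> Y \<in> TM q"
  using subspace_add[OF subspace_TM, of X q "Y - X"] TS_subset by (auto simp: mem_normal_class)

text \<open>Inverse of \<open>nu_dual\<close> on covectors that annihilate T_qS; for those the
  chosen representative is immaterial.\<close>

definition descend :: "'m \<Rightarrow> ('m, 'a) covec \<Rightarrow> ('m, 'a) tvec set \<Rightarrow> real"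
  where "descend q \<gamma> z = (if z \<in> normal_space M S q then \<gamma> (SOME X. X \<in> z) else 0)"

context
  fixes q \<gamma>
  assumes q: "q \<in> S" and \<gamma>: "\<gamma> \<in> CTM q" "\<And>X. X \<in> TS q \<Longrightarrow> \<gamma> X = 0"
begin

lemma descend_class:
  assumes X: "X \<in> TM q"
  shows "descend q \<gamma> (cls q X) = \<gamma> X"
proof -
  let ?z = "cls q X"
  have "X \<in> ?z" using subspace_0[OF subspace_TS[OF q]] by (simp add: mem_normal_class)
  then have Y: "(SOME Y. Y \<in> ?z) \<in> ?z" by (rule someI[of "\<lambda>Y. Y \<in> ?z"])
  then have "\<gamma> ((SOME Y. Y \<in> ?z) - X) = 0" using \<gamma>(2) by (simp add: mem_normal_class)
  then have "\<gamma> (SOME Y. Y \<in> ?z) = \<gamma> X"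
    using dual_space_minus[OF \<gamma>(1) subspace_TM normal_class_subset[OF q X Y] X] by simp
  moreover have "?z \<in> normal_space M S q" using X by (simp add: normal_space_def)
  ultimately show ?thesis by (simp add: descend_def)
qed

lemma descend_in: "descend q \<gamma> \<in> Conormal q"
  unfolding conormal_space_def
  using subspace_add[OF subspace_TM] subspace_scale[OF subspace_TM]
  by (simp add: descend_class dual_space_additive[OF \<gamma>(1)] dual_space_scale[OF \<gamma>(1)]) (simp add: descend_def)

lemma nu_dual_descend: "nu q (descend q \<gamma>) = \<gamma>"
  using dual_space_outside[OF \<gamma>(1)] by (auto simp: nu_dual_def descend_class)

end

lemma conormal_eqI:
  assumes "\<xi> \<in> Conormal q" "\<xi>' \<in> Conormal q"
    and "\<And>X. X \<in> TM q \<Longrightarrow> \<xi> (cls q X) = \<xi>' (cls q X)"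
  shows "\<xi> = \<xi>'"
proof
  fix z
  show "\<xi> z = \<xi>' z"
  proof (cases "z \<in> normal_space M S q")
    case True
    then show ?thesis using assms(3) by (auto simp: normal_space_def)
  next
    case False
    then show ?thesis using assms(1,2) by (simp add: conormal_space_def)
  qed
qed

lemma nu_dual_inj:
  assumes "\<xi> \<in> Conormal q" "\<xi>' \<in> Conormal q" "nu q \<xi> = nu q \<xi>'"
  shows "\<xi> = \<xi>'"
proof (rule conormal_eqI[OF assms(1,2)])
  fix X assume "X \<in> TM q"
  then show "\<xi> (cls q X) = \<xi>' (cls q X)"
    using fun_cong[OF assms(3), of X] by (simp add: nu_dual_def)
qed

text \<open>Reduces the nested descriptions of the conormal bracket to one differential: if dF and
  dG represent the two sections along S, then d{F, G}, being the bracket of exact forms, represents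
  their bracket.\<close>

lemma conormal_bracket_eq:
  assumes q: "q \<in> S" and V: "openin mtop V" "q \<in> V" and F: "smooth_fun M V F" and G: "smooth_fun M V G"
    and dF: "\<And>p. p \<in> V \<Longrightarrow> p \<in> S \<Longrightarrow> dM F p = nu p (\<eta>1 p)"
    and dG: "\<And>p. p \<in> V \<Longrightarrow> p \<in> S \<Longrightarrow> dM G p = nu p (\<eta>2 p)"
    and \<xi>: "\<xi> \<in> Conormal q" "nu q \<xi> = dM (bracket F G) q"
  shows "conormal_bracket M \<pi> S \<eta>1 \<eta>2 q = \<xi>"
proof -
  obtain F' A where F': "F' \<in> Cinf" "openin mtop A" "q \<in> A" "A \<subseteq> V" "\<And>p. p \<in> A \<Longrightarrow> F' p = F p"
    using smooth_extension[OF V F] by metis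
  obtain G' B where G': "G' \<in> Cinf" "openin mtop B" "q \<in> B" "B \<subseteq> V" "\<And>p. p \<in> B \<Longrightarrow> G' p = G p"
    using smooth_extension[OF V G] by metis
  have W: "openin mtop (A \<inter> B)" "q \<in> A \<inter> B" using F' G' by auto
  let ?a = "\<lambda>\<eta> p. if p \<in> S then nu p (\<eta> p) else 0"
  have "AS_bracket M \<pi> S (?a \<eta>1) (?a \<eta>2) q = form_bracket M \<pi> (exact_form F') (exact_form G') q"
  proof (rule AS_bracket_eq[OF q W exact_form_covector_field[OF F'(1)] exact_form_covector_field[OF G'(1)]])
    fix p assume p: "p \<in> A \<inter> B" "p \<in> S"
    have "dM F' p = dM F p" "dM G' p = dM G p"
      using p differential_cong[of A p F' F] differential_cong[of B p G' G] F'(2,5) G'(2,5) by blast+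
    then show "exact_form F' p = ?a \<eta>1 p" "exact_form G' p = ?a \<eta>2 p"
      using p F'(4) dF dG S_points by (auto simp: exact_form_def)
  qed
  also have "\<dots> = dM (bracket F' G') q"
    by (rule form_bracket_exact[OF F'(1) G'(1) S_points[OF q]])
  also have "\<dots> = dM (bracket F G) q"
    using differential_cong[OF W, of "bracket F G" "bracket F' G'"] bracket_cong[OF W(1), of _ F F' G G'] F'(5) G'(5)
    by auto
  finally have "AS_bracket M \<pi> S (?a \<eta>1) (?a \<eta>2) q = nu q \<xi>" using \<xi>(2) by simp
  then show ?thesis
    using q \<xi>(1) nu_dual_inj[of _ q \<xi>] by (auto simp: conormal_bracket_def intro!: the_equality)
qed

end

section \<open>The normal bundle\<close>

text \<open>A fixed choice, so that coordinates on the normal bundle become expressions in W alone;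
  for a subspace W the listed properties characterise the orthogonal projection.\<close>

definition orth_proj :: "'a::euclidean_space set \<Rightarrow> 'a \<Rightarrow> 'a"
  where "orth_proj W = (SOME p. bounded_linear p \<and> (\<forall>x. p x \<in> W) \<and> (\<forall>x\<in>W. p x = x) \<and>
    (\<forall>x. x - p x \<in> orthogonal_comp W) \<and> (\<forall>x\<in>orthogonal_comp W. p x = 0))"

lemma orth_proj:
  assumes "subspace W"
  shows "bounded_linear (orth_proj W)" "orth_proj W x \<in> W" "x \<in> W \<Longrightarrow> orth_proj W x = x"
    "x - orth_proj W x \<in> orthogonal_comp W" "x \<in> orthogonal_comp W \<Longrightarrow> orth_proj W x = 0"
proof -
  let ?P = "\<lambda>p. bounded_linear p \<and> (\<forall>x. p x \<in> W) \<and> (\<forall>x\<in>W. p x = x) \<and>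
    (\<forall>x. x - p x \<in> orthogonal_comp W) \<and> (\<forall>x\<in>orthogonal_comp W. p x = 0)"
  obtain p where "?P p" using orthogonal_projection[OF assms] by metis
  then have "?P (orth_proj W)" unfolding orth_proj_def by (rule someI[of ?P])
  then show "bounded_linear (orth_proj W)" "orth_proj W x \<in> W" "x \<in> W \<Longrightarrow> orth_proj W x = x"
    "x - orth_proj W x \<in> orthogonal_comp W" "x \<in> orthogonal_comp W \<Longrightarrow> orth_proj W x = 0"
    by blast+
qed

context poisson_sub
begin

abbreviation "N \<equiv> normal_bundle M S"
abbreviation "NA \<equiv> normal_atlas M S"
abbreviation "Aff \<equiv> affine_functions M S"

section \<open>Charts of the normal bundle\<close>

lemma normal_bundleE:
  assumes "z \<in> N"
  obtains q X where "z = (q, cls q X)" "q \<in> S" "X \<in> TM q"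
  using assms unfolding normal_bundle_def normal_space_def by auto

lemma normal_bundleI: "q \<in> S \<Longrightarrow> X \<in> TM q \<Longrightarrow> (q, cls q X) \<in> N"
  by (simp add: normal_bundle_def normal_space_def)

text \<open>In coordinates the coset of X is \<open>X c\<close> + W, which meets the orthogonal
  complement of W exactly in the orthogonal component of \<open>X c\<close>.\<close>

lemma normal_chart_value:
  assumes c: "slice_chart M S c W" and q: "q \<in> S" "q \<in> fst c" and X: "X \<in> TM q"
  shows "snd (normal_chart S M c W) (q, cls q X) = snd c q + (X c - orth_proj W (X c))"
proof -
  note cM = slice_chart_in[OF c] and W = slice_subspace[OF c]
  note p = orth_proj[OF W]
  let ?v = "X c - orth_proj W (X c)"
  have "(THE v. v \<in> orthogonal_comp W \<and> v \<in> (\<lambda>X. X c) ` cls q X) = ?v"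
  proof (rule the_equality)
    let ?Y = "X - coord_vec M c (orth_proj W (X c)) q"
    have "coord_vec M c (orth_proj W (X c)) q \<in> TS q"
      by (simp add: tangent_subspace_eq[OF c q] coord_vec_in[OF cM q(2)] coord_vec_self[OF cM q(2)] p(2))
    then have "?Y - X \<in> TS q" using subspace_neg[OF subspace_TS[OF q(1)]] by simp
    then have "?Y \<in> cls q X" by (simp add: mem_normal_class)
    moreover have "?Y c = ?v" by (simp add: coord_vec_self[OF cM q(2)])
    ultimately show "?v \<in> orthogonal_comp W \<and> ?v \<in> (\<lambda>X. X c) ` cls q X"
      using p(4) by (metis image_eqI)
  next
    fix v assume v: "v \<in> orthogonal_comp W \<and> v \<in> (\<lambda>X. X c) ` cls q X"
    then obtain Y where Y: "Y \<in> cls q X" "v = Y c" by blast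
    then have "(Y - X) c \<in> W" using tangent_subspace_eq[OF c q] mem_normal_class by blast
    then have w: "v - X c \<in> W" using Y(2) by simp
    then have "orth_proj W (v - X c) = v - X c" by (rule p(3))
    moreover have "orth_proj W (v - X c) = orth_proj W v - orth_proj W (X c)"
      by (rule linear_diff[OF bounded_linear.linear[OF p(1)]])
    moreover have "orth_proj W v = 0" using v p(5) by blast
    ultimately show "v = ?v" by (simp add: algebra_simps)
  qed
  then show ?thesis by (simp add: normal_chart_def)
qed

text \<open>The component of y in W is the coordinate of the base point in S, the orthogonal
  component represents the vector in the fibre.\<close>

definition normal_chart_inv :: "('m, 'a) chart \<Rightarrow> 'a set \<Rightarrow> 'a \<Rightarrow> 'm \<times> ('m, 'a) tvec set"
  where "normal_chart_inv c W y = (let q = chart_inv c (orth_proj W y) in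
    (q, cls q (coord_vec M c (y - orth_proj W y) q)))"

context
  fixes c W
  assumes c: "slice_chart M S c W"
begin

private lemma cM: "c \<in> M" using slice_chart_in[OF c] .
private lemmas W = slice_subspace[OF c]
private lemmas p = orth_proj[OF W]

abbreviation "nc \<equiv> normal_chart S M c W"

lemma fst_normal_chart: "fst nc = {z \<in> N. fst z \<in> fst c}"
  by (simp add: normal_chart_def)

lemma chart_inv_orth_proj:
  assumes "orth_proj W y \<in> snd c ` fst c"
  shows "chart_inv c (orth_proj W y) \<in> S" "chart_inv c (orth_proj W y) \<in> fst c"
    "snd c (chart_inv c (orth_proj W y)) = orth_proj W y"
  using slice_inv_mem[OF c assms p(2)] chart_inv_right[OF assms] by auto

lemma normal_chart_inv_right:
  assumes y: "orth_proj W y \<in> snd c ` fst c"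
  shows "normal_chart_inv c W y \<in> fst nc"
    "snd nc (normal_chart_inv c W y) = y"
proof -
  let ?q = "chart_inv c (orth_proj W y)"
  note q = chart_inv_orth_proj[OF y]
  have T: "coord_vec M c (y - orth_proj W y) ?q \<in> TM ?q"
    by (rule coord_vec_in[OF cM q(2)])
  show "normal_chart_inv c W y \<in> fst nc"
    using normal_bundleI[OF q(1) T] q(2) by (simp add: normal_chart_inv_def Let_def fst_normal_chart)
  show "snd nc (normal_chart_inv c W y) = y"
    using normal_chart_value[OF c q(1,2) T] coord_vec_self[OF cM q(2)] q(3) p(5)[OF p(4)]
    by (simp add: normal_chart_inv_def Let_def)
qed

lemma normal_chart_inv_left:
  assumes z: "z \<in> fst nc"
  shows "orth_proj W (snd nc z) = snd c (fst z)"
    "normal_chart_inv c W (snd nc z) = z"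
proof -
  have zN: "z \<in> N" "fst z \<in> fst c" using z by (auto simp: fst_normal_chart)
  from zN(1) obtain q X where qX: "z = (q, cls q X)" "q \<in> S" "X \<in> TM q" by (rule normal_bundleE)
  have q: "q \<in> fst c" using zN(2) qX(1) by simp
  note v = normal_chart_value[OF c qX(2) q qX(3)]
  note l = bounded_linear.linear[OF p(1)]
  have 1: "orth_proj W (snd nc z) = snd c q"
    unfolding qX(1) v using linear_add[OF l] p(3)[OF slice_mem[OF c qX(2) q]] p(5)[OF p(4)] by simp
  show "orth_proj W (snd nc z) = snd c (fst z)" using 1 qX(1) by simp
  let ?Y = "coord_vec M c (X c - orth_proj W (X c)) q"
  have T: "?Y - X \<in> TM q"
    by (intro subspace_diff subspace_TM coord_vec_in cM q qX(3))
  have "(?Y - X) c = - orth_proj W (X c)" by (simp add: coord_vec_self[OF cM q])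
  then have "?Y - X \<in> TS q"
    using T p(2) subspace_neg[OF W] by (simp add: tangent_subspace_eq[OF c qX(2) q])
  then have "cls q ?Y = cls q X" by (simp add: normal_class_eq_iff[OF qX(2)])
  moreover have "snd nc z - snd c q = X c - orth_proj W (X c)"
    unfolding qX(1) v by simp
  ultimately show "normal_chart_inv c W (snd nc z) = z"
    unfolding normal_chart_inv_def Let_def 1 chart_inv_chart[OF cM q] using qX(1) by simp
qed

lemma inj_normal_chart: "inj_on (snd nc) (fst nc)"
  by (rule inj_on_inverseI[where g = "normal_chart_inv c W"]) (rule normal_chart_inv_left(2))

text \<open>A fibre fills the whole orthogonal complement, so the image is a cylinder over the image
  of the base. Openness of chart domains and overlaps then follows from continuity of the
  projection.\<close>

lemma normal_chart_image:
  assumes "A \<subseteq> fst c"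
  shows "snd nc ` {z \<in> N. fst z \<in> A} = {y. orth_proj W y \<in> snd c ` A}"
proof (intro set_eqI iffI)
  fix y assume "y \<in> snd nc ` {z \<in> N. fst z \<in> A}"
  then obtain z where z: "z \<in> N" "fst z \<in> A" "y = snd nc z" by auto
  then have "z \<in> fst nc" using assms by (auto simp: fst_normal_chart)
  then show "y \<in> {y. orth_proj W y \<in> snd c ` A}" using normal_chart_inv_left(1) z by simp
next
  fix y assume y: "y \<in> {y. orth_proj W y \<in> snd c ` A}"
  then have y': "orth_proj W y \<in> snd c ` fst c" using assms by auto
  have "chart_inv c (orth_proj W y) \<in> A" using y assms cM by (auto simp: subset_iff)
  then have "fst (normal_chart_inv c W y) \<in> A" by (simp add: normal_chart_inv_def Let_def)
  then show "y \<in> snd nc ` {z \<in> N. fst z \<in> A}"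
    using normal_chart_inv_right[OF y'] fst_normal_chart by (intro image_eqI[of _ _ "normal_chart_inv c W y"]) auto
qed

lemma normal_chart_range: "snd nc ` fst nc = {y. orth_proj W y \<in> snd c ` fst c}"
  unfolding fst_normal_chart by (rule normal_chart_image) simp

lemma open_normal_chart_image:
  assumes "A \<subseteq> fst c" "open (snd c ` A)"
  shows "open (snd nc ` {z \<in> N. fst z \<in> A})"
proof -
  have "open (orth_proj W -` (snd c ` A))"
    by (rule continuous_open_vimage[OF assms(2)]) (simp add: linear_continuous_at[OF p(1)])
  then show ?thesis unfolding normal_chart_image[OF assms(1)] vimage_def .
qed

end

lemma normal_atlasE:
  assumes "\<nu> \<in> NA"
  obtains c W where "slice_chart M S c W" "\<nu> = normal_chart S M c W"
  using assms by (auto simp: normal_atlas_def)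

lemma inj_normal_atlas: "\<nu> \<in> NA \<Longrightarrow> inj_on (snd \<nu>) (fst \<nu>)"
  by (erule normal_atlasE) (simp add: inj_normal_chart)

lemma chart_inv_normal [simp]: "\<nu> \<in> NA \<Longrightarrow> z \<in> fst \<nu> \<Longrightarrow> chart_inv \<nu> (snd \<nu> z) = z"
  by (simp add: chart_inv_left inj_normal_atlas)

lemma normal_atlas_subset: "\<nu> \<in> NA \<Longrightarrow> fst \<nu> \<subseteq> N"
  by (erule normal_atlasE) (auto simp: fst_normal_chart)

lemma open_normal_atlas:
  assumes "\<nu> \<in> NA"
  shows "open (snd \<nu> ` fst \<nu>)"
proof -
  obtain c W where c: "slice_chart M S c W" "\<nu> = normal_chart S M c W"
    using assms by (rule normal_atlasE)
  show ?thesis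
    using open_normal_chart_image[OF c(1) subset_refl open_chart[OF slice_chart_in[OF c(1)]]]
    by (simp add: c(2) fst_normal_chart[OF c(1)])
qed

lemma normal_chart_exists:
  assumes "z \<in> N"
  obtains \<nu> where "\<nu> \<in> NA" "z \<in> fst \<nu>"
proof -
  have "fst z \<in> S" using assms by (auto simp: normal_bundle_def)
  then obtain c W where c: "slice_chart M S c W" "fst z \<in> fst c" using slice_exists by blast
  have "normal_chart S M c W \<in> NA" using c(1) unfolding normal_atlas_def by blast
  then show thesis using that assms c fst_normal_chart[OF c(1)] by blast
qed

lemma points_normal_atlas: "points NA = N"
proof
  show "points NA \<subseteq> N" using normal_atlas_subset by (auto simp: points_def)
  show "N \<subseteq> points NA"
  proof
    fix z assume "z \<in> N"
    then obtain \<nu> where "\<nu> \<in> NA" "z \<in> fst \<nu>" by (rule normal_chart_exists)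
    then show "z \<in> points NA" unfolding points_def by blast
  qed
qed

lemma openin_normal_atlas:
  "openin (atlas_topology NA) V \<longleftrightarrow> V \<subseteq> N \<and> (\<forall>\<nu>\<in>NA. open (snd \<nu> ` (V \<inter> fst \<nu>)))"
  using openin_atlas_topology[of NA, OF inj_normal_atlas] by (simp add: points_normal_atlas)

lemma openin_normal_chart:
  assumes "\<nu> \<in> NA"
  shows "openin (atlas_topology NA) (fst \<nu>)"
proof -
  obtain c W where c: "slice_chart M S c W" "\<nu> = normal_chart S M c W"
    using assms by (rule normal_atlasE)
  have "open (snd \<nu>' ` (fst \<nu> \<inter> fst \<nu>'))" if \<nu>': "\<nu>' \<in> NA" for \<nu>'
  proof -
    obtain d W' where d: "slice_chart M S d W'" "\<nu>' = normal_chart S M d W'"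
      using \<nu>' by (rule normal_atlasE)
    have "fst \<nu> \<inter> fst \<nu>' = {z \<in> N. fst z \<in> fst d \<inter> fst c}"
      using c d by (auto simp: fst_normal_chart)
    then show ?thesis
      using open_normal_chart_image[OF d(1), of "fst d \<inter> fst c"]
        open_transition[OF slice_chart_in[OF d(1)] slice_chart_in[OF c(1)]] d(2) by simp
  qed
  then show ?thesis using normal_atlas_subset[OF assms] by (simp add: openin_normal_atlas)
qed

lemma zero_section_in: "q \<in> S \<Longrightarrow> zero_section M S q \<in> N"
  unfolding zero_section_def by (rule normal_bundleI[OF _ subspace_0[OF subspace_TM]])

lemma chart_at_zero_section:
  assumes "q \<in> S"
  shows "chart_at NA (zero_section M S q) \<in> NA" "zero_section M S q \<in> fst (chart_at NA (zero_section M S q))"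
proof -
  let ?o = "zero_section M S q"
  obtain \<nu> where "\<nu> \<in> NA" "?o \<in> fst \<nu>" using zero_section_in[OF assms] by (rule normal_chart_exists)
  then show "chart_at NA ?o \<in> NA" "?o \<in> fst (chart_at NA ?o)"
    using someI[of "\<lambda>c. c \<in> NA \<and> ?o \<in> fst c" \<nu>] by (auto simp: chart_at_def)
qed

lemma normal_scale_class:
  assumes q: "q \<in> S"
  shows "normal_scale M S q t (cls q X) = cls q (t *\<^sub>R X)"
proof -
  have "cls q (t *\<^sub>R Y) = cls q (t *\<^sub>R X)" if "Y \<in> cls q X" for Y
    using that subspace_scale[OF subspace_TS[OF q], of "Y - X" t]
    by (simp add: mem_normal_class normal_class_eq_iff[OF q] scaleR_diff_right)
  moreover have "X \<in> cls q X" using subspace_0[OF subspace_TS[OF q]] by (simp add: mem_normal_class)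
  ultimately show ?thesis unfolding normal_scale_def by blast
qed

subsection \<open>Affine functions in normal charts\<close>

lemma affine_functionsD:
  assumes "\<phi> \<in> Aff"
  shows "smooth_fun M S (fst \<phi>)" "q \<notin> S \<Longrightarrow> fst \<phi> q = 0"
    "q \<in> S \<Longrightarrow> snd \<phi> q \<in> Conormal q" "q \<notin> S \<Longrightarrow> snd \<phi> q = 0"
    "c \<in> M \<Longrightarrow> smooth_on (snd c ` (S \<inter> fst c)) ((\<lambda>q. snd \<phi> q (cls q (coord_vec M c v q))) \<circ> chart_inv c)"
  using assms unfolding affine_functions_def smooth_functions_def conormal_sections_def
  by (simp_all add: mem_Times_iff)

lemma conormalD:
  assumes "\<xi> \<in> Conormal q"
  shows "X \<in> TM q \<Longrightarrow> Y \<in> TM q \<Longrightarrow> \<xi> (cls q (X + Y)) = \<xi> (cls q X) + \<xi> (cls q Y)"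
    "X \<in> TM q \<Longrightarrow> \<xi> (cls q (r *\<^sub>R X)) = r * \<xi> (cls q X)"
    "\<xi> (cls q 0) = 0"
proof -
  show add: "X \<in> TM q \<Longrightarrow> Y \<in> TM q \<Longrightarrow> \<xi> (cls q (X + Y)) = \<xi> (cls q X) + \<xi> (cls q Y)"
    and scale: "X \<in> TM q \<Longrightarrow> \<xi> (cls q (r *\<^sub>R X)) = r * \<xi> (cls q X)" for X Y r
    using assms unfolding conormal_space_def by blast+
  show "\<xi> (cls q 0) = 0" using scale[OF subspace_0[OF subspace_TM], of 0] by simp
qed

lemma conormal_coords:
  assumes \<xi>: "\<xi> \<in> Conormal q" and c: "c \<in> M" "q \<in> fst c"
  shows "\<xi> (cls q (coord_vec M c v q)) = (\<Sum>b\<in>Basis. (v \<bullet> b) * \<xi> (cls q (coord_vec M c b q)))"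
proof -
  have "linear (\<lambda>v. \<xi> (cls q (coord_vec M c v q)))"
    by (intro linearI) (simp_all add: linear_add[OF linear_coord_vec[OF c]] linear_scale[OF linear_coord_vec[OF c]]
        conormalD[OF \<xi>] coord_vec_in[OF c])
  from linear_basis_expansion[OF this, of v] show ?thesis by simp
qed

text \<open>With p the projection onto W, the function reads f(p y) + sum_b ((y - p y) \<bullet> b)
  \<eta>_b(p y) in a normal chart, where \<eta>_b are the coefficients of the section. Since p is
  linear and maps into the image of S, smoothness of f and \<eta>_b along S is enough.\<close>

lemma affine_fun_smooth:
  assumes \<phi>: "\<phi> \<in> Aff" and \<nu>: "\<nu> \<in> NA"
  shows "smooth_on (snd \<nu> ` fst \<nu>) (affine_fun \<phi> \<circ> chart_inv \<nu>)"
proof -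
  obtain c W where c: "slice_chart M S c W" and \<nu>': "\<nu> = normal_chart S M c W"
    using \<nu> by (rule normal_atlasE)
  note cM = slice_chart_in[OF c] and p = orth_proj[OF slice_subspace[OF c]]
  let ?p = "orth_proj W" and ?T = "{y. orth_proj W y \<in> snd c ` fst c}"
  let ?g = "\<lambda>b. (\<lambda>q. snd \<phi> q (cls q (coord_vec M c b q))) \<circ> chart_inv c"
  have pT: "?p ` ?T \<subseteq> snd c ` (S \<inter> fst c)"
  proof
    fix x assume "x \<in> ?p ` ?T"
    then obtain y where y: "?p y \<in> snd c ` fst c" "x = ?p y" by blast
    note q = chart_inv_orth_proj[OF c y(1)]
    show "x \<in> snd c ` (S \<inter> fst c)"
      by (rule image_eqI[of _ _ "chart_inv c (?p y)"]) (use q y(2) in auto)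
  qed
  have sp: "smooth_on ?T ?p" by (rule smooth_on_bounded_linear[OF p(1)])
  have 1: "smooth_on ?T ((fst \<phi> \<circ> chart_inv c) \<circ> ?p)"
    by (rule smooth_on_compose[OF sp smooth_fun_chart[OF affine_functionsD(1)[OF \<phi>] cM] pT])
  have 2: "smooth_on ?T (?g b \<circ> ?p)" for b
    by (rule smooth_on_compose[OF sp affine_functionsD(5)[OF \<phi> cM] pT])
  have 3: "smooth_on ?T (\<lambda>y. (y - ?p y) \<bullet> b)" for b
    by (rule smooth_on_bilinear[OF bounded_bilinear_inner
          smooth_on_diff[OF smooth_on_bounded_linear[OF bounded_linear_ident] sp] smooth_on_const])
  have "smooth_on ?T (\<lambda>y. ((fst \<phi> \<circ> chart_inv c) \<circ> ?p) y + (\<Sum>b\<in>Basis. ((y - ?p y) \<bullet> b) * (?g b \<circ> ?p) y))"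
    by (rule smooth_on_add[OF 1 smooth_on_sum[OF smooth_on_mult[OF 3 2]]])
  then have "smooth_on ?T (affine_fun \<phi> \<circ> chart_inv \<nu>)"
  proof (rule smooth_on_cong)
    fix y assume "y \<in> ?T"
    then have y: "?p y \<in> snd c ` fst c" by simp
    note q = chart_inv_orth_proj[OF c y]
    have "chart_inv \<nu> y = normal_chart_inv c W y"
      using chart_inv_normal[OF \<nu>, unfolded \<nu>', OF normal_chart_inv_right(1)[OF c y]]
      unfolding normal_chart_inv_right(2)[OF c y] \<nu>' .
    then show "((fst \<phi> \<circ> chart_inv c) \<circ> ?p) y + (\<Sum>b\<in>Basis. ((y - ?p y) \<bullet> b) * (?g b \<circ> ?p) y) =
        (affine_fun \<phi> \<circ> chart_inv \<nu>) y"
      using conormal_coords[OF affine_functionsD(3)[OF \<phi> q(1)] cM q(2), of "y - ?p y"]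
      by (simp add: affine_fun_def normal_chart_inv_def Let_def)
  qed
  then show ?thesis unfolding \<nu>' normal_chart_range[OF c] .
qed

end

section \<open>First order jets along the zero section\<close>

locale exponential = poisson_sub M \<pi> S for M :: "('m, 'a::euclidean_space) chart set" and \<pi> S +
  fixes e :: "'m \<times> ('m, 'a) tvec set \<Rightarrow> 'm"
  assumes exponential_map: "exponential_map M S e"
begin

abbreviation "Om \<equiv> e ` N"
abbreviation "ie \<equiv> inv_into N e"

text \<open>The retraction \<rho> of e(E) onto S.\<close>

definition base_point :: "'m \<Rightarrow> 'm" where "base_point p = fst (ie p)"

lemmas exp_conds = exponential_map[unfolded exponential_map_def]
lemmas open_Om = exp_conds[THEN conjunct1]
  and inj_e = exp_conds[THEN conjunct2, THEN conjunct1]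
  and smooth_e = exp_conds[THEN conjunct2, THEN conjunct2, THEN conjunct1]
  and smooth_ie = exp_conds[THEN conjunct2, THEN conjunct2, THEN conjunct2, THEN conjunct1]
  and e_zero = exp_conds[THEN conjunct2, THEN conjunct2, THEN conjunct2, THEN conjunct2, THEN conjunct1, rule_format]
  and e_velocity = exp_conds[THEN conjunct2, THEN conjunct2, THEN conjunct2, THEN conjunct2, THEN conjunct2, rule_format]

lemma ie_in: "p \<in> Om \<Longrightarrow> ie p \<in> N"
  by (rule inv_into_into)

lemma ie_e: "z \<in> N \<Longrightarrow> ie (e z) = z"
  by (rule inv_into_f_f[OF inj_e])

lemma ie_S: "q \<in> S \<Longrightarrow> ie q = zero_section M S q"
  using ie_e[OF zero_section_in] by (simp only: e_zero)

lemma S_Om: "q \<in> S \<Longrightarrow> q \<in> Om"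
  using e_zero zero_section_in by (metis imageI)

lemma Om_points: "p \<in> Om \<Longrightarrow> p \<in> points M"
  using open_Om openin_top[of Om] by blast

lemma base_point_in: "p \<in> Om \<Longrightarrow> base_point p \<in> S"
  using ie_in[of p] unfolding base_point_def by (rule normal_bundleE) simp_all

lemma base_point_S: "q \<in> S \<Longrightarrow> base_point q = q"
  by (simp add: base_point_def ie_S zero_section_def)

section \<open>The exponential map in charts\<close>

lemma restrict_atlas_inj: "d \<in> restrict_atlas M Om \<Longrightarrow> inj_on (snd d) (fst d)"
  unfolding restrict_atlas_def by (erule imageE) (simp add: inj_on_Int[OF disjI1] inj_chart)

lemma points_restrict: "points (restrict_atlas M Om) = Om"
  using Om_points by (auto simp: points_def restrict_atlas_def)

lemma openin_restrict:
  "openin (atlas_topology (restrict_atlas M Om)) V \<longleftrightarrow> V \<subseteq> Om \<and> openin mtop V"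
proof -
  have "openin (atlas_topology (restrict_atlas M Om)) V \<longleftrightarrow>
      V \<subseteq> Om \<and> (\<forall>c\<in>M. open (snd c ` (V \<inter> (fst c \<inter> Om))))"
    using openin_atlas_topology[of "restrict_atlas M Om" V, OF restrict_atlas_inj]
    unfolding points_restrict by (simp add: restrict_atlas_def)
  also have "\<dots> \<longleftrightarrow> V \<subseteq> Om \<and> openin mtop V"
  proof (cases "V \<subseteq> Om")
    case True
    then have "V \<inter> (fst c \<inter> Om) = V \<inter> fst c" for c :: "('m, 'a) chart" by blast
    moreover have "V \<subseteq> points M" using True Om_points by blast
    ultimately show ?thesis by (simp only: openin_top simp_thms)
  qed simp
  finally show ?thesis .
qed

lemma topspace_restrict: "topspace (atlas_topology (restrict_atlas M Om)) = Om"
proof (rule topspace_atlas_topology[of "restrict_atlas M Om", OF restrict_atlas_inj, unfolded points_restrict])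
  fix d assume "d \<in> restrict_atlas M Om"
  then obtain c where "c \<in> M" "d = (fst c \<inter> Om, snd c)" by (auto simp: restrict_atlas_def)
  then show "open (snd d ` fst d)" using open_image[OF open_Om, of c] by (simp add: Int_commute)
qed

lemma topspace_normal: "topspace (atlas_topology NA) = N"
  using topspace_atlas_topology[of NA, OF inj_normal_atlas open_normal_atlas] by (simp add: points_normal_atlas)

text \<open>\<open>exponential_map\<close> refers to the restricted atlas on e(E); here its charts
  are traded for those of M, since points e z lie in \<open>Om\<close> anyway. Openness comes from
  continuity of e.\<close>

lemma e_in_charts:
  assumes \<nu>: "\<nu> \<in> NA" and d: "d \<in> M"
  shows "open (snd \<nu> ` {z \<in> fst \<nu>. e z \<in> fst d})"
    and "smooth_on (snd \<nu> ` {z \<in> fst \<nu>. e z \<in> fst d}) (snd d \<circ> e \<circ> chart_inv \<nu>)"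
proof -
  let ?d = "(fst d \<inter> Om, snd d)"
  have mem: "?d \<in> restrict_atlas M Om" using d by (auto simp: restrict_atlas_def)
  have set_eq: "{z \<in> fst \<nu>. e z \<in> fst ?d} = {z \<in> fst \<nu>. e z \<in> fst d}"
    using normal_atlas_subset[OF \<nu>] by auto
  have "smooth_on (snd \<nu> ` {z \<in> fst \<nu>. e z \<in> fst ?d}) (snd ?d \<circ> e \<circ> chart_inv \<nu>)"
    using smooth_e \<nu> mem unfolding smooth_map_def by blast
  then show "smooth_on (snd \<nu> ` {z \<in> fst \<nu>. e z \<in> fst d}) (snd d \<circ> e \<circ> chart_inv \<nu>)"
    unfolding set_eq by simp
  have "openin (atlas_topology (restrict_atlas M Om)) (fst d \<inter> Om)"
    unfolding openin_restrict using openin_Int[OF openin_chart[OF d] open_Om] by simp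
  then have "openin (atlas_topology NA) {z \<in> N. e z \<in> fst d \<inter> Om}"
    using smooth_e openin_continuous_map_preimage[of "atlas_topology NA" _ e] topspace_normal
    unfolding smooth_map_def by fastforce
  then have "open (snd \<nu> ` ({z \<in> N. e z \<in> fst d \<inter> Om} \<inter> fst \<nu>))"
    using \<nu> unfolding openin_normal_atlas by blast
  moreover have "{z \<in> N. e z \<in> fst d \<inter> Om} \<inter> fst \<nu> = {z \<in> fst \<nu>. e z \<in> fst d}"
    using normal_atlas_subset[OF \<nu>] by auto
  ultimately show "open (snd \<nu> ` {z \<in> fst \<nu>. e z \<in> fst d})" by simp
qed

lemma ie_in_charts:
  assumes \<nu>: "\<nu> \<in> NA" and c: "c \<in> M"
  shows "openin mtop {p \<in> Om. ie p \<in> fst \<nu>}"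
    and "smooth_on (snd c ` ({p \<in> Om. ie p \<in> fst \<nu>} \<inter> fst c)) (snd \<nu> \<circ> ie \<circ> chart_inv c)"
proof -
  let ?c = "(fst c \<inter> Om, snd c)"
  have mem: "?c \<in> restrict_atlas M Om" using c by (auto simp: restrict_atlas_def)
  have "smooth_on (snd ?c ` {p \<in> fst ?c. ie p \<in> fst \<nu>}) (snd \<nu> \<circ> ie \<circ> chart_inv ?c)"
    using smooth_ie \<nu> mem unfolding smooth_map_def by blast
  \<comment> \<open>The inverse of the restricted chart is taken over a smaller domain; it agrees
    with \<open>chart_inv c\<close> on the coordinates of that domain, hence the congruence.\<close>
  then have "smooth_on (snd ?c ` {p \<in> fst ?c. ie p \<in> fst \<nu>}) (snd \<nu> \<circ> ie \<circ> chart_inv c)"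
  proof (rule smooth_on_cong)
    fix x assume "x \<in> snd ?c ` {p \<in> fst ?c. ie p \<in> fst \<nu>}"
    then obtain p where p: "p \<in> fst ?c" "x = snd ?c p" by blast
    have "chart_inv ?c (snd ?c p) = p" using chart_inv_left[OF restrict_atlas_inj[OF mem] p(1)] .
    moreover have "chart_inv c (snd c p) = p" using p c by simp
    ultimately show "(snd \<nu> \<circ> ie \<circ> chart_inv ?c) x = (snd \<nu> \<circ> ie \<circ> chart_inv c) x" using p by simp
  qed
  moreover have "snd ?c ` {p \<in> fst ?c. ie p \<in> fst \<nu>} = snd c ` ({p \<in> Om. ie p \<in> fst \<nu>} \<inter> fst c)" by auto
  ultimately show "smooth_on (snd c ` ({p \<in> Om. ie p \<in> fst \<nu>} \<inter> fst c)) (snd \<nu> \<circ> ie \<circ> chart_inv c)" by simp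
  have "openin (atlas_topology (restrict_atlas M Om)) {p \<in> Om. ie p \<in> fst \<nu>}"
    using smooth_ie openin_continuous_map_preimage[of "atlas_topology (restrict_atlas M Om)" _ ie, OF _ openin_normal_chart[OF \<nu>]]
    unfolding smooth_map_def topspace_restrict by blast
  then show "openin mtop {p \<in> Om. ie p \<in> fst \<nu>}" unfolding openin_restrict by blast
qed

text \<open>The calculus of \<open>manifold\<close> is set up for M and not for the normal charts of
  E, so the chain rule for G after e is done with one explicit chart on each side.\<close>

lemma pullback_chain_rule:
  assumes G: "smooth_fun M Om G" and \<nu>: "\<nu> \<in> NA" and z: "z \<in> fst \<nu>" and d: "d \<in> M" "e z \<in> fst d"
  shows "((G \<circ> e \<circ> chart_inv \<nu>) has_derivative
    (\<lambda>w. cderiv d G (e z) (frechet_derivative (snd d \<circ> e \<circ> chart_inv \<nu>) (at (snd \<nu> z)) w))) (at (snd \<nu> z))"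
proof -
  let ?t = "snd d \<circ> e \<circ> chart_inv \<nu>"
  let ?D = "frechet_derivative ?t (at (snd \<nu> z))"
  let ?U = "snd \<nu> ` {z \<in> fst \<nu>. e z \<in> fst d}"
  have x: "snd \<nu> z \<in> ?U" using z d by blast
  note U = e_in_charts[OF \<nu> d(1)]
  have ez: "e z \<in> Om" using normal_atlas_subset[OF \<nu>] z by blast
  have 1: "(?t has_derivative ?D) (at (snd \<nu> z))"
    by (rule smooth_on_has_derivative[OF U x])
  have v: "?t (snd \<nu> z) = snd d (e z)" using \<nu> z by simp
  have 2: "((G \<circ> chart_inv d) has_derivative cderiv d G (e z)) (at (?t (snd \<nu> z)))"
    unfolding v by (rule smooth_fun_has_derivative[OF open_Om G ez d])
  have 3: "((G \<circ> chart_inv d) \<circ> ?t has_derivative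
      cderiv d G (e z) \<circ> ?D) (at (snd \<nu> z))"
    by (rule diff_chain_at[OF 1 2])
  have "(G \<circ> e \<circ> chart_inv \<nu> has_derivative
      cderiv d G (e z) \<circ> ?D) (at (snd \<nu> z))"
  proof (rule has_derivative_transform_within_open[OF 3 U(1) x])
    fix y assume "y \<in> ?U"
    then obtain z' where z': "z' \<in> fst \<nu>" "e z' \<in> fst d" "y = snd \<nu> z'" by blast
    then show "((G \<circ> chart_inv d) \<circ> ?t) y = (G \<circ> e \<circ> chart_inv \<nu>) y"
      using \<nu> d by simp
  qed
  then show ?thesis by (simp add: o_def)
qed

lemma pullback_smooth:
  assumes G: "smooth_fun M Om G" and \<nu>: "\<nu> \<in> NA"
  shows "smooth_on (snd \<nu> ` fst \<nu>) (G \<circ> e \<circ> chart_inv \<nu>)"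
proof (rule smooth_on_local)
  fix x assume "x \<in> snd \<nu> ` fst \<nu>"
  then obtain z where z: "z \<in> fst \<nu>" "x = snd \<nu> z" by (elim imageE)
  have ez: "e z \<in> Om" using normal_atlas_subset[OF \<nu>] z by blast
  obtain d where d: "d \<in> M" "e z \<in> fst d" using Om_points[OF ez] chart_exists by blast
  let ?U = "snd \<nu> ` {z \<in> fst \<nu>. e z \<in> fst d}"
  let ?t = "snd d \<circ> e \<circ> chart_inv \<nu>"
  note U = e_in_charts[OF \<nu> d(1)]
  have "smooth_on ?U ((G \<circ> chart_inv d) \<circ> ?t)"
  proof (rule smooth_on_compose[OF U(2) smooth_fun_chart[OF G d(1)]])
    show "?t ` ?U \<subseteq> snd d ` (Om \<inter> fst d)"
    proof
      fix y assume "y \<in> ?t ` ?U"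
      then obtain z' where z': "z' \<in> fst \<nu>" "e z' \<in> fst d" "y = ?t (snd \<nu> z')" by blast
      have "y = snd d (e z')" using z'(3) chart_inv_normal[OF \<nu> z'(1)] by simp
      then show "y \<in> snd d ` (Om \<inter> fst d)" using z'(1,2) normal_atlas_subset[OF \<nu>] by blast
    qed
  qed
  then have "smooth_on ?U (G \<circ> e \<circ> chart_inv \<nu>)"
  proof (rule smooth_on_cong)
    fix y assume "y \<in> ?U"
    then obtain z' where "z' \<in> fst \<nu>" "e z' \<in> fst d" "y = snd \<nu> z'" by blast
    then show "((G \<circ> chart_inv d) \<circ> ?t) y = (G \<circ> e \<circ> chart_inv \<nu>) y"
      using \<nu> d by simp
  qed
  then have sub: "smooth_on (snd \<nu> ` fst \<nu> \<inter> ?U) (G \<circ> e \<circ> chart_inv \<nu>)"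
    by (rule smooth_on_subset) (rule Int_lower2)
  have "x \<in> ?U" unfolding z(2) by (rule imageI) (simp add: z d)
  with U(1) sub show "\<exists>U. open U \<and> x \<in> U \<and> smooth_on (snd \<nu> ` fst \<nu> \<inter> U) (G \<circ> e \<circ> chart_inv \<nu>)"
    by (intro exI[of _ ?U] conjI)
qed

section \<open>Functions near S induced by affine functions\<close>

definition pushed :: "('m, 'a) affine \<Rightarrow> 'm \<Rightarrow> real"
  where "pushed \<phi> = affine_fun \<phi> \<circ> ie"

lemma pushed_smooth:
  assumes \<phi>: "\<phi> \<in> Aff"
  shows "smooth_fun M Om (pushed \<phi>)"
proof (rule smooth_funI)
  fix p assume p: "p \<in> Om"
  obtain \<nu> where \<nu>: "\<nu> \<in> NA" "ie p \<in> fst \<nu>" using ie_in[OF p] by (rule normal_chart_exists)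
  obtain c where c: "c \<in> M" "p \<in> fst c" using Om_points[OF p] chart_exists by blast
  let ?W = "{p \<in> Om. ie p \<in> fst \<nu>}"
  note W = ie_in_charts[OF \<nu>(1) c(1)]
  have sub: "(snd \<nu> \<circ> ie \<circ> chart_inv c) ` (snd c ` (?W \<inter> fst c)) \<subseteq> snd \<nu> ` fst \<nu>"
  proof (intro image_subsetI, elim imageE)
    fix x r assume r: "r \<in> ?W \<inter> fst c" "x = snd c r"
    then have "(snd \<nu> \<circ> ie \<circ> chart_inv c) x = snd \<nu> (ie r)" using c by simp
    then show "(snd \<nu> \<circ> ie \<circ> chart_inv c) x \<in> snd \<nu> ` fst \<nu>" using r(1) by simp
  qed
  have "smooth_on (snd c ` (?W \<inter> fst c)) ((affine_fun \<phi> \<circ> chart_inv \<nu>) \<circ> (snd \<nu> \<circ> ie \<circ> chart_inv c))"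
    by (rule smooth_on_compose[OF W(2) affine_fun_smooth[OF \<phi> \<nu>(1)] sub])
  then have "smooth_on (snd c ` (?W \<inter> fst c)) (pushed \<phi> \<circ> chart_inv c)"
  proof (rule smooth_on_cong, elim imageE)
    fix x r assume r: "r \<in> ?W \<inter> fst c" "x = snd c r"
    then show "((affine_fun \<phi> \<circ> chart_inv \<nu>) \<circ> (snd \<nu> \<circ> ie \<circ> chart_inv c)) x = (pushed \<phi> \<circ> chart_inv c) x"
      using c \<nu> by (simp add: pushed_def)
  qed
  moreover have "p \<in> ?W" using p \<nu>(2) by simp
  ultimately show "\<exists>c\<in>M. \<exists>W. p \<in> fst c \<and> p \<in> W \<and> openin mtop W \<and>
    smooth_on (snd c ` (W \<inter> fst c)) (pushed \<phi> \<circ> chart_inv c)"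
    using c W(1) by (intro bexI[of _ c] exI[of _ ?W] conjI)
qed

lemma zero_conormal_section: "0 \<in> conormal_sections M S"
  by (simp add: conormal_sections_def conormal_space_def o_def)

lemma base_affine:
  assumes F: "smooth_fun M Om F"
  shows "(\<lambda>q. if q \<in> S then F q else 0) \<in> smooth_functions M S"
proof -
  have "smooth_fun M S F" using smooth_fun_subset[OF F] S_Om by blast
  then have "smooth_fun M S (\<lambda>q. if q \<in> S then F q else 0)"
    by (rule smooth_fun_cong) simp
  then show ?thesis by (simp add: smooth_functions_def)
qed

text \<open>F after \<rho> is induced by the affine function with base part F|S and linear part 0,
  so \<open>pushed_smooth\<close> applies.\<close>

lemma base_point_smooth:
  assumes F: "smooth_fun M Om F"
  shows "smooth_fun M Om (\<lambda>p. F (base_point p))"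
proof -
  have "(\<lambda>q. if q \<in> S then F q else 0, 0) \<in> Aff"
    using base_affine[OF F] zero_conormal_section by (simp add: affine_functions_def)
  from pushed_smooth[OF this] show ?thesis
    by (rule smooth_fun_cong) (use base_point_in in \<open>auto simp: pushed_def affine_fun_def base_point_def\<close>)
qed

lemma pushed_S: "\<phi> \<in> Aff \<Longrightarrow> q \<in> S \<Longrightarrow> pushed \<phi> q = fst \<phi> q"
  using conormalD(3)[OF affine_functionsD(3)[of \<phi> q]]
  by (simp add: pushed_def ie_S affine_fun_def zero_section_def)

text \<open>This is where the normalisation of \<open>d e\<close> along the fibres enters.\<close>

lemma differential_pushed_linear:
  assumes \<eta>: "\<eta> \<in> conormal_sections M S" and q: "q \<in> S"
  shows "dM (pushed (0, \<eta>)) q = nu q (\<eta> q)"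
proof
  fix X
  let ?F = "pushed (0, \<eta>)"
  have \<phi>: "(0, \<eta>) \<in> Aff"
    using \<eta> by (simp add: affine_functions_def smooth_functions_def smooth_fun_def o_def)
  note F = pushed_smooth[OF \<phi>]
  show "dM ?F q X = nu q (\<eta> q) X"
  proof (cases "X \<in> TM q")
    case X: True
    let ?o = "zero_section M S q"
    define \<gamma> where "\<gamma> t = (q, normal_scale M S q t (cls q X))" for t
    define V where "V = tangent_map NA M e ?o (velocity NA \<gamma>)"
    have \<gamma>: "\<gamma> t = (q, cls q (t *\<^sub>R X))" for t by (simp add: \<gamma>_def normal_scale_class[OF q])
    have tX: "t *\<^sub>R X \<in> TM q" for t by (rule subspace_scale[OF subspace_TM X])
    have \<gamma>N: "\<gamma> t \<in> N" for t unfolding \<gamma> by (rule normal_bundleI[OF q tX])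
    \<comment> \<open>By the normalisation, V (the velocity at t = 0 of e(t z), z the class of X)
      and X differ by a vector tangent to S. The differential of \<open>?F\<close> kills that vector
      because \<open>?F\<close> is 0 on S.\<close>
    have "cls q V = cls q X"
      using e_velocity[OF q, of "cls q X"] X unfolding V_def \<gamma>_def normal_space_def by blast
    then have VX: "V - X \<in> TS q" by (simp add: normal_class_eq_iff[OF q])
    have VT: "V \<in> TM q"
      using subspace_add[OF subspace_TM, of "V - X" q X] VX TS_subset X by auto
    have "?F p = 0" if "p \<in> S" for p using pushed_S[OF \<phi> that] by simp
    then have "dM ?F q (V - X) = 0"
      by (intro differential_on_TS[OF q open_Om S_Om[OF q] F _ VX])
    then have dVX: "dM ?F q V = dM ?F q X"
      using dual_space_minus[OF differential_smooth[OF open_Om S_Om[OF q] F] subspace_TM VT X] by simp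
    obtain d where d: "d \<in> M" "q \<in> fst d" using S_points[OF q] chart_exists by blast
    \<comment> \<open>The chart in which \<open>tangent_map\<close> takes the derivative.\<close>
    define \<nu> where "\<nu> = chart_at NA ?o"
    note \<nu> = chart_at_zero_section[OF q, folded \<nu>_def]
    obtain c W where c: "slice_chart M S c W" "\<nu> = normal_chart S M c W" using \<nu>(1) by (rule normal_atlasE)
    have qc: "q \<in> fst c" using \<nu>(2) c fst_normal_chart[OF c(1)] by (auto simp: zero_section_def)
    have \<gamma>\<nu>: "\<gamma> t \<in> fst \<nu>" for t using \<gamma>N[of t] qc fst_normal_chart[OF c(1)] c(2) by (auto simp: \<gamma>)
    have \<gamma>0: "\<gamma> 0 = ?o" by (simp add: \<gamma> zero_section_def)
    define v where "v = X c - orth_proj W (X c)"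
    note l = bounded_linear.linear[OF orth_proj(1)[OF slice_subspace[OF c(1)]]]
    \<comment> \<open>The curve t z is a straight line in the normal chart, in the direction of the
      orthogonal part of \<open>X c\<close>.\<close>
    have \<nu>\<gamma>: "snd \<nu> (\<gamma> t) = snd c q + t *\<^sub>R v" for t
      using normal_chart_value[OF c(1) q qc tX[of t]] linear_scale[OF l, of t "X c"]
      by (simp add: \<gamma> c(2) v_def scaleR_fun_apply scaleR_diff_right)
    have "((\<lambda>t. snd \<nu> (\<gamma> t)) has_vector_derivative v) (at 0)"
      unfolding \<nu>\<gamma> by (auto intro!: derivative_eq_intros)
    then have "velocity NA \<gamma> \<nu> = v"
      using \<nu>(1) \<gamma>\<nu>[of 0] vector_derivative_at by (simp add: velocity_def)
    then have Vd: "V d = frechet_derivative (snd d \<circ> e \<circ> chart_inv \<nu>) (at (snd \<nu> ?o)) v"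
      using d e_zero[OF q] by (simp add: V_def tangent_map_def Let_def flip: \<nu>_def)
    have "(?F \<circ> e \<circ> chart_inv \<nu> has_derivative
      (\<lambda>w. cderiv d ?F (e ?o) (frechet_derivative (snd d \<circ> e \<circ> chart_inv \<nu>) (at (snd \<nu> ?o)) w))) (at (snd \<nu> ?o))"
      by (rule pullback_chain_rule[OF F \<nu> d(1)]) (simp add: e_zero[OF q] d)
    moreover have "snd \<nu> ?o = snd c q + 0 *\<^sub>R v" using \<nu>\<gamma>[of 0] \<gamma>0 by simp
    \<comment> \<open>Two evaluations of the derivative at 0 of \<open>?F\<close> along e(t z): by
      the chain rule it is the differential of \<open>?F\<close> at V, and directly it is \<eta>(z),
      because the function is t \<eta>(z).\<close>
    ultimately have "((\<lambda>t. (?F \<circ> e \<circ> chart_inv \<nu>) (snd c q + t *\<^sub>R v)) has_vector_derivative cderiv d ?F q (V d)) (at 0)"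
      using has_vector_derivative_along_line[of "?F \<circ> e \<circ> chart_inv \<nu>" _ "snd c q" 0 v] e_zero[OF q] Vd by simp
    moreover have "(?F \<circ> e \<circ> chart_inv \<nu>) (snd c q + t *\<^sub>R v) = t * \<eta> q (cls q X)" for t
    proof -
      have "(?F \<circ> e \<circ> chart_inv \<nu>) (snd c q + t *\<^sub>R v) = ?F (e (\<gamma> t))"
        using \<gamma>\<nu>[of t] \<nu>(1) by (simp flip: \<nu>\<gamma>)
      also have "\<dots> = \<eta> q (cls q (t *\<^sub>R X))"
        using ie_e[OF \<gamma>N[of t]] by (simp add: pushed_def affine_fun_def \<gamma>)
      also have "\<dots> = t * \<eta> q (cls q X)"
        using conormalD(2)[OF _ X, of "\<eta> q" t] \<eta> q by (simp add: conormal_sections_def)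
      finally show ?thesis .
    qed
    ultimately have "((\<lambda>t. t * \<eta> q (cls q X)) has_vector_derivative cderiv d ?F q (V d)) (at 0)" by simp
    moreover have "((\<lambda>t. t * \<eta> q (cls q X)) has_vector_derivative \<eta> q (cls q X)) (at 0)"
      by (auto intro!: derivative_eq_intros simp flip: has_real_derivative_iff_has_vector_derivative)
    ultimately have "cderiv d ?F q (V d) = \<eta> q (cls q X)" by (rule vector_derivative_unique_at)
    then have "dM ?F q V = \<eta> q (cls q X)"
      using differential_eq[OF d smooth_fun_chart_diff[OF open_Om F S_Om[OF q] d] VT] by simp
    then show ?thesis using dVX X by (simp add: nu_dual_def)
  qed (simp add: differential_def nu_dual_def)
qed

section \<open>The jet map and its kernel\<close>

definition jet :: "('m \<Rightarrow> real) \<Rightarrow> ('m, 'a) affine"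
  where "jet F = (\<lambda>q. if q \<in> S then F q else 0,
    \<lambda>q. if q \<in> S then descend q (dM (\<lambda>p. F p - F (base_point p)) q) else 0)"

text \<open>\<rho> fixes S pointwise. Subtracting F after \<rho> removes the part of dF tangent to
  S, which would prevent it from descending to the normal bundle.\<close>

lemma differential_vertical:
  assumes q: "q \<in> S" and F: "smooth_fun M Om F"
  shows "dM (\<lambda>p. F p - F (base_point p)) q \<in> CTM q"
    "X \<in> TS q \<Longrightarrow> dM (\<lambda>p. F p - F (base_point p)) q X = 0"
proof -
  note sm = smooth_fun_diff[OF F base_point_smooth[OF F]]
  show "dM (\<lambda>p. F p - F (base_point p)) q \<in> CTM q"
    by (rule differential_smooth[OF open_Om S_Om[OF q] sm])
  show "X \<in> TS q \<Longrightarrow> dM (\<lambda>p. F p - F (base_point p)) q X = 0"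
    by (rule differential_on_TS[OF q open_Om S_Om[OF q] sm, where a = 0]) (simp_all add: base_point_S)
qed

text \<open>In a chart of M the coefficients of the section are the directional derivatives of F
  minus F after \<rho>, hence smooth along S.\<close>

lemma jet_in:
  assumes F: "smooth_fun M Om F"
  shows "jet F \<in> Aff"
proof -
  let ?G = "\<lambda>p. F p - F (base_point p)"
  let ?\<eta> = "\<lambda>q. if q \<in> S then descend q (dM ?G q) else 0"
  note sm = smooth_fun_diff[OF F base_point_smooth[OF F]]
  have "smooth_on (snd c ` (S \<inter> fst c)) ((\<lambda>q. ?\<eta> q (cls q (coord_vec M c v q))) \<circ> chart_inv c)"
    if c: "c \<in> M" for c v
  proof -
    have "smooth_on (snd c ` (S \<inter> fst c)) ((\<lambda>q. cderiv c ?G q v) \<circ> chart_inv c)"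
      by (rule smooth_on_subset[OF smooth_on_cderiv[OF open_Om sm c]]) (use S_Om in blast)
    then show ?thesis
    proof (rule smooth_on_cong)
      fix x assume "x \<in> snd c ` (S \<inter> fst c)"
      then obtain q where q: "q \<in> S" "q \<in> fst c" "x = snd c q" by blast
      have "?\<eta> q (cls q (coord_vec M c v q)) = cderiv c ?G q v"
        using q descend_class[OF q(1) differential_vertical[OF q(1) F] coord_vec_in[OF c q(2)], of v]
          differential_coord_vec[OF c q(2) smooth_fun_chart_diff[OF open_Om sm S_Om[OF q(1)] c q(2)], of v]
        by simp
      then show "((\<lambda>q. cderiv c ?G q v) \<circ> chart_inv c) x = ((\<lambda>q. ?\<eta> q (cls q (coord_vec M c v q))) \<circ> chart_inv c) x"
        using q c by (simp only: o_apply chart_inv_chart)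
    qed
  qed
  moreover have "?\<eta> q \<in> Conormal q" if "q \<in> S" for q
    using that descend_in[OF that differential_vertical[OF that F]] by simp
  ultimately have "?\<eta> \<in> conormal_sections M S" by (simp add: conormal_sections_def)
  then show ?thesis using base_affine[OF F] by (simp add: jet_def affine_functions_def)
qed

lemma jet_cong:
  assumes "\<And>p. p \<in> Om \<Longrightarrow> F p = G p"
  shows "jet F = jet G"
proof -
  have D: "dM (\<lambda>p. F p - F (base_point p)) q = dM (\<lambda>p. G p - G (base_point p)) q" if "q \<in> S" for q
    by (rule differential_cong[OF open_Om S_Om[OF that]]) (simp add: assms S_Om[OF base_point_in])
  show ?thesis unfolding jet_def by (rule prod_eqI) (auto simp: D assms S_Om intro!: ext)
qed

lemma descend_linear:
  "descend q (\<gamma> + \<delta>) = descend q \<gamma> + descend q \<delta>"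
  "descend q (r *\<^sub>R \<gamma>) = r *\<^sub>R descend q \<gamma>"
  "descend q 0 = 0"
  by (auto simp: descend_def fun_eq_iff scaleR_fun_apply)

lemma jet_add:
  assumes F: "smooth_fun M Om F" and G: "smooth_fun M Om G"
  shows "jet (\<lambda>p. F p + G p) = jet F + jet G"
proof -
  have D: "dM (\<lambda>p. (F p + G p) - (F (base_point p) + G (base_point p))) q =
      dM (\<lambda>p. F p - F (base_point p)) q + dM (\<lambda>p. G p - G (base_point p)) q" if "q \<in> S" for q
  proof -
    have "dM (\<lambda>p. (F p - F (base_point p)) + (G p - G (base_point p))) q =
      dM (\<lambda>p. F p - F (base_point p)) q + dM (\<lambda>p. G p - G (base_point p)) q"
      by (rule differential_arith(1)[OF open_Om S_Om[OF that] smooth_fun_diff[OF F base_point_smooth[OF F]]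
            smooth_fun_diff[OF G base_point_smooth[OF G]]])
    then show ?thesis by (simp add: algebra_simps)
  qed
  show ?thesis
  proof (rule prod_eqI)
    show "snd (jet (\<lambda>p. F p + G p)) = snd (jet F + jet G)"
    proof
      fix q
      show "snd (jet (\<lambda>p. F p + G p)) q = snd (jet F + jet G) q"
        by (cases "q \<in> S") (simp_all add: jet_def D descend_linear)
    qed
  qed (auto simp: jet_def)
qed

text \<open>On S the point and its image under \<rho> coincide, so the product rules for FG and for
  its composite with \<rho> have the same coefficients. Their difference is the product of affine
  functions, with no quadratic term left.\<close>

lemma jet_mult:
  assumes F: "smooth_fun M Om F" and G: "smooth_fun M Om G"
  shows "jet (\<lambda>p. F p * G p) = affine_mult (jet F) (jet G)"
proof -
  note Fr = base_point_smooth[OF F] and Gr = base_point_smooth[OF G]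
  have D: "dM (\<lambda>p. F p * G p - F (base_point p) * G (base_point p)) q =
      F q *\<^sub>R dM (\<lambda>p. G p - G (base_point p)) q + G q *\<^sub>R dM (\<lambda>p. F p - F (base_point p)) q"
    if q: "q \<in> S" for q
  proof -
    note qOm = S_Om[OF q] 
    show ?thesis
      unfolding differential_arith(2)[OF open_Om qOm smooth_fun_mult[OF F G] smooth_fun_mult[OF Fr Gr]]
        differential_arith(3)[OF open_Om qOm F G] differential_arith(3)[OF open_Om qOm Fr Gr]
        differential_arith(2)[OF open_Om qOm F Fr] differential_arith(2)[OF open_Om qOm G Gr] base_point_S[OF q]
      by (simp add: algebra_simps)
  qed
  show ?thesis
  proof (rule prod_eqI)
    show "snd (jet (\<lambda>p. F p * G p)) = snd (affine_mult (jet F) (jet G))"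
    proof
      fix q
      show "snd (jet (\<lambda>p. F p * G p)) q = snd (affine_mult (jet F) (jet G)) q"
        by (cases "q \<in> S") (simp_all add: jet_def affine_mult_def D descend_linear)
    qed
  qed (auto simp: jet_def affine_mult_def)
qed

lemma jet_const_mult:
  assumes F: "smooth_fun M Om F"
  shows "jet (\<lambda>p. r * F p) = r *\<^sub>R jet F"
proof -
  have "jet (\<lambda>p. r) = (\<lambda>q. if q \<in> S then r else 0, 0)"
    unfolding jet_def
    by (rule prod_eqI) (auto simp: differential_const[OF S_points] descend_linear intro!: ext)
  then show ?thesis
    unfolding jet_mult[OF smooth_fun_const F]
    by (auto simp: affine_mult_def prod_eq_iff fun_eq_iff scaleR_fun_apply jet_def)
qed

text \<open>Subtracting the composite with \<rho> leaves the fibrewise linear part alone, whose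
  differential on S is given by \<open>differential_pushed_linear\<close>.\<close>

lemma jet_pushed:
  assumes \<phi>: "\<phi> \<in> Aff"
  shows "jet (pushed \<phi>) = \<phi>"
proof -
  have \<eta>: "snd \<phi> \<in> conormal_sections M S" using \<phi> by (auto simp: affine_functions_def)
  have "descend q (dM (\<lambda>p. pushed \<phi> p - pushed \<phi> (base_point p)) q) = snd \<phi> q" if q: "q \<in> S" for q
  proof -
    let ?d = "dM (\<lambda>p. pushed \<phi> p - pushed \<phi> (base_point p)) q"
    note v = differential_vertical[OF q pushed_smooth[OF \<phi>]]
    have "?d = dM (pushed (0, snd \<phi>)) q"
    proof (rule differential_cong[OF open_Om S_Om[OF q]])
      fix p assume p: "p \<in> Om"
      show "pushed \<phi> p - pushed \<phi> (base_point p) = pushed (0, snd \<phi>) p"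
        unfolding pushed_S[OF \<phi> base_point_in[OF p]]
        by (simp add: pushed_def affine_fun_def base_point_def)
    qed
    then have "?d = nu q (snd \<phi> q)" using differential_pushed_linear[OF \<eta> q] by simp
    then have "nu q (descend q ?d) = nu q (snd \<phi> q)"
      using nu_dual_descend[OF q v] by simp
    from nu_dual_inj[OF descend_in[OF q v] affine_functionsD(3)[OF \<phi> q] this] show ?thesis .
  qed
  then show ?thesis
    using pushed_S[OF \<phi>] affine_functionsD(2,4)[OF \<phi>] by (auto simp: jet_def prod_eq_iff fun_eq_iff)
qed

text \<open>Once F vanishes on S, its composite with \<rho> vanishes on all of e(E), and the section
  in the jet comes from dF itself.\<close>

lemma jet_zero_iff:
  assumes F: "smooth_fun M Om F"
  shows "jet F = 0 \<longleftrightarrow> (\<forall>q\<in>S. F q = 0 \<and> dM F q = 0)"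
proof -
  have dF: "dM (\<lambda>p. F p - F (base_point p)) q = dM F q" if q: "q \<in> S" and Z: "\<forall>q\<in>S. F q = 0" for q
    by (rule differential_cong[OF open_Om S_Om[OF q]]) (simp add: Z base_point_in)
  show ?thesis
  proof
    assume J: "jet F = 0"
    have Z: "\<forall>q\<in>S. F q = 0"
    proof
      fix q assume "q \<in> S"
      then have "F q = fst (jet F) q" by (simp add: jet_def)
      then show "F q = 0" by (simp add: J)
    qed
    have "dM F q = 0" if q: "q \<in> S" for q
    proof -
      have "descend q (dM (\<lambda>p. F p - F (base_point p)) q) = 0"
        using arg_cong[OF J, of "\<lambda>j. snd j q"] q unfolding jet_def by simp
      then have "nu q 0 = dM F q"
        using nu_dual_descend[OF q differential_vertical[OF q F]] dF[OF q Z] by simp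
      then show ?thesis unfolding nu_dual_def zero_fun_apply if_cancel by (simp add: zero_fun_def)
    qed
    with Z show "\<forall>q\<in>S. F q = 0 \<and> dM F q = 0" by blast
  next
    assume Z: "\<forall>q\<in>S. F q = 0 \<and> dM F q = 0"
    then have D: "dM (\<lambda>p. F p - F (base_point p)) q = 0" if "q \<in> S" for q
      using dF[OF that] that by simp
    show "jet F = 0"
      unfolding jet_def by (rule prod_eqI) (auto simp: Z D descend_linear intro!: ext)
  qed
qed

text \<open>Well-definedness on the quotient: the difference of F and F' vanishes to second order,
  and by \<open>bracket_second_order\<close> so does its bracket with H.\<close>

lemma jet_bracket_cong:
  assumes F: "smooth_fun M Om F" and F': "smooth_fun M Om F'" and H: "smooth_fun M Om H" and J: "jet F = jet F'"
  shows "jet (bracket F H) = jet (bracket F' H)"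
proof -
  let ?G = "\<lambda>p. F p - F' p"
  have G: "smooth_fun M Om ?G" by (rule smooth_fun_diff[OF F F'])
  have "jet F = jet (\<lambda>p. ?G p + F' p)" by simp
  also have "\<dots> = jet ?G + jet F'" by (rule jet_add[OF G F'])
  finally have "jet ?G = 0" using J by simp
  then have dG: "dM ?G p = 0" if "p \<in> S" for p using jet_zero_iff[OF G] that by blast
  have "jet (bracket ?G H) = 0"
    unfolding jet_zero_iff[OF bracket_smooth[OF open_Om G H]]
    using bracket_second_order[OF _ open_Om S_Om G H dG] by blast
  moreover have "jet (bracket F H) = jet (\<lambda>p. bracket ?G H p + bracket F' H p)"
  proof (rule jet_cong)
    fix p assume p: "p \<in> Om"
    show "bracket F H p = bracket ?G H p + bracket F' H p"
      using bracket_add_left[OF open_Om p G H F'] by simp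
  qed
  ultimately show ?thesis
    using jet_add[OF bracket_smooth[OF open_Om G H] bracket_smooth[OF open_Om F' H]] by simp
qed

section \<open>The bracket on affine functions\<close>

definition aff_bracket :: "('m, 'a) affine \<Rightarrow> ('m, 'a) affine \<Rightarrow> ('m, 'a) affine"
  where "aff_bracket \<phi> \<psi> = jet (bracket (pushed \<phi>) (pushed \<psi>))"

lemma pushed_bracket_smooth: "\<phi> \<in> Aff \<Longrightarrow> \<psi> \<in> Aff \<Longrightarrow> smooth_fun M Om (bracket (pushed \<phi>) (pushed \<psi>))"
  by (rule bracket_smooth[OF open_Om pushed_smooth pushed_smooth])

lemma aff_bracket_in: "\<phi> \<in> Aff \<Longrightarrow> \<psi> \<in> Aff \<Longrightarrow> aff_bracket \<phi> \<psi> \<in> Aff"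
  unfolding aff_bracket_def by (rule jet_in[OF pushed_bracket_smooth])

lemma pushed_add: "pushed (\<phi> + \<psi>) = (\<lambda>p. pushed \<phi> p + pushed \<psi> p)"
  and pushed_scale: "pushed (r *\<^sub>R \<phi>) = (\<lambda>p. r * pushed \<phi> p)"
  by (auto simp: pushed_def affine_fun_def fun_eq_iff scaleR_fun_apply algebra_simps)

text \<open>Closure of \<open>Aff\<close> is inherited through the jet: the sum is the jet of a sum
  of smooth functions, and scalar multiples and products are treated alike.\<close>

lemma Aff_add: "\<phi> \<in> Aff \<Longrightarrow> \<psi> \<in> Aff \<Longrightarrow> \<phi> + \<psi> \<in> Aff"
  using jet_in[OF smooth_fun_add[OF pushed_smooth pushed_smooth], of \<phi> \<psi>]
  by (simp add: jet_add pushed_smooth jet_pushed)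

lemma Aff_scale: "\<phi> \<in> Aff \<Longrightarrow> r *\<^sub>R \<phi> \<in> Aff"
  using jet_in[OF smooth_fun_mult[OF smooth_fun_const pushed_smooth], of \<phi> r]
  by (simp add: jet_const_mult pushed_smooth jet_pushed)

lemma Aff_mult: "\<phi> \<in> Aff \<Longrightarrow> \<psi> \<in> Aff \<Longrightarrow> affine_mult \<phi> \<psi> \<in> Aff"
  using jet_in[OF smooth_fun_mult[OF pushed_smooth pushed_smooth], of \<phi> \<psi>]
  by (simp add: jet_mult pushed_smooth jet_pushed)

lemma Aff_zero: "0 \<in> Aff"
proof -
  have "jet (\<lambda>p. 0) = 0"
    unfolding jet_zero_iff[OF smooth_fun_const] using differential_const[OF S_points] by simp
  then show ?thesis using jet_in[OF smooth_fun_const, of 0] by simp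
qed

lemma aff_bracket_antisym:
  assumes \<phi>: "\<phi> \<in> Aff" and \<psi>: "\<psi> \<in> Aff"
  shows "aff_bracket \<phi> \<psi> = - aff_bracket \<psi> \<phi>"
proof -
  have "aff_bracket \<phi> \<psi> = jet (\<lambda>p. -1 * bracket (pushed \<psi>) (pushed \<phi>) p)"
    unfolding aff_bracket_def
    by (rule jet_cong) (use bracket_antisym[OF open_Om _ pushed_smooth[OF \<phi>] pushed_smooth[OF \<psi>]] in simp)
  also have "\<dots> = - aff_bracket \<psi> \<phi>"
    unfolding jet_const_mult[OF pushed_bracket_smooth[OF \<psi> \<phi>]] by (simp add: aff_bracket_def)
  finally show ?thesis .
qed

lemma aff_bracket_add:
  assumes \<phi>: "\<phi> \<in> Aff" and \<psi>: "\<psi> \<in> Aff" and \<chi>: "\<theta> \<in> Aff"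
  shows "aff_bracket (\<phi> + \<psi>) \<theta> = aff_bracket \<phi> \<theta> + aff_bracket \<psi> \<theta>"
proof -
  have "aff_bracket (\<phi> + \<psi>) \<theta> = jet (\<lambda>p. bracket (pushed \<phi>) (pushed \<theta>) p + bracket (pushed \<psi>) (pushed \<theta>) p)"
    unfolding aff_bracket_def pushed_add
    by (rule jet_cong) (rule bracket_add_left[OF open_Om _ pushed_smooth[OF \<phi>] pushed_smooth[OF \<chi>] pushed_smooth[OF \<psi>]])
  then show ?thesis
    using jet_add[OF pushed_bracket_smooth[OF \<phi> \<chi>] pushed_bracket_smooth[OF \<psi> \<chi>]] by (simp add: aff_bracket_def)
qed

lemma aff_bracket_scale:
  assumes \<phi>: "\<phi> \<in> Aff" and \<psi>: "\<psi> \<in> Aff"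
  shows "aff_bracket (r *\<^sub>R \<phi>) \<psi> = r *\<^sub>R aff_bracket \<phi> \<psi>"
proof -
  have "aff_bracket (r *\<^sub>R \<phi>) \<psi> = jet (\<lambda>p. r * bracket (pushed \<phi>) (pushed \<psi>) p)"
    unfolding aff_bracket_def pushed_scale
    by (rule jet_cong) (rule bracket_const_mult[OF open_Om _ pushed_smooth[OF \<phi>] pushed_smooth[OF \<psi>]])
  then show ?thesis
    using jet_const_mult[OF pushed_bracket_smooth[OF \<phi> \<psi>]] by (simp add: aff_bracket_def)
qed

text \<open>Allows any representative in the second argument, not just the pushed one.
  \<open>jet_bracket_cong\<close> does this in the first argument and antisymmetry moves it
  over.\<close>

lemma aff_bracket_jet:
  assumes \<phi>: "\<phi> \<in> Aff" and F: "smooth_fun M Om F"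
  shows "aff_bracket \<phi> (jet F) = jet (bracket (pushed \<phi>) F)"
proof -
  note s = pushed_smooth[OF \<phi>] and t = pushed_smooth[OF jet_in[OF F]]
  have anti: "jet (bracket (pushed \<phi>) G) = - jet (bracket G (pushed \<phi>))" if G: "smooth_fun M Om G" for G
  proof -
    have "jet (bracket (pushed \<phi>) G) = jet (\<lambda>p. -1 * bracket G (pushed \<phi>) p)"
      by (rule jet_cong) (use bracket_antisym[OF open_Om _ s G] in simp)
    then show ?thesis using jet_const_mult[OF bracket_smooth[OF open_Om G s], of "-1"] by simp
  qed
  have "jet (bracket (pushed (jet F)) (pushed \<phi>)) = jet (bracket F (pushed \<phi>))"
    by (rule jet_bracket_cong[OF t F s jet_pushed[OF jet_in[OF F]]])
  then show ?thesis unfolding aff_bracket_def anti[OF t] anti[OF F] by simp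
qed

text \<open>The inner bracket is a jet by definition, so \<open>aff_bracket_jet\<close> turns each
  nested bracket into the jet of a nested Poisson bracket; the three add up to the jet of 0.\<close>

lemma aff_bracket_jacobi:
  assumes x: "x \<in> Aff" and y: "y \<in> Aff" and z: "z \<in> Aff"
  shows "aff_bracket x (aff_bracket y z) + aff_bracket y (aff_bracket z x) + aff_bracket z (aff_bracket x y) = 0"
proof -
  let ?P = "pushed"
  let ?B = "\<lambda>x y z. bracket (?P x) (bracket (?P y) (?P z))"
  have eq: "aff_bracket a (aff_bracket b c) = jet (?B a b c)" if "a \<in> Aff" "b \<in> Aff" "c \<in> Aff" for a b c
    unfolding aff_bracket_def[of b c] by (rule aff_bracket_jet[OF that(1) pushed_bracket_smooth[OF that(2,3)]])
  have s: "smooth_fun M Om (?B a b c)" if "a \<in> Aff" "b \<in> Aff" "c \<in> Aff" for a b c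
    by (rule bracket_smooth[OF open_Om pushed_smooth[OF that(1)] pushed_bracket_smooth[OF that(2,3)]])
  have "jet (?B x y z) + jet (?B y z x) + jet (?B z x y) = jet (\<lambda>p. (?B x y z p + ?B y z x p) + ?B z x y p)"
    unfolding jet_add[OF smooth_fun_add[OF s[OF x y z] s[OF y z x]] s[OF z x y]] jet_add[OF s[OF x y z] s[OF y z x]] ..
  also have "\<dots> = jet (\<lambda>p. 0)"
    by (rule jet_cong) (rule bracket_jacobi[OF open_Om _ pushed_smooth[OF x] pushed_smooth[OF y] pushed_smooth[OF z]])
  also have "\<dots> = 0"
    unfolding jet_zero_iff[OF smooth_fun_const] using differential_const[OF S_points] by simp
  finally show ?thesis by (simp only: eq x y z)
qed

lemma aff_bracket_leibniz:
  assumes x: "x \<in> Aff" and y: "y \<in> Aff" and z: "z \<in> Aff"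
  shows "aff_bracket x (affine_mult y z) = affine_mult (aff_bracket x y) z + affine_mult y (aff_bracket x z)"
proof -
  let ?P = "pushed"
  note sx = pushed_smooth[OF x] and sy = pushed_smooth[OF y] and sz = pushed_smooth[OF z]
  note sxy = pushed_bracket_smooth[OF x y] and sxz = pushed_bracket_smooth[OF x z]
  \<comment> \<open>The product of the pushed functions differs from the pushed product by a
    fibrewise quadratic term, but has the same jet.\<close>
  have "affine_mult y z = jet (\<lambda>p. ?P y p * ?P z p)"
    unfolding jet_mult[OF sy sz] jet_pushed[OF y] jet_pushed[OF z] ..
  then have "aff_bracket x (affine_mult y z) = jet (bracket (?P x) (\<lambda>p. ?P y p * ?P z p))"
    using aff_bracket_jet[OF x smooth_fun_mult[OF sy sz]] by simp
  also have "\<dots> = jet (\<lambda>p. bracket (?P x) (?P y) p * ?P z p + ?P y p * bracket (?P x) (?P z) p)"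
    by (rule jet_cong) (rule bracket_leibniz[OF open_Om _ sx sy sz])
  also have "\<dots> = affine_mult (aff_bracket x y) z + affine_mult y (aff_bracket x z)"
    unfolding jet_add[OF smooth_fun_mult[OF sxy sz] smooth_fun_mult[OF sy sxz]] jet_mult[OF sxy sz] jet_mult[OF sy sxz]
      jet_pushed[OF y] jet_pushed[OF z] aff_bracket_def ..
  finally show ?thesis .
qed

lemma affine_mult_commute: "affine_mult x y = affine_mult y x"
  by (auto simp: affine_mult_def mult.commute add.commute)

lemma affine_mult_add: "affine_mult (x + y) z = affine_mult x z + affine_mult y z"
  and affine_mult_scale: "affine_mult (r *\<^sub>R x) z = r *\<^sub>R affine_mult x z"
  and affine_mult_assoc: "affine_mult (affine_mult x y) z = affine_mult x (affine_mult y z)"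
  by (auto simp: affine_mult_def prod_eq_iff fun_eq_iff scaleR_fun_apply algebra_simps)

lemma aff_poisson_algebra: "poisson_algebra Aff affine_mult aff_bracket"
proof -
  have "bilinear_within Aff affine_mult"
    unfolding bilinear_within_def
  proof (intro conjI ballI allI)
    fix x y z :: "('m, 'a) affine"
    show "affine_mult (x + y) z = affine_mult x z + affine_mult y z"
      by (rule affine_mult_add)
    show "affine_mult z (x + y) = affine_mult z x + affine_mult z y"
      unfolding affine_mult_commute[of z] by (rule affine_mult_add)
  next
    fix r and x y :: "('m, 'a) affine"
    show "affine_mult (r *\<^sub>R x) y = r *\<^sub>R affine_mult x y"
      by (rule affine_mult_scale)
    show "affine_mult x (r *\<^sub>R y) = r *\<^sub>R affine_mult x y"
      unfolding affine_mult_commute[of x] by (rule affine_mult_scale)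
  qed (rule Aff_mult)
  moreover have "bilinear_within Aff aff_bracket"
    unfolding bilinear_within_def
  proof (intro conjI ballI allI)
    fix x y z assume x: "x \<in> Aff" and y: "y \<in> Aff" and z: "z \<in> Aff"
    show "aff_bracket (x + y) z = aff_bracket x z + aff_bracket y z"
      by (rule aff_bracket_add[OF x y z])
    show "aff_bracket z (x + y) = aff_bracket z x + aff_bracket z y"
      unfolding aff_bracket_antisym[OF z Aff_add[OF x y]] aff_bracket_add[OF x y z]
        aff_bracket_antisym[OF z x] aff_bracket_antisym[OF z y] by simp
  next
    fix r x y assume x: "x \<in> Aff" and y: "y \<in> Aff"
    show "aff_bracket (r *\<^sub>R x) y = r *\<^sub>R aff_bracket x y"
      by (rule aff_bracket_scale[OF x y])
    show "aff_bracket x (r *\<^sub>R y) = r *\<^sub>R aff_bracket x y"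
      unfolding aff_bracket_antisym[OF x Aff_scale[OF y]] aff_bracket_scale[OF y x] aff_bracket_antisym[OF x y] by simp
  qed (rule aff_bracket_in)
  \<comment> \<open>The derivation rule in the first argument, from the one in the second by
    antisymmetry.\<close>
  moreover have "aff_bracket (affine_mult x y) z = affine_mult x (aff_bracket y z) + affine_mult (aff_bracket x z) y"
    if x: "x \<in> Aff" and y: "y \<in> Aff" and z: "z \<in> Aff" for x y z
  proof -
    have m: "affine_mult (- u) v = - affine_mult u v" for u v
      using affine_mult_scale[of "-1" u v] by simp
    have "aff_bracket (affine_mult x y) z = - (affine_mult (aff_bracket z x) y + affine_mult x (aff_bracket z y))"
      by (simp only: aff_bracket_antisym[OF Aff_mult[OF x y] z] aff_bracket_leibniz[OF z x y])
    also have "\<dots> = affine_mult x (- aff_bracket z y) + affine_mult (- aff_bracket z x) y"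
      using affine_mult_commute[of x "- aff_bracket z y"] affine_mult_commute[of x "aff_bracket z y"] by (simp add: m)
    also have "\<dots> = affine_mult x (aff_bracket y z) + affine_mult (aff_bracket x z) y"
      by (simp only: aff_bracket_antisym[OF y z] aff_bracket_antisym[OF x z])
    finally show ?thesis .
  qed
  moreover have "subspace Aff"
    by (rule subspaceI) (auto intro: Aff_zero Aff_add Aff_scale)
  ultimately show ?thesis
    unfolding poisson_algebra_def
    by (intro conjI ballI affine_mult_commute affine_mult_assoc aff_bracket_antisym aff_bracket_jacobi aff_bracket_leibniz)
qed

lemma fst_aff_bracket:
  assumes x: "x \<in> Aff" and y: "y \<in> Aff"
  shows "fst (aff_bracket x y) = sub_bracket M \<pi> S (fst x) (fst y)"
proof
  fix q
  show "fst (aff_bracket x y) q = sub_bracket M \<pi> S (fst x) (fst y) q"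
  proof (cases "q \<in> S")
    case True
    have "sub_bracket M \<pi> S (fst x) (fst y) q = bracket (pushed x) (pushed y) q"
      by (rule sub_bracket_eq[OF True open_Om S_Om[OF True] pushed_smooth[OF x] pushed_smooth[OF y]])
        (simp_all add: pushed_S x y)
    then show ?thesis using True by (simp add: aff_bracket_def jet_def)
  qed (simp add: aff_bracket_def jet_def sub_bracket_def)
qed

lemma aff_bracket_linear:
  assumes \<eta>1: "\<eta>1 \<in> conormal_sections M S" and \<eta>2: "\<eta>2 \<in> conormal_sections M S"
  shows "aff_bracket (0, \<eta>1) (0, \<eta>2) = (0, conormal_bracket M \<pi> S \<eta>1 \<eta>2)"
proof -
  have z: "0 \<in> smooth_functions M S"
    using base_affine[OF smooth_fun_const, of 0] by (simp add: zero_fun_def)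
  have a1: "(0, \<eta>1) \<in> Aff" and a2: "(0, \<eta>2) \<in> Aff" using \<eta>1 \<eta>2 z by (simp_all add: affine_functions_def)
  let ?F = "pushed (0, \<eta>1)" and ?G = "pushed (0, \<eta>2)"
  note F = pushed_smooth[OF a1] and G = pushed_smooth[OF a2]
  let ?B = "bracket ?F ?G"
  note B = bracket_smooth[OF open_Om F G]
  \<comment> \<open>The anchor image of the differential of \<open>?F\<close> is tangent to S, and
    \<open>?G\<close> is 0 on S. This gives base part 0, and it makes the differential of
    \<open>?B\<close> itself the source of the section in the jet.\<close>
  have B0: "?B q = 0" if q: "q \<in> S" for q
  proof -
    have "dM ?G q (sharp M \<pi> q (dM ?F q)) = 0"
      by (rule differential_on_TS[OF q open_Om S_Om[OF q] G, where a = 0])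
        (simp_all add: pushed_S[OF a2] sharp_in_TS[OF q differential_smooth[OF open_Om S_Om[OF q] F]])
    then show ?thesis
      using covec_sharp[OF S_points[OF q] differential_smooth[OF open_Om S_Om[OF q] F] S_points[OF q]
          differential_smooth[OF open_Om S_Om[OF q] G]] S_points[OF q]
      by (simp add: poisson_bracket_def)
  qed
  have "descend q (dM (\<lambda>p. ?B p - ?B (base_point p)) q) = conormal_bracket M \<pi> S \<eta>1 \<eta>2 q"
    if q: "q \<in> S" for q
  proof -
    have eq: "dM (\<lambda>p. ?B p - ?B (base_point p)) q = dM ?B q"
      by (rule differential_cong[OF open_Om S_Om[OF q]]) (simp add: B0 base_point_in)
    note v = differential_vertical[OF q B, unfolded eq]
    show ?thesis
      unfolding eq
      by (rule conormal_bracket_eq[OF q open_Om S_Om[OF q] F G _ _ descend_in[OF q v] nu_dual_descend[OF q v], symmetric])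
        (simp_all add: differential_pushed_linear \<eta>1 \<eta>2)
  qed
  then show ?thesis
    using B0 by (auto simp: aff_bracket_def jet_def fun_eq_iff conormal_bracket_def)
qed

lemma aff_infinitesimal: "infinitesimal_poisson_algebra M \<pi> S aff_bracket"
proof -
  have "f \<in> fst ` Aff" if "f \<in> smooth_functions M S" for f
    using that zero_conormal_section by (intro image_eqI[of _ _ "(f, 0)"]) (auto simp: affine_functions_def)
  then have "fst ` Aff = smooth_functions M S" by (auto simp: affine_functions_def)
  moreover have "poisson_algebra_hom Aff affine_mult aff_bracket (smooth_functions M S) (*) (sub_bracket M \<pi> S) fst"
    unfolding poisson_algebra_hom_def by (simp add: fst_aff_bracket affine_functions_def affine_mult_def mem_Times_iff)
  ultimately show ?thesis
    using aff_poisson_algebra aff_bracket_linear by (simp add: infinitesimal_poisson_algebra_def)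
qed

text \<open>The error, a Poisson bracket minus the function pushed from its own jet, has jet 0
  because \<open>jet\<close> inverts \<open>pushed\<close>. It remains to carry its vanishing to
  second order from M to the charts of E.\<close>

lemma aff_first_order: "first_order_approximation M \<pi> S e aff_bracket"
  unfolding first_order_approximation_def
proof (intro ballI)
  fix \<phi>1 \<phi>2 assume \<phi>: "\<phi>1 \<in> Aff" "\<phi>2 \<in> Aff"
  let ?P = "bracket (pushed \<phi>1) (pushed \<phi>2)"
  let ?R = "\<lambda>p. ?P p - pushed (jet ?P) p"
  let ?h = "\<lambda>z. bracket (affine_fun \<phi>1 \<circ> ie) (affine_fun \<phi>2 \<circ> ie) (e z) - affine_fun (aff_bracket \<phi>1 \<phi>2) z"
  note P = pushed_bracket_smooth[OF \<phi>]
  note JP = pushed_smooth[OF jet_in[OF P]]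
  have R: "smooth_fun M Om ?R" by (rule smooth_fun_diff[OF P JP])
  have "jet ?P = jet (\<lambda>p. ?R p + pushed (jet ?P) p)" by simp
  also have "\<dots> = jet ?R + jet ?P" unfolding jet_add[OF R JP] jet_pushed[OF jet_in[OF P]] ..
  finally have "jet ?R = 0" by simp
  then have R0: "?R q = 0" "dM ?R q = 0" if "q \<in> S" for q
    using jet_zero_iff[OF R] that by blast+
  have h: "?h z = ?R (e z)" if "z \<in> N" for z
    using ie_e[OF that] by (simp add: pushed_def aff_bracket_def)
  have rep: "(?h \<circ> chart_inv \<nu>) y = (?R \<circ> e \<circ> chart_inv \<nu>) y" if "\<nu> \<in> NA" "y \<in> snd \<nu> ` fst \<nu>" for \<nu> y
    using h[of "chart_inv \<nu> y"] chart_inv_right(2)[OF that(2)] normal_atlas_subset[OF that(1)] by auto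
  have "smooth_fun NA N ?h"
    unfolding smooth_fun_def
  proof
    fix \<nu> assume \<nu>: "\<nu> \<in> NA"
    have "N \<inter> fst \<nu> = fst \<nu>" using normal_atlas_subset[OF \<nu>] by blast
    moreover have "smooth_on (snd \<nu> ` fst \<nu>) (?h \<circ> chart_inv \<nu>)"
      by (rule smooth_on_cong[OF pullback_smooth[OF R \<nu>]]) (rule rep[OF \<nu>, symmetric])
    ultimately show "smooth_on (snd \<nu> ` (N \<inter> fst \<nu>)) (?h \<circ> chart_inv \<nu>)" by simp
  qed
  moreover have "?h (zero_section M S q) = 0" if q: "q \<in> S" for q
    using h[OF zero_section_in[OF q]] e_zero[OF q] R0(1)[OF q] by simp
  moreover have "differential NA ?h (zero_section M S q) = 0" if q: "q \<in> S" for q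
  proof -
    let ?o = "zero_section M S q"
    \<comment> \<open>The chart in which \<open>differential\<close> on E is computed; by the chain
      rule the derivative there is 0 because that of \<open>?R\<close> at q is.\<close>
    define \<nu> where "\<nu> = chart_at NA ?o"
    note \<nu> = chart_at_zero_section[OF q, folded \<nu>_def]
    obtain d where d: "d \<in> M" "q \<in> fst d" using S_points[OF q] chart_exists by blast
    have "cderiv d ?R q w = 0" for w
      using differential_coord_vec[OF d smooth_fun_chart_diff[OF open_Om R S_Om[OF q] d], of w] R0(2)[OF q] by simp
    then have "(?R \<circ> e \<circ> chart_inv \<nu> has_derivative (\<lambda>w. 0)) (at (snd \<nu> ?o))"
      using pullback_chain_rule[OF R \<nu> d(1)] e_zero[OF q] d(2) by simp
    then have "frechet_derivative (?R \<circ> e \<circ> chart_inv \<nu>) (at (snd \<nu> ?o)) = (\<lambda>w. 0)"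
      by (rule frechet_derivative_at[symmetric])
    moreover have "frechet_derivative (?h \<circ> chart_inv \<nu>) (at (snd \<nu> ?o)) = frechet_derivative (?R \<circ> e \<circ> chart_inv \<nu>) (at (snd \<nu> ?o))"
      by (rule frechet_cong_open(1)[OF open_normal_atlas[OF \<nu>(1)] imageI[OF \<nu>(2)] rep[OF \<nu>(1)]])
    ultimately have "frechet_derivative (?h \<circ> chart_inv \<nu>) (at (snd \<nu> ?o)) = (\<lambda>w. 0)" by (rule trans[rotated])
    then show ?thesis
      unfolding differential_def Let_def \<nu>_def by (auto simp only: fun_eq_iff zero_fun_apply if_cancel)
  qed
  ultimately show "vanishes_to_second_order M S ?h" unfolding vanishes_to_second_order_def by blast
qed

end

theorem theorem3p3:
  fixes M :: "('m, 'a::euclidean_space) chart set"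
    and \<pi> :: "('m, 'a) tensor"
    and S :: "'m set"
    and e :: "'m \<times> ('m, 'a) tvec set \<Rightarrow> 'm"
  assumes "poisson_manifold M \<pi>"
    and "poisson_submanifold M \<pi> S"
    and "exponential_map M S e"
  shows "\<exists>br. infinitesimal_poisson_algebra M \<pi> S br \<and> first_order_approximation M \<pi> S e br"
proof -
  interpret exponential M \<pi> S e
    by unfold_locales (use assms in \<open>auto simp: poisson_manifold_def\<close>)
  show ?thesis using aff_infinitesimal aff_first_order by blast
qed

end
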